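(* Let $\lambda=(\lambda_1,\dots,\lambda_r)$ be a partition of $n$. Suppose that either $\lambda$ has at least four distinct parts, or $\lambda$ has exactly three distinct parts $a>b>c$ with $a\neq b+c$. Then $X_\lambda/S_n$ is not Cohen--Macaulay, and hence $X_\lambda$ is not Cohen--Macaulay.
   Context: Work over $\mathbb{C}$. For a partition $\lambda=(\lambda_1\ge\dots\ge\lambda_r)$ of $n$, let $E_\lambda\subset\mathbb{C}^n$ be the subspace defined by $x_1=\cdots=x_{\lambda_1}$, $x_{\lambda_1+1}=\cdots=x_{\lambda_1+\lambda_2}$, ..., $x_{n-\lambda_r+1}=\cdots=x_n$. Let $X_\lambda=S_n\cdot E_\lambda$ be the union of the $S_n$-translates of $E_\lambda$ (a reduced subspace arrangement in $\mathbb{C}^n$, with $S_n$ permuting coordinates), and $X_\lambda/S_n$ the quotient variety, with coordinate ring $\mathcal{O}(X_\lambda)^{S_n}$. *)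

theory Defs
  imports "HOL-Algebra.Algebra" "HOL-Combinatorics.Permutations" "HOL-Library.Extended_Nat" Complex_Main
begin

definition ht :: "('a, 'b) ring_scheme \<Rightarrow> 'a set \<Rightarrow> enat" where
  "ht R p = Sup {enat k | k. \<exists>P :: nat \<Rightarrow> 'a set.
      (\<forall>i\<le>k. primeideal (P i) R) \<and> (\<forall>i<k. P i \<subset> P (Suc i)) \<and> P k = p}"

definition regular_seq :: "('a, 'b) ring_scheme \<Rightarrow> (nat \<Rightarrow> 'a) \<Rightarrow> nat \<Rightarrow> bool" where
  "regular_seq R a k \<longleftrightarrow>
     (\<forall>i<k. a i \<in> carrier R) \<and>
     (\<forall>i<k. \<forall>x\<in>carrier R. a i \<otimes>\<^bsub>R\<^esub> x \<in> genideal R (a ` {..<i}) \<longrightarrow> x \<in> genideal R (a ` {..<i})) \<and>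
     genideal R (a ` {..<k}) \<noteq> carrier R"

definition grade :: "('a, 'b) ring_scheme \<Rightarrow> 'a set \<Rightarrow> enat" where
  "grade R I = Sup {enat k | k. \<exists>a. (\<forall>i<k. a i \<in> I) \<and> regular_seq R a k}"

text \<open>A Noetherian commutative ring is Cohen--Macaulay iff grade m = ht m for every
  maximal ideal m (i.e. depth of R_m = dim R_m for all maximal m).\<close>
definition cohen_macaulay :: "('a, 'b) ring_scheme \<Rightarrow> bool" where
  "cohen_macaulay R \<longleftrightarrow> cring R \<and> noetherian_ring R \<and>
     (\<forall>m. maximalideal m R \<longrightarrow> grade R m = ht R m)"

definition cspace :: "nat \<Rightarrow> (nat \<Rightarrow> complex) set" where
  "cspace n = {x. \<forall>i\<ge>n. x i = 0}"

definition is_partition :: "nat list \<Rightarrow> nat \<Rightarrow> bool" where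
  "is_partition lam n \<longleftrightarrow> sorted_wrt (\<ge>) lam \<and> 0 \<notin> set lam \<and> sum_list lam = n"

definition blk :: "nat list \<Rightarrow> nat \<Rightarrow> nat" where
  "blk lam i = (LEAST j. i < sum_list (take (Suc j) lam))"

definition E_lam :: "nat list \<Rightarrow> (nat \<Rightarrow> complex) set" where
  "E_lam lam = {x \<in> cspace (sum_list lam).
      \<forall>i<sum_list lam. \<forall>j<sum_list lam. blk lam i = blk lam j \<longrightarrow> x i = x j}"

definition X_lam :: "nat list \<Rightarrow> (nat \<Rightarrow> complex) set" where
  "X_lam lam = (\<Union>\<sigma>\<in>{\<sigma>. \<sigma> permutes {..<sum_list lam}}. (\<lambda>x. x \<circ> \<sigma>) ` E_lam lam)"

definition poly_fun :: "nat \<Rightarrow> ((nat \<Rightarrow> complex) \<Rightarrow> complex) \<Rightarrow> bool" where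
  "poly_fun n p \<longleftrightarrow> (\<exists>A c. finite (A :: (nat \<Rightarrow> nat) set) \<and>
      p = (\<lambda>x. sum (\<lambda>e. c e * prod (\<lambda>i. x i ^ e i) {..<n}) A))"

definition fun_ring :: "(nat \<Rightarrow> complex) set \<Rightarrow> ((nat \<Rightarrow> complex) \<Rightarrow> complex) set
    \<Rightarrow> ((nat \<Rightarrow> complex) \<Rightarrow> complex) ring" where
  "fun_ring Y C = \<lparr>carrier = C,
     monoid.mult = (\<lambda>f g. restrict (\<lambda>x. f x * g x) Y),
     monoid.one = restrict (\<lambda>_. 1) Y,
     ring.zero = restrict (\<lambda>_. 0) Y,
     ring.add = (\<lambda>f g. restrict (\<lambda>x. f x + g x) Y)\<rparr>"

definition coord_ring :: "nat list \<Rightarrow> ((nat \<Rightarrow> complex) \<Rightarrow> complex) ring" where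
  "coord_ring lam = fun_ring (X_lam lam)
     {restrict p (X_lam lam) | p. poly_fun (sum_list lam) p}"

text \<open>Invariant ring O(X_lambda)^{S_n}, the coordinate ring of X_lambda/S_n.\<close>
definition inv_coord_ring :: "nat list \<Rightarrow> ((nat \<Rightarrow> complex) \<Rightarrow> complex) ring" where
  "inv_coord_ring lam = fun_ring (X_lam lam)
     {f \<in> carrier (coord_ring lam). \<forall>\<sigma>. \<sigma> permutes {..<sum_list lam} \<longrightarrow>
        (\<forall>x\<in>X_lam lam. f (x \<circ> \<sigma>) = f x)}"

end

theory Submission
  imports Defs "HOL-Computational_Algebra.Polynomial" "HOL-Library.Function_Algebras"
begin

text \<open>
  A point of \<open>E_lam lam\<close> is a configuration of \<open>r = length lam\<close> points \<open>z i\<close> with the parts of \<open>lam\<close> as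
  weights, and invariant polynomials restrict to polynomials in the weighted power sums
  \<open>\<Sum>i<r. L i * z i ^ m\<close>. The hypothesis provides three blocks of distinct sizes such that no part is
  the sum of two of these sizes. On the plane of vanishing first moment of the three points there is
  a quintic form which is not a polynomial in the power sums, although near each line where two of
  the three points collide it is one (a cusp condition). Multiplied by a product that vanishes to
  high order at all other collisions and symmetrised, it gives a function \<open>wit\<close> on configurations
  which is not in the invariant ring, while \<open>theta r * wit\<close> and \<open>theta (r - 1) * wit\<close> are. Here
  \<open>theta s\<close> detects whether at most \<open>s\<close> distinct coordinates are really \<open>s\<close> distinct ones, so that
  \<open>theta r, \<dots>, theta 1\<close> is a homogeneous system of parameters.

  If the coordinate ring or its invariant ring were Cohen--Macaulay, the Koszul complex of
  \<open>theta r, theta (r - 1)\<close> and high powers of the remaining parameters would be exact. The relation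
  \<open>theta r * (theta (r - 1) * wit) = theta (r - 1) * (theta r * wit)\<close> then puts \<open>theta r * wit\<close> into
  the ideal of \<open>theta r\<close> and the high powers, and comparing degrees (after averaging over the
  symmetric group) puts \<open>wit\<close> into the invariant ring, a contradiction.
\<close>

section \<open>Koszul homology and regular sequences\<close>

text \<open>Geometrically, the parameter space of \<open>E_lam\<close> modulo the size-preserving
  block permutations maps to the quotient. Where two blocks of different sizes collide, the image
  has a cuspidal edge: the mean of the two points and the square and cube of their difference
  survive, the difference itself does not. That no part is the sum of the two sizes ensures that no
  further branch passes through such a point. Where three blocks collide, the three cusp conditions
  admit more functions than the weighted power sums generate. The defect sits in codimension two,
  which is why multiplication by each of two parameters repairs it.

  The obstacle is that the Cohen-Macaulay hypothesis only yields some regular sequence in the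
  maximal ideal of the origin, not regularity of the \<open>theta\<close>. Koszul exactness needs
  only that powers of the regular elements lie in the ideal of the parameters, so neither
  localisation nor dimension theory enters. The coordinate ring and its invariants are treated
  together, as rings of restrictions of a set of polynomial functions that allows averaging.\<close>

locale subring_set =
  fixes C :: "'a::comm_ring_1 set"
  assumes zero_closed: "0 \<in> C" and one_closed: "1 \<in> C"
    and add_closed: "x \<in> C \<Longrightarrow> y \<in> C \<Longrightarrow> x + y \<in> C"
    and mult_closed: "x \<in> C \<Longrightarrow> y \<in> C \<Longrightarrow> x * y \<in> C"
    and uminus_closed: "x \<in> C \<Longrightarrow> - x \<in> C"
begin

lemma diff_closed: "x \<in> C \<Longrightarrow> y \<in> C \<Longrightarrow> x - y \<in> C"
  using add_closed uminus_closed by (metis add_uminus_conv_diff)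

lemma sum_closed: "(\<And>i. i \<in> A \<Longrightarrow> f i \<in> C) \<Longrightarrow> sum f A \<in> C"
  by (induction A rule: infinite_finite_induct) (auto intro: zero_closed add_closed)

lemma power_closed: "x \<in> C \<Longrightarrow> x ^ k \<in> C"
  by (induction k) (auto intro: one_closed mult_closed)

definition ideal_of :: "'a set \<Rightarrow> bool" where
  "ideal_of J \<longleftrightarrow> J \<subseteq> C \<and> 0 \<in> J \<and> (\<forall>x\<in>J. \<forall>y\<in>J. x + y \<in> J) \<and> (\<forall>c\<in>C. \<forall>x\<in>J. c * x \<in> J)"

lemma ideal_ofD:
  assumes "ideal_of J"
  shows "0 \<in> J" "x \<in> J \<Longrightarrow> y \<in> J \<Longrightarrow> x + y \<in> J" "c \<in> C \<Longrightarrow> x \<in> J \<Longrightarrow> c * x \<in> J" "x \<in> J \<Longrightarrow> x \<in> C"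
  using assms by (auto simp: ideal_of_def)

lemma ideal_of_uminus: "ideal_of J \<Longrightarrow> x \<in> J \<Longrightarrow> - x \<in> J"
  using ideal_ofD(3)[of J "- 1" x] one_closed uminus_closed by auto

lemma ideal_of_diff: "ideal_of J \<Longrightarrow> x \<in> J \<Longrightarrow> y \<in> J \<Longrightarrow> x - y \<in> J"
  using ideal_ofD(2) ideal_of_uminus by (metis add_uminus_conv_diff)

lemma ideal_of_sum: "ideal_of J \<Longrightarrow> (\<And>i. i \<in> A \<Longrightarrow> f i \<in> J) \<Longrightarrow> sum f A \<in> J"
  by (induction A rule: infinite_finite_induct) (auto intro: ideal_ofD)

end

text \<open>The Koszul complex as an iterated mapping cone: a chain assigns an element to each
  subset of the sequence, a subset being encoded by its characteristic list.\<close>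

fun koszul_d :: "'a::comm_ring_1 list \<Rightarrow> (bool list \<Rightarrow> 'a) \<Rightarrow> bool list \<Rightarrow> 'a" where
  "koszul_d (t # ts) c (b # l) =
     (if b then - koszul_d ts (\<lambda>m. c (True # m)) l
      else koszul_d ts (\<lambda>m. c (False # m)) l + t * c (True # l))"
| "koszul_d ts c l = 0"

text \<open>Exterior multiplication by the \<open>i\<close>-th basis vector, with the sign from
  moving it past the earlier ones; \<open>koszul_d\<close> is the matching contraction.\<close>

fun koszul_h :: "nat \<Rightarrow> (bool list \<Rightarrow> 'a::comm_ring_1) \<Rightarrow> bool list \<Rightarrow> 'a" where
  "koszul_h 0 c (b # l) = (if b then c (False # l) else 0)"
| "koszul_h (Suc i) c (b # l) =
     (if b then - koszul_h i (\<lambda>m. c (True # m)) l else koszul_h i (\<lambda>m. c (False # m)) l)"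
| "koszul_h i c [] = 0"

abbreviation weight :: "bool list \<Rightarrow> nat" where "weight l \<equiv> count_list l True"

lemma koszul_d_add: "koszul_d ts (\<lambda>l. c l + c' l) l = koszul_d ts c l + koszul_d ts c' l"
proof (induction ts arbitrary: c c' l)
  case (Cons t ts)
  show ?case by (cases l) (auto simp: Cons algebra_simps)
qed simp

lemma koszul_d_scale: "koszul_d ts (\<lambda>l. a * c l) l = a * koszul_d ts c l"
proof (induction ts arbitrary: c l)
  case (Cons t ts)
  show ?case by (cases l) (auto simp: Cons algebra_simps)
qed simp

lemma koszul_d_uminus: "koszul_d ts (\<lambda>l. - c l) l = - koszul_d ts c l"
  using koszul_d_scale[of ts "-1" c l] by simp

lemma koszul_d_zero: "koszul_d ts (\<lambda>l. 0) l = 0"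
  using koszul_d_scale[of ts 0 "\<lambda>l. 0" l] by simp

lemma koszul_d_sum: "koszul_d ts (\<lambda>l. \<Sum>i\<in>A. c i l) l = (\<Sum>i\<in>A. koszul_d ts (c i) l)"
  by (induction A rule: infinite_finite_induct) (auto simp: koszul_d_add koszul_d_zero)

lemma koszul_d_d: "koszul_d ts (koszul_d ts c) l = 0"
proof (induction ts arbitrary: c l)
  case (Cons t ts)
  show ?case
    by (cases l) (auto simp: koszul_d_add koszul_d_scale koszul_d_uminus Cons)
qed simp

lemma koszul_d_weight:
  assumes "\<And>l. length l = length ts \<Longrightarrow> weight l \<noteq> w \<Longrightarrow> c l = 0"
    and "length l = length ts" "Suc (weight l) \<noteq> w"
  shows "koszul_d ts c l = 0"
  using assms
proof (induction ts arbitrary: c l w)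
  case (Cons t ts)
  obtain b m where l: "l = b # m" using Cons.prems(2) by (cases l) auto
  show ?case
  proof (cases b)
    case True
    show ?thesis
    proof (cases w)
      case 0
      have "koszul_d ts (\<lambda>m. c (True # m)) m = 0"
        by (rule Cons.IH[of "Suc (Suc (weight m))"]) (use Cons.prems l 0 in auto)
      then show ?thesis using True l by simp
    next
      case (Suc v)
      have "koszul_d ts (\<lambda>m. c (True # m)) m = 0"
        by (rule Cons.IH[of v]) (use Cons.prems l Suc True in auto)
      then show ?thesis using True l by simp
    qed
  next
    case False
    have "koszul_d ts (\<lambda>m. c (False # m)) m = 0"
      by (rule Cons.IH[of w]) (use Cons.prems l False in auto)
    moreover have "c (True # m) = 0"
      using Cons.prems l False by auto
    ultimately show ?thesis using False l by simp
  qed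
qed simp

lemma koszul_h_add: "koszul_h i (\<lambda>l. c l + c' l) l = koszul_h i c l + koszul_h i c' l"
proof (induction i arbitrary: c c' l)
  case 0
  show ?case by (cases l) auto
next
  case (Suc i)
  show ?case by (cases l) (auto simp: Suc)
qed

lemma koszul_h_scale: "koszul_h i (\<lambda>l. a * c l) l = a * koszul_h i c l"
proof (induction i arbitrary: c l)
  case 0
  show ?case by (cases l) auto
next
  case (Suc i)
  show ?case by (cases l) (auto simp: Suc)
qed

lemma koszul_h_uminus: "koszul_h i (\<lambda>l. - c l) l = - koszul_h i c l"
  using koszul_h_scale[of i "-1" c l] by simp

text \<open>Contraction and exterior multiplication anticommute up to the entry
  \<open>ts ! i\<close>, so every entry of the sequence annihilates Koszul homology.\<close>

lemma koszul_h_homotopy: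
  "i < length ts \<Longrightarrow> length l = length ts \<Longrightarrow>
     koszul_d ts (koszul_h i c) l + koszul_h i (koszul_d ts c) l = ts ! i * c l"
proof (induction ts arbitrary: i c l)
  case (Cons t ts)
  obtain b m where l: "l = b # m" using Cons.prems(2) by (cases l) auto
  show ?case
  proof (cases i)
    case 0
    then show ?thesis using l Cons.prems
      by (cases b) (auto simp: koszul_d_zero)
  next
    case (Suc j)
    have "koszul_d ts (koszul_h j c') m + koszul_h j (koszul_d ts c') m = ts ! j * c' m" for c'
      using Cons.IH[of j m c'] Cons.prems Suc l by auto
    note ih = this[of "\<lambda>m. c (True # m)"] this[of "\<lambda>m. c (False # m)"]
    show ?thesis using l Suc ih
      by (auto simp: koszul_d_uminus koszul_h_uminus koszul_h_add koszul_h_scale algebra_simps)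
  qed
qed simp

lemma koszul_h_weight:
  assumes "\<And>l. length l = k \<Longrightarrow> weight l \<noteq> w \<Longrightarrow> c l = 0"
    and "length l = k" "weight l \<noteq> Suc w"
  shows "koszul_h i c l = 0"
  using assms
proof (induction i arbitrary: c l w k)
  case 0
  then show ?case by (cases l) auto
next
  case (Suc i)
  show ?case
  proof (cases l)
    case (Cons b m)
    show ?thesis
    proof (cases b)
      case True
      show ?thesis
      proof (cases w)
        case 0
        have "koszul_h i (\<lambda>m. c (True # m)) m = 0"
          by (rule Suc.IH[of "length m" "Suc (weight m)"]) (use Suc.prems Cons 0 in auto)
        then show ?thesis using True Cons by simp
      next
        case (Suc v)
        have "koszul_h i (\<lambda>m. c (True # m)) m = 0"
          by (rule Suc.IH[of "length m" v]) (use Suc.prems Cons Suc True in auto)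
        then show ?thesis using True Cons by simp
      qed
    next
      case False
      have "koszul_h i (\<lambda>m. c (False # m)) m = 0"
        by (rule Suc.IH[of "length m" w]) (use Suc.prems Cons False in auto)
      then show ?thesis using False Cons by simp
    qed
  qed simp
qed

context subring_set
begin

lemma koszul_d_mem:
  assumes "ideal_of J" "set ts \<subseteq> C" "\<And>l. length l = length ts \<Longrightarrow> c l \<in> J"
    and "length l = length ts"
  shows "koszul_d ts c l \<in> J"
  using assms(2-)
proof (induction ts arbitrary: c l)
  case Nil
  then show ?case using ideal_ofD(1)[OF assms(1)] by simp
next
  case (Cons t ts)
  obtain b m where l: "l = b # m" using Cons.prems(3) by (cases l) auto
  show ?case using l Cons.prems Cons.IH[of "\<lambda>m. c (b # m)" m]
    by (auto intro!: ideal_ofD[OF assms(1)] ideal_of_uminus[OF assms(1)])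
qed

lemma koszul_h_mem:
  assumes "ideal_of J" "\<And>l. length l = k \<Longrightarrow> c l \<in> J" and "length l = k"
  shows "koszul_h i c l \<in> J"
  using assms(2-)
proof (induction i arbitrary: c l k)
  case 0
  then show ?case using ideal_ofD(1)[OF assms(1)] by (cases l) auto
next
  case (Suc i)
  show ?case
  proof (cases l)
    case Nil
    then show ?thesis using ideal_ofD(1)[OF assms(1)] by simp
  next
    case (Cons b m)
    then have "koszul_h i (\<lambda>m. c (b # m)) m \<in> J"
      by (intro Suc.IH[of "length m"]) (use Suc.prems in auto)
    then show ?thesis using Cons ideal_of_uminus[OF assms(1)] by auto
  qed
qed

lemma ideal_of_C: "ideal_of C"
  by (auto simp: ideal_of_def zero_closed add_closed mult_closed)

definition chain :: "'a list \<Rightarrow> nat \<Rightarrow> (bool list \<Rightarrow> 'a) \<Rightarrow> bool" where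
  "chain ts w c \<longleftrightarrow> (\<forall>l. length l = length ts \<longrightarrow> c l \<in> C \<and> (weight l \<noteq> w \<longrightarrow> c l = 0))"

text \<open>Depth sensitivity of the Koszul complex: the induction passes from \<open>J (Suc j)\<close> to \<open>J j\<close>
  through the long exact sequence of multiplication by \<open>a j\<close>, on which a power of \<open>a j\<close> acts as
  zero by the homotopy.\<close>
lemma koszul_exact:
  fixes J :: "nat \<Rightarrow> 'a set" and a :: "nat \<Rightarrow> 'a"
  assumes J: "\<And>j. j \<le> length ts \<Longrightarrow> ideal_of (J j)"
    and mono: "\<And>j. j < length ts \<Longrightarrow> J j \<subseteq> J (Suc j)"
    and aC: "\<And>j. j < length ts \<Longrightarrow> a j \<in> C" "\<And>j. j < length ts \<Longrightarrow> a j \<in> J (Suc j)"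
    and reg: "\<And>j x. j < length ts \<Longrightarrow> x \<in> C \<Longrightarrow> a j * x \<in> J j \<Longrightarrow> x \<in> J j"
    and dec: "\<And>j x. j < length ts \<Longrightarrow> x \<in> J (Suc j) \<Longrightarrow> \<exists>y\<in>C. x - a j * y \<in> J j"
    and ts: "set ts \<subseteq> C"
    and rad: "\<And>j. j < length ts \<Longrightarrow> \<exists>N u. (\<forall>i. u i \<in> C) \<and> a j ^ N - (\<Sum>i<length ts. u i * ts ! i) \<in> J 0"
    and "j \<le> length ts" "j < w" "chain ts w c"
    and "\<And>l. length l = length ts \<Longrightarrow> koszul_d ts c l \<in> J j"
  shows "\<exists>e. chain ts (Suc w) e \<and> (\<forall>l. length l = length ts \<longrightarrow> c l - koszul_d ts e l \<in> J j)"
  using assms(9-)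
proof (induction j arbitrary: w c rule: inc_induct)
  case base
  \<comment> \<open>The weight \<open>w\<close> exceeds the number of entries, so there is no
    nonzero chain. The condition \<open>j < w\<close> is there to reach this base case.\<close>
  have "c l = 0" if "length l = length ts" for l
    using base that count_le_length[of l True] unfolding chain_def by force
  then show ?case using ideal_ofD(1)[OF J[of "length ts"]]
    by (intro exI[of _ "\<lambda>l. 0"]) (auto simp: chain_def koszul_d_zero zero_closed)
next
  case (step j w c)
  have jr: "j < length ts" using step by simp
  have Jj: "ideal_of (J j)" and JS: "ideal_of (J (Suc j))" using J jr by auto
  have J0: "J 0 \<subseteq> J j" using jr
  proof (induction j)
    case (Suc j) then show ?case using mono[of j] by auto
  qed simp
  obtain N u where u: "\<And>i. u i \<in> C" and N: "a j ^ N - (\<Sum>i<length ts. u i * ts ! i) \<in> J j"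
    using rad[OF jr] J0 by blast
  define bd where "bd c = (\<exists>e. chain ts (Suc w) e \<and> (\<forall>l. length l = length ts \<longrightarrow> c l - koszul_d ts e l \<in> J j))" for c
  have "bd (\<lambda>l. a j ^ N * c l)"
    unfolding bd_def
  proof (intro exI[of _ "\<lambda>l. \<Sum>i<length ts. u i * koszul_h i c l"] conjI allI impI)
    show "chain ts (Suc w) (\<lambda>l. \<Sum>i<length ts. u i * koszul_h i c l)"
      unfolding chain_def
    proof (intro allI impI conjI)
      fix l :: "bool list" assume l: "length l = length ts"
      have "koszul_h i c l \<in> C" for i
        by (rule koszul_h_mem[OF ideal_of_C _ l]) (use step.prems in \<open>auto simp: chain_def\<close>)
      then show "(\<Sum>i<length ts. u i * koszul_h i c l) \<in> C"
        using u by (auto intro!: sum_closed mult_closed)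
      assume "weight l \<noteq> Suc w"
      then have "koszul_h i c l = 0" for i
        by (intro koszul_h_weight[of "length ts" w]) (use step.prems l in \<open>auto simp: chain_def\<close>)
      then show "(\<Sum>i<length ts. u i * koszul_h i c l) = 0" by simp
    qed
    fix l :: "bool list" assume l: "length l = length ts"
    have "koszul_d ts (\<lambda>l. \<Sum>i<length ts. u i * koszul_h i c l) l
        = (\<Sum>i<length ts. u i * (ts ! i * c l - koszul_h i (koszul_d ts c) l))"
      unfolding koszul_d_sum koszul_d_scale
      by (intro sum.cong refl arg_cong[where f="\<lambda>x. _ * x"])
         (use koszul_h_homotopy[OF _ l, of _ c] in \<open>auto simp: eq_diff_eq\<close>)
    also have "\<dots> = (\<Sum>i<length ts. u i * ts ! i) * c l - (\<Sum>i<length ts. u i * koszul_h i (koszul_d ts c) l)"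
      by (simp add: sum_subtractf sum_distrib_right sum_distrib_left algebra_simps)
    finally have eq: "a j ^ N * c l - koszul_d ts (\<lambda>l. \<Sum>i<length ts. u i * koszul_h i c l) l
        = c l * (a j ^ N - (\<Sum>i<length ts. u i * ts ! i)) + (\<Sum>i<length ts. u i * koszul_h i (koszul_d ts c) l)"
      by (simp add: algebra_simps)
    show "a j ^ N * c l - koszul_d ts (\<lambda>l. \<Sum>i<length ts. u i * koszul_h i c l) l \<in> J j"
      unfolding eq
    proof (intro ideal_ofD(2)[OF Jj] ideal_of_sum[OF Jj] ideal_ofD(3)[OF Jj] N u)
      show "c l \<in> C" using step.prems l by (auto simp: chain_def)
      show "koszul_h i (koszul_d ts c) l \<in> J j" for i
        by (rule koszul_h_mem[OF Jj _ l]) (use step.prems in auto)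
    qed
  qed
  \<comment> \<open>One factor \<open>a j\<close> is removed at a time. Modulo
    \<open>J (Suc j)\<close> the bounding chain \<open>e\<close> is a cycle of weight
    \<open>Suc w\<close>, so the induction hypothesis corrects it by a boundary to a multiple
    \<open>a j * q\<close>. Cancelling \<open>a j\<close> modulo \<open>J j\<close> shows that
    \<open>q\<close> bounds.\<close>
  moreover have "bd (\<lambda>l. a j ^ t * c l)" if bdS: "bd (\<lambda>l. a j ^ Suc t * c l)" for t
  proof -
    obtain e where e: "chain ts (Suc w) e" and
      ce: "\<And>l. length l = length ts \<Longrightarrow> a j ^ Suc t * c l - koszul_d ts e l \<in> J j"
      using bdS unfolding bd_def by blast
    have "koszul_d ts e l \<in> J (Suc j)" if l: "length l = length ts" for l
    proof -
      have "a j ^ Suc t * c l \<in> J (Suc j)"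
        using ideal_ofD(3)[OF JS, of "a j ^ t * c l" "a j"] aC jr step.prems l
        by (auto simp: chain_def algebra_simps intro: mult_closed power_closed)
      then have "a j ^ Suc t * c l - (a j ^ Suc t * c l - koszul_d ts e l) \<in> J (Suc j)"
        using ideal_of_diff[OF JS] ce[OF l] mono[OF jr] by blast
      then show ?thesis by simp
    qed
    then obtain b where b: "chain ts (Suc (Suc w)) b"
      and eb: "\<And>l. length l = length ts \<Longrightarrow> e l - koszul_d ts b l \<in> J (Suc j)"
      using step.IH[of "Suc w" e] step.prems e by auto
    \<comment> \<open>The value \<open>0\<close> off weight \<open>Suc w\<close> keeps
      \<open>q\<close> a chain; it is a correct quotient there because both \<open>e\<close> and the
      boundary of \<open>b\<close> vanish.\<close>
    define q where "q l = (if weight l = Suc w then SOME y. y \<in> C \<and> (e l - koszul_d ts b l) - a j * y \<in> J j else 0)" for l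
    have q: "q l \<in> C \<and> (e l - koszul_d ts b l) - a j * q l \<in> J j" if l: "length l = length ts" for l
    proof (cases "weight l = Suc w")
      case True
      have "\<exists>y. y \<in> C \<and> (e l - koszul_d ts b l) - a j * y \<in> J j"
        using dec[OF jr eb[OF l]] by blast
      from someI_ex[OF this] show ?thesis using True by (simp add: q_def)
    next
      case False
      have "koszul_d ts b l = 0"
        by (rule koszul_d_weight[of ts "Suc (Suc w)"]) (use b l False in \<open>auto simp: chain_def\<close>)
      moreover have "e l = 0" using e l False by (auto simp: chain_def)
      ultimately show ?thesis using False ideal_ofD(1)[OF Jj] by (auto simp: q_def zero_closed)
    qed
    show "bd (\<lambda>l. a j ^ t * c l)"
      unfolding bd_def
    proof (intro exI[of _ q] conjI allI impI)
      show "chain ts (Suc w) q" using q by (auto simp: chain_def q_def)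
      fix l :: "bool list" assume l: "length l = length ts"
      define j' where "j' l = (e l - koszul_d ts b l) - a j * q l" for l
      have "e = (\<lambda>l. j' l + (koszul_d ts b l + a j * q l))" by (simp add: j'_def)
      then have "koszul_d ts e l = koszul_d ts (\<lambda>l. j' l + (koszul_d ts b l + a j * q l)) l" by simp
      also have "\<dots> = koszul_d ts j' l + a j * koszul_d ts q l"
        by (simp add: koszul_d_add koszul_d_scale koszul_d_d)
      finally have de: "koszul_d ts e l = koszul_d ts j' l + a j * koszul_d ts q l" .
      have "koszul_d ts j' l \<in> J j"
        by (rule koszul_d_mem[OF Jj ts _ l]) (use q in \<open>auto simp: j'_def\<close>)
      then have "(a j ^ Suc t * c l - koszul_d ts e l) + koszul_d ts j' l \<in> J j"
        using ideal_ofD(2)[OF Jj] ce[OF l] by blast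
      moreover have "(a j ^ Suc t * c l - koszul_d ts e l) + koszul_d ts j' l
          = a j * (a j ^ t * c l - koszul_d ts q l)"
        by (simp add: de algebra_simps)
      moreover have "a j ^ t * c l - koszul_d ts q l \<in> C"
        using step.prems l aC jr koszul_d_mem[OF ideal_of_C ts _ l, of q] q
        by (auto simp: chain_def intro!: diff_closed mult_closed power_closed)
      ultimately show "a j ^ t * c l - koszul_d ts q l \<in> J j"
        using reg[OF jr] by metis
    qed
  qed
  ultimately have "bd (\<lambda>l. a j ^ 0 * c l)"
    by (induction N) blast+
  then show ?case unfolding bd_def by simp
qed

text \<open>The component of a boundary at the empty subset is where ideal membership is read
  off.\<close>

lemma koszul_d_no_True:
  assumes "set ts \<subseteq> C" "\<And>l. length l = length ts \<Longrightarrow> c l \<in> C"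
  shows "\<exists>v. (\<forall>i. v i \<in> C) \<and>
    koszul_d ts c (replicate (length ts) False) = (\<Sum>i<length ts. ts ! i * v i)"
  using assms
proof (induction ts arbitrary: c)
  case Nil
  then show ?case using zero_closed by auto
next
  case (Cons t ts)
  obtain v where v: "\<And>i. v i \<in> C"
    "koszul_d ts (\<lambda>m. c (False # m)) (replicate (length ts) False) = (\<Sum>i<length ts. ts ! i * v i)"
    using Cons.IH[of "\<lambda>m. c (False # m)"] Cons.prems by auto
  show ?case
    by (rule exI[of _ "case_nat (c (True # replicate (length ts) False)) v"])
      (use v Cons.prems in \<open>auto simp: sum.lessThan_Suc_shift add.commute split: nat.split simp del: sum.lessThan_Suc\<close>)
qed

text \<open>The relation is a cycle of weight \<open>1\<close> with entries \<open>h\<close> and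
  \<open>- g\<close>. Exactness modulo \<open>J 0\<close> makes it a boundary, and the entry at
  \<open>q\<close> of a boundary is a combination of \<open>p\<close> and \<open>us\<close>
  alone.\<close>

lemma syzygy_mod_rest:
  fixes J :: "nat \<Rightarrow> 'a set" and a :: "nat \<Rightarrow> 'a" and p q g h :: 'a and us :: "'a list"
  defines "ts \<equiv> p # q # us"
  assumes J: "\<And>j. j \<le> length ts \<Longrightarrow> ideal_of (J j)"
    and mono: "\<And>j. j < length ts \<Longrightarrow> J j \<subseteq> J (Suc j)"
    and aC: "\<And>j. j < length ts \<Longrightarrow> a j \<in> C" "\<And>j. j < length ts \<Longrightarrow> a j \<in> J (Suc j)"
    and reg: "\<And>j x. j < length ts \<Longrightarrow> x \<in> C \<Longrightarrow> a j * x \<in> J j \<Longrightarrow> x \<in> J j"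
    and dec: "\<And>j x. j < length ts \<Longrightarrow> x \<in> J (Suc j) \<Longrightarrow> \<exists>y\<in>C. x - a j * y \<in> J j"
    and ts: "set ts \<subseteq> C"
    and rad: "\<And>j. j < length ts \<Longrightarrow> \<exists>N u. (\<forall>i. u i \<in> C) \<and> a j ^ N - (\<Sum>i<length ts. u i * ts ! i) \<in> J 0"
    and gh: "g \<in> C" "h \<in> C" "p * h - q * g \<in> J 0"
  shows "\<exists>b v. b \<in> C \<and> (\<forall>i. v i \<in> C) \<and> g - (p * b + (\<Sum>i<length us. us ! i * v i)) \<in> J 0"
proof -
  define k where "k = length us"
  define c where "c l = (if l = True # False # replicate k False then h
      else if l = False # True # replicate k False then - g else 0)" for l
  have "chain ts 1 c"
    by (auto simp: chain_def c_def gh zero_closed uminus_closed)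
  moreover have "koszul_d ts c l \<in> J 0" if l: "length l = length ts" for l
  proof (cases "weight l = 0")
    case True
    then have "l = replicate (length ts) False"
      by (intro replicate_eqI) (use l in \<open>auto simp: count_list_0_iff\<close>)
    then have "koszul_d ts c l = p * h - q * g"
      by (simp add: ts_def c_def koszul_d_zero k_def)
    then show ?thesis using gh by simp
  next
    case False
    then have "koszul_d ts c l = 0"
      by (intro koszul_d_weight[of ts 1]) (use l \<open>chain ts 1 c\<close> in \<open>auto simp: chain_def\<close>)
    then show ?thesis using ideal_ofD(1)[OF J[of 0]] by simp
  qed
  ultimately obtain e where e: "chain ts 2 e"
    and ce: "\<And>l. length l = length ts \<Longrightarrow> c l - koszul_d ts e l \<in> J 0"
    using koszul_exact[of ts J a 0 1 c] J mono aC reg dec ts rad by (auto simp: numeral_2_eq_2)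
  define l where "l = False # True # replicate k False"
  obtain v where v: "\<And>i. v i \<in> C"
    "koszul_d us (\<lambda>m. e (False # True # m)) (replicate (length us) False) = (\<Sum>i<length us. us ! i * v i)"
    using koszul_d_no_True[of us "\<lambda>m. e (False # True # m)"] e ts by (auto simp: ts_def chain_def)
  have "koszul_d ts e l = - (\<Sum>i<length us. us ! i * v i) + p * e (True # True # replicate k False)"
    using v(2) by (simp add: ts_def l_def k_def)
  moreover have "c l - koszul_d ts e l \<in> J 0"
    using ce[of l] by (simp add: l_def ts_def k_def)
  ultimately have "- g - (- (\<Sum>i<length us. us ! i * v i) + p * e (True # True # replicate k False)) \<in> J 0"
    by (simp add: l_def c_def)
  then have "- (- g - (- (\<Sum>i<length us. us ! i * v i) + p * e (True # True # replicate k False))) \<in> J 0"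
    using ideal_of_uminus[OF J[of 0]] by blast
  moreover have "- (- g - (- (\<Sum>i<length us. us ! i * v i) + p * e (True # True # replicate k False)))
     = g - (p * (- e (True # True # replicate k False)) + (\<Sum>i<length us. us ! i * v i))"
    by (simp add: algebra_simps)
  moreover have "- e (True # True # replicate k False) \<in> C"
    using e by (auto simp: chain_def ts_def k_def intro!: uminus_closed)
  ultimately show ?thesis using v(1) by metis
qed

end

section \<open>Polynomial functions and power sums\<close>

lemma poly_fun_monom: "poly_fun n (\<lambda>x. c * (\<Prod>i<n. x i ^ e i))"
  unfolding poly_fun_def by (intro exI[of _ "{e}"] exI[of _ "\<lambda>_. c"]) auto

lemma poly_fun_add:
  assumes "poly_fun n p" "poly_fun n q"
  shows "poly_fun n (\<lambda>x. p x + q x)"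
proof -
  obtain A c where A: "finite A" "p = (\<lambda>x. \<Sum>e\<in>A. c e * (\<Prod>i<n. x i ^ e i))"
    using assms(1) unfolding poly_fun_def by blast
  obtain B d where B: "finite B" "q = (\<lambda>x. \<Sum>e\<in>B. d e * (\<Prod>i<n. x i ^ e i))"
    using assms(2) unfolding poly_fun_def by blast
  have "p x + q x = (\<Sum>e\<in>A \<union> B. ((if e \<in> A then c e else 0) + (if e \<in> B then d e else 0)) * (\<Prod>i<n. x i ^ e i))" for x
  proof -
    have "p x = (\<Sum>e\<in>A \<union> B. (if e \<in> A then c e else 0) * (\<Prod>i<n. x i ^ e i))"
      unfolding A(2) using A(1) B(1) by (intro sum.mono_neutral_cong_left) auto
    moreover have "q x = (\<Sum>e\<in>A \<union> B. (if e \<in> B then d e else 0) * (\<Prod>i<n. x i ^ e i))"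
      unfolding B(2) using A(1) B(1) by (intro sum.mono_neutral_cong_left) auto
    ultimately show ?thesis by (simp add: sum.distrib distrib_right)
  qed
  then show ?thesis unfolding poly_fun_def
    using A(1) B(1) by (intro exI[of _ "A \<union> B"] exI) auto
qed

lemma poly_fun_const: "poly_fun n (\<lambda>x. c)"
  using poly_fun_monom[of n c "\<lambda>_. 0"] by simp

lemma poly_fun_sum: "(\<And>a. a \<in> A \<Longrightarrow> poly_fun n (p a)) \<Longrightarrow> poly_fun n (\<lambda>x. \<Sum>a\<in>A. p a x)"
  by (induction A rule: infinite_finite_induct) (auto intro: poly_fun_const poly_fun_add)

lemma poly_fun_mult:
  assumes "poly_fun n p" "poly_fun n q"
  shows "poly_fun n (\<lambda>x. p x * q x)"
proof -
  obtain A c where A: "finite A" "p = (\<lambda>x. \<Sum>e\<in>A. c e * (\<Prod>i<n. x i ^ e i))"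
    using assms(1) unfolding poly_fun_def by blast
  obtain B d where B: "finite B" "q = (\<lambda>x. \<Sum>e\<in>B. d e * (\<Prod>i<n. x i ^ e i))"
    using assms(2) unfolding poly_fun_def by blast
  have "p x * q x = (\<Sum>e\<in>A. \<Sum>e'\<in>B. (c e * d e') * (\<Prod>i<n. x i ^ (e i + e' i)))" for x
    unfolding A(2) B(2) sum_product
    by (intro sum.cong refl) (simp add: power_add prod.distrib algebra_simps)
  then show ?thesis by (auto intro!: poly_fun_sum poly_fun_monom)
qed

lemma poly_fun_coord: "i < n \<Longrightarrow> poly_fun n (\<lambda>x. x i)"
proof -
  assume i: "i < n"
  have "(\<Prod>j<n. x j ^ (if j = i then 1 else 0)) = x i" for x :: "nat \<Rightarrow> complex"
    using i by (subst prod.mono_neutral_right[of "{..<n}" "{i}"]) auto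
  then show ?thesis using poly_fun_monom[of n 1 "\<lambda>j. if j = i then 1 else 0"] by simp
qed

lemma poly_fun_uminus: "poly_fun n p \<Longrightarrow> poly_fun n (\<lambda>x. - p x)"
  using poly_fun_mult[OF poly_fun_const[of n "-1"]] by auto

lemma poly_fun_diff: "poly_fun n p \<Longrightarrow> poly_fun n q \<Longrightarrow> poly_fun n (\<lambda>x. p x - q x)"
  using poly_fun_add[OF _ poly_fun_uminus, of n p q] by simp

lemma poly_fun_prod: "(\<And>a. a \<in> A \<Longrightarrow> poly_fun n (p a)) \<Longrightarrow> poly_fun n (\<lambda>x. \<Prod>a\<in>A. p a x)"
  by (induction A rule: infinite_finite_induct) (auto intro: poly_fun_const poly_fun_mult)

lemma poly_fun_power: "poly_fun n p \<Longrightarrow> poly_fun n (\<lambda>x. p x ^ k)"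
  by (induction k) (auto intro: poly_fun_const poly_fun_mult)

lemmas poly_fun_intros = poly_fun_const poly_fun_coord poly_fun_add poly_fun_mult poly_fun_uminus
  poly_fun_diff poly_fun_sum poly_fun_prod poly_fun_power

lemma poly_fun_induct [consumes 1, case_names const coord add mult]:
  assumes "poly_fun n p"
    and const: "\<And>c. P (\<lambda>x. c)"
    and coord: "\<And>i. i < n \<Longrightarrow> P (\<lambda>x. x i)"
    and add: "\<And>p q. poly_fun n p \<Longrightarrow> poly_fun n q \<Longrightarrow> P p \<Longrightarrow> P q \<Longrightarrow> P (\<lambda>x. p x + q x)"
    and mult: "\<And>p q. poly_fun n p \<Longrightarrow> poly_fun n q \<Longrightarrow> P p \<Longrightarrow> P q \<Longrightarrow> P (\<lambda>x. p x * q x)"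
  shows "P p"
proof -
  define Q where "Q p \<longleftrightarrow> poly_fun n p \<and> P p" for p
  have Qc: "Q (\<lambda>x. c)" for c by (auto simp: Q_def poly_fun_const const)
  have Qi: "Q (\<lambda>x. x i)" if "i < n" for i using that by (auto simp: Q_def poly_fun_coord coord)
  have Qa: "Q (\<lambda>x. p x + q x)" if "Q p" "Q q" for p q
    using that by (auto simp: Q_def poly_fun_add add)
  have Qm: "Q (\<lambda>x. p x * q x)" if "Q p" "Q q" for p q
    using that by (auto simp: Q_def poly_fun_mult mult)
  have Qs: "Q (\<lambda>x. \<Sum>a\<in>A. f a x)" if "\<And>a. a \<in> A \<Longrightarrow> Q (f a)" for A and f :: "'c \<Rightarrow> _"
    using that by (induction A rule: infinite_finite_induct) (auto intro: Qc Qa)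
  have Qp: "Q (\<lambda>x. \<Prod>a\<in>A. f a x)" if "\<And>a. a \<in> A \<Longrightarrow> Q (f a)" for A and f :: "'c \<Rightarrow> _"
    using that by (induction A rule: infinite_finite_induct) (auto intro: Qc Qm)
  have Qe: "Q (\<lambda>x. p x ^ k)" if "Q p" for p k
    using that by (induction k) (auto intro: Qc Qm)
  obtain A c where "p = (\<lambda>x. \<Sum>e\<in>A. c e * (\<Prod>i<n. x i ^ e i))"
    using assms(1) unfolding poly_fun_def by blast
  then have "Q p" by (auto intro!: Qs Qm Qc Qp Qe Qi)
  then show ?thesis by (simp add: Q_def)
qed

lemma poly_fun_subst:
  assumes "poly_fun n G" "\<And>k. k < n \<Longrightarrow> poly_fun m (s k)"
  shows "poly_fun m (\<lambda>z. G (\<lambda>k. s k z))"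
  using assms(1) by (induction rule: poly_fun_induct) (auto intro: poly_fun_intros assms(2))

lemma poly_fun_cong:
  assumes "poly_fun n G" "\<And>k. k < n \<Longrightarrow> x k = y k"
  shows "G x = G y"
  using assms(1) by (induction rule: poly_fun_induct) (auto simp: assms(2))

lemma poly_fun_comp_poly:
  assumes "poly_fun n G"
  shows "\<exists>P. \<forall>t. G (\<lambda>k. poly (c k) t) = poly P t"
  using assms
proof (induction rule: poly_fun_induct)
  case (const c)
  then show ?case by (intro exI[of _ "[:c:]"]) auto
next
  case (add p q)
  then show ?case by (metis poly_add)
next
  case (mult p q)
  then show ?case by (metis poly_mult)
qed auto

text \<open>Division by \<open>x i - x j\<close> with the substituted polynomial as remainder; the
  product case is the Leibniz rule for differences.\<close>

lemma poly_fun_diff_fun_upd: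
  assumes "poly_fun n u" and ij: "i < n" "j < n"
  shows "\<exists>w. poly_fun n w \<and> (\<forall>x. u x - u (x(i := x j)) = (x i - x j) * w x)"
proof -
  have upd: "poly_fun n (\<lambda>x. p (x(i := x j)))" if "poly_fun n p" for p
  proof -
    have "poly_fun n (\<lambda>x. (x(i := x j)) k)" if "k < n" for k
      using that ij by (cases "k = i") (auto intro: poly_fun_coord)
    from poly_fun_subst[of n p n "\<lambda>k x. (x(i := x j)) k", OF that this] show ?thesis by (simp only:)
  qed
  show ?thesis using assms(1)
  proof (induction rule: poly_fun_induct)
    case (const c)
    then show ?case by (intro exI[of _ "\<lambda>_. 0"]) (auto intro: poly_fun_const)
  next
    case (coord k)
    show ?case
      by (cases "k = i") (auto intro!: exI[of _ "\<lambda>_. if k = i then 1 else 0"] poly_fun_const)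
  next
    case (add p q)
    then obtain v w where v: "poly_fun n v" "\<And>x. p x - p (x(i := x j)) = (x i - x j) * v x"
      and w: "poly_fun n w" "\<And>x. q x - q (x(i := x j)) = (x i - x j) * w x" by blast
    have "p x + q x - (p (x(i := x j)) + q (x(i := x j))) = (x i - x j) * (v x + w x)" for x
      unfolding distrib_left v(2)[symmetric] w(2)[symmetric] by (rule add_diff_add)
    then show ?case
      using poly_fun_add[OF v(1) w(1)] by blast
  next
    case (mult p q)
    then obtain v w where v: "poly_fun n v" "\<And>x. p x - p (x(i := x j)) = (x i - x j) * v x"
      and w: "poly_fun n w" "\<And>x. q x - q (x(i := x j)) = (x i - x j) * w x" by blast
    have "p x * q x - p (x(i := x j)) * q (x(i := x j))
        = (x i - x j) * (v x * q x + p (x(i := x j)) * w x)" for x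
    proof -
      have "p x * q x - p (x(i := x j)) * q (x(i := x j))
          = (p x - p (x(i := x j))) * q x + p (x(i := x j)) * (q x - q (x(i := x j)))"
        by (simp add: algebra_simps)
      then show ?thesis by (simp add: v(2) w(2) algebra_simps)
    qed
    moreover have "poly_fun n (\<lambda>x. v x * q x + p (x(i := x j)) * w x)"
      by (intro poly_fun_add poly_fun_mult v(1) w(1) mult.hyps upd)
    ultimately show ?case by blast
  qed
qed

lemma poly_fun_factor_diff:
  assumes "poly_fun n u" "i < n" "j < n" "\<And>x. x i = x j \<Longrightarrow> u x = 0"
  shows "\<exists>w. poly_fun n w \<and> (\<forall>x. u x = (x i - x j) * w x)"
proof -
  obtain w where w: "poly_fun n w" "\<And>x. u x - u (x(i := x j)) = (x i - x j) * w x"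
    using poly_fun_diff_fun_upd[OF assms(1-3)] by blast
  have "u (x(i := x j)) = 0" for x
    by (intro assms(4)) auto
  with w show ?thesis by (metis diff_zero)
qed

text \<open>A set closed under lines is irreducible: a point where \<open>f\<close> is nonzero and a
  point where \<open>g\<close> is nonzero are joined by a line, and along it the claim is that
  univariate polynomials have no zero divisors.\<close>

lemma poly_fun_mult_eq_0:
  assumes f: "poly_fun n f" and g: "poly_fun n g"
    and V: "\<And>x y t. x \<in> V \<Longrightarrow> y \<in> V \<Longrightarrow> (\<lambda>k. x k + t * (y k - x k)) \<in> V"
    and fg: "\<And>x. x \<in> V \<Longrightarrow> f x * g x = 0"
  shows "(\<forall>x\<in>V. f x = 0) \<or> (\<forall>x\<in>V. g x = 0)"
proof (rule ccontr)
  assume "\<not> ?thesis"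
  then obtain x y where xy: "x \<in> V" "y \<in> V" "f x \<noteq> 0" "g y \<noteq> 0" by blast
  define c where "c k = [:x k, y k - x k:]" for k
  have c: "poly (c k) t = x k + t * (y k - x k)" for k t by (simp add: c_def)
  obtain P where P: "\<And>t. f (\<lambda>k. poly (c k) t) = poly P t" using poly_fun_comp_poly[OF f] by blast
  obtain Q where Q: "\<And>t. g (\<lambda>k. poly (c k) t) = poly Q t" using poly_fun_comp_poly[OF g] by blast
  have "poly (P * Q) t = 0" for t
    using fg[OF V[OF xy(1,2)]] unfolding poly_mult P[symmetric] Q[symmetric] c by simp
  then have "P * Q = 0" by (simp add: poly_all_0_iff_0[symmetric])
  moreover have "poly P 0 \<noteq> 0" using xy(3) P[of 0] by (simp add: c)
  moreover have "poly Q 1 \<noteq> 0" using xy(4) Q[of 1] by (simp add: c)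
  ultimately show False by auto
qed

section \<open>Symmetric polynomial functions and the Reynolds operator\<close>

definition sym_fun :: "nat \<Rightarrow> ((nat \<Rightarrow> complex) \<Rightarrow> complex) \<Rightarrow> bool" where
  "sym_fun n G \<longleftrightarrow> (\<forall>\<sigma> x. \<sigma> permutes {..<n} \<longrightarrow> G (x \<circ> \<sigma>) = G x)"

definition sym_avg :: "nat \<Rightarrow> ((nat \<Rightarrow> complex) \<Rightarrow> complex) \<Rightarrow> (nat \<Rightarrow> complex) \<Rightarrow> complex" where
  "sym_avg n G x = (\<Sum>\<sigma> | \<sigma> permutes {..<n}. G (x \<circ> \<sigma>)) / fact n"

lemma poly_fun_compose_permutes:
  assumes "poly_fun n G" "\<sigma> permutes {..<n}"
  shows "poly_fun n (\<lambda>x. G (x \<circ> \<sigma>))"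
proof -
  have "poly_fun n (\<lambda>x. x (\<sigma> k))" if "k < n" for k
    using permutes_in_image[OF assms(2), of k] that by (intro poly_fun_coord) auto
  from poly_fun_subst[OF assms(1) this] show ?thesis by (simp add: comp_def)
qed

lemma sum_permutes_compose:
  assumes "\<tau> permutes S"
  shows "(\<Sum>\<sigma> | \<sigma> permutes S. f (\<tau> \<circ> \<sigma>)) = (\<Sum>\<sigma> | \<sigma> permutes S. f \<sigma>)"
proof (rule sum.reindex_bij_witness[of _ "\<lambda>\<sigma>. inv_into UNIV \<tau> \<circ> \<sigma>" "\<lambda>\<sigma>. \<tau> \<circ> \<sigma>"])
qed (use assms in \<open>auto simp: permutes_compose permutes_inv o_assoc permutes_inv_o\<close>)

lemma poly_fun_sum_permutes:
  "poly_fun n G \<Longrightarrow> poly_fun n (\<lambda>x. \<Sum>\<sigma> | \<sigma> permutes {..<n}. G (x \<circ> \<sigma>))"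
  by (intro poly_fun_sum) (auto intro: poly_fun_compose_permutes)

lemma sym_fun_sum_permutes: "sym_fun n (\<lambda>x. \<Sum>\<sigma> | \<sigma> permutes {..<n}. G (x \<circ> \<sigma>))"
  unfolding sym_fun_def using sum_permutes_compose[where f = "\<lambda>\<sigma>. G (_ \<circ> \<sigma>)"]
  by (auto simp: o_assoc[symmetric])

lemma poly_fun_sym_avg: "poly_fun n G \<Longrightarrow> poly_fun n (sym_avg n G)"
  unfolding sym_avg_def divide_inverse
  by (intro poly_fun_mult poly_fun_const poly_fun_sum_permutes)

lemma sym_fun_sym_avg: "sym_fun n (sym_avg n G)"
  using sym_fun_sum_permutes[of n G] by (simp add: sym_fun_def sym_avg_def)

lemma card_permutes: "card {\<sigma>. \<sigma> permutes {..<n::nat}} = fact n"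
  using card_permutations[of "{..<n}" n] by simp

lemma sym_avg_eq:
  assumes "\<And>\<sigma>. \<sigma> permutes {..<n} \<Longrightarrow> G (x \<circ> \<sigma>) = c"
  shows "sym_avg n G x = c"
proof -
  have "(\<Sum>\<sigma> | \<sigma> permutes {..<n}. G (x \<circ> \<sigma>)) = (\<Sum>\<sigma> | \<sigma> permutes {..<n}. c)"
    using assms by (intro sum.cong) auto
  then show ?thesis by (simp add: sym_avg_def card_permutes)
qed

lemma sym_avg_sym: "sym_fun n G \<Longrightarrow> sym_avg n G x = G x"
  by (intro sym_avg_eq) (auto simp: sym_fun_def)

lemma sym_avg_diff: "sym_avg n (\<lambda>x. F x - G x) x = sym_avg n F x - sym_avg n G x"
  by (simp add: sym_avg_def sum_subtractf diff_divide_distrib)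

lemma sym_avg_add: "sym_avg n (\<lambda>x. F x + G x) x = sym_avg n F x + sym_avg n G x"
  by (simp add: sym_avg_def sum.distrib add_divide_distrib)

lemma sym_avg_sum: "sym_avg n (\<lambda>x. \<Sum>i\<in>A. F i x) x = (\<Sum>i\<in>A. sym_avg n (F i) x)"
  unfolding sym_avg_def sum_divide_distrib by (rule sum.swap)

lemma sym_avg_mult_left: "sym_fun n S \<Longrightarrow> sym_avg n (\<lambda>x. S x * G x) x = S x * sym_avg n G x"
  by (simp add: sym_avg_def sym_fun_def sum_distrib_left)

lemma power_fun_apply: "(f ^ k) x = (f x :: 'b::comm_ring_1) ^ k"
  by (induction k) auto

lemma sum_fun_apply: "(sum F A) x = (\<Sum>i\<in>A. F i x :: 'b::comm_ring_1)"
  by (induction A rule: infinite_finite_induct) auto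

lemma subring_poly_fun: "subring_set {p. poly_fun n p}"
  by unfold_locales
     (auto simp: zero_fun_def one_fun_def plus_fun_def times_fun_def fun_Compl_def intro: poly_fun_intros)

lemma subring_sym_poly_fun: "subring_set {p. poly_fun n p \<and> sym_fun n p}"
  by unfold_locales
     (auto simp: zero_fun_def one_fun_def plus_fun_def times_fun_def fun_Compl_def sym_fun_def intro: poly_fun_intros)

section \<open>The algebra generated by the power sums\<close>

inductive psum_alg :: "nat \<Rightarrow> ((nat \<Rightarrow> complex) \<Rightarrow> complex) \<Rightarrow> bool" for n where
  const: "psum_alg n (\<lambda>x. c)"
| psum: "psum_alg n (\<lambda>x. \<Sum>k<n. x k ^ m)"
| add: "psum_alg n F \<Longrightarrow> psum_alg n G \<Longrightarrow> psum_alg n (\<lambda>x. F x + G x)"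
| mult: "psum_alg n F \<Longrightarrow> psum_alg n G \<Longrightarrow> psum_alg n (\<lambda>x. F x * G x)"

lemma poly_fun_psum_alg: "psum_alg n F \<Longrightarrow> poly_fun n F"
  by (induction rule: psum_alg.induct) (auto intro!: poly_fun_intros)

lemma psum_alg_sum: "(\<And>a. a \<in> A \<Longrightarrow> psum_alg n (F a)) \<Longrightarrow> psum_alg n (\<lambda>x. \<Sum>a\<in>A. F a x)"
  by (induction A rule: infinite_finite_induct) (auto intro: psum_alg.intros)

lemma psum_alg_diff: "psum_alg n F \<Longrightarrow> psum_alg n G \<Longrightarrow> psum_alg n (\<lambda>x. F x - G x)"
  using psum_alg.add[OF _ psum_alg.mult[OF psum_alg.const[of n "-1"]], of F G] by simp

definition dlists :: "nat \<Rightarrow> nat \<Rightarrow> nat list set" where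
  "dlists n s = {xs. length xs = s \<and> distinct xs \<and> set xs \<subseteq> {..<n}}"

lemma finite_dlists: "finite (dlists n s)"
  by (rule finite_subset[OF _ finite_lists_length_eq[of "{..<n}" s]]) (auto simp: dlists_def)

lemma dlists_0: "dlists n 0 = {[]}" by (auto simp: dlists_def)

lemma sum_dlists_Suc:
  "(\<Sum>xs\<in>dlists n (Suc s). f xs) = (\<Sum>xs\<in>dlists n s. \<Sum>m\<in>{..<n} - set xs. f (m # xs))"
proof -
  have "(\<Sum>xs\<in>dlists n s. \<Sum>m\<in>{..<n} - set xs. f (m # xs))
      = (\<Sum>(xs, m)\<in>(SIGMA xs:dlists n s. {..<n} - set xs). f (m # xs))"
    by (subst sum.Sigma) (auto intro: finite_dlists)
  also have "\<dots> = (\<Sum>xs\<in>dlists n (Suc s). f xs)"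
    by (rule sum.reindex_bij_witness[of _ "\<lambda>xs. (tl xs, hd xs)" "\<lambda>(xs, m). m # xs"])
       (auto simp: dlists_def length_Suc_conv)
  finally show ?thesis by simp
qed

text \<open>Sums over injective index tuples are reduced to power sums by inclusion-exclusion on the
  first index.\<close>
lemma psum_alg_dlists:
  "psum_alg n (\<lambda>x. \<Sum>xs\<in>dlists n (length es). \<Prod>j<length es. x (xs ! j) ^ (es ! j))"
proof (induction "length es" arbitrary: es)
  case 0
  then show ?case by (auto simp: dlists_0 intro: psum_alg.const)
next
  case (Suc s)
  obtain e fs where es: "es = e # fs" using Suc(2) by (cases es) auto
  have s: "length fs = s" using Suc(2) es by simp
  define N where "N gs x = (\<Sum>xs\<in>dlists n s. \<Prod>j<s. x (xs ! j) ^ (gs ! j))" for gs and x :: "nat \<Rightarrow> complex"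
  have N: "psum_alg n (N gs)" if "length gs = s" for gs
    using Suc(1)[of gs] that by (simp add: N_def[abs_def])
  have "(\<Sum>xs\<in>dlists n (length es). \<Prod>j<length es. x (xs ! j) ^ (es ! j))
      = (\<Sum>k<n. x k ^ e) * N fs x - (\<Sum>t<s. N (fs[t := fs ! t + e]) x)" for x
  proof -
    have "(\<Sum>xs\<in>dlists n (length es). \<Prod>j<length es. x (xs ! j) ^ (es ! j))
      = (\<Sum>xs\<in>dlists n s. \<Sum>m\<in>{..<n} - set xs. x m ^ e * (\<Prod>j<s. x (xs ! j) ^ (fs ! j)))"
      using Suc(2) es by (simp add: sum_dlists_Suc s prod.lessThan_Suc_shift del: prod.lessThan_Suc)
    also have "\<dots> = (\<Sum>xs\<in>dlists n s. (\<Sum>k<n. x k ^ e) * (\<Prod>j<s. x (xs ! j) ^ (fs ! j))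
         - (\<Sum>t<s. \<Prod>j<s. x (xs ! j) ^ (fs[t := fs ! t + e] ! j)))"
    proof (rule sum.cong[OF refl])
      fix xs assume xs: "xs \<in> dlists n s"
      have "(\<Sum>m\<in>set xs. x m ^ e) = (\<Sum>t<s. x (xs ! t) ^ e)"
        using xs by (intro sum.reindex_bij_betw[symmetric] bij_betw_nth) (auto simp: dlists_def)
      moreover have "x (xs ! t) ^ e * (\<Prod>j<s. x (xs ! j) ^ (fs ! j))
          = (\<Prod>j<s. x (xs ! j) ^ (fs[t := fs ! t + e] ! j))" if t: "t < s" for t
      proof -
        have "(\<Prod>j<s. x (xs ! j) ^ (fs[t := fs ! t + e] ! j))
            = (\<Prod>j<s. x (xs ! j) ^ (fs ! j) * (if j = t then x (xs ! t) ^ e else 1))"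
          using s t by (intro prod.cong) (auto simp: nth_list_update power_add)
        also have "\<dots> = (\<Prod>j<s. x (xs ! j) ^ (fs ! j)) * x (xs ! t) ^ e"
          using t by (simp add: prod.distrib prod.delta)
        finally show ?thesis by simp
      qed
      moreover have "(\<Sum>m\<in>{..<n} - set xs. x m ^ e) = (\<Sum>m<n. x m ^ e) - (\<Sum>m\<in>set xs. x m ^ e)"
        using xs by (intro sum_diff) (auto simp: dlists_def)
      ultimately show "(\<Sum>m\<in>{..<n} - set xs. x m ^ e * (\<Prod>j<s. x (xs ! j) ^ (fs ! j)))
        = (\<Sum>k<n. x k ^ e) * (\<Prod>j<s. x (xs ! j) ^ (fs ! j))
         - (\<Sum>t<s. \<Prod>j<s. x (xs ! j) ^ (fs[t := fs ! t + e] ! j))"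
        by (simp add: sum_distrib_right[symmetric] left_diff_distrib)
          (simp add: sum_distrib_right)
    qed
    also have "\<dots> = (\<Sum>k<n. x k ^ e) * N fs x - (\<Sum>t<s. N (fs[t := fs ! t + e]) x)"
      unfolding N_def sum_subtractf sum_distrib_left[symmetric] by (subst (2) sum.swap) simp
    finally show ?thesis .
  qed
  then show ?case
    by (auto intro!: psum_alg_diff psum_alg.mult psum_alg.psum psum_alg_sum N s)
qed

lemma sum_permutes_dlists:
  "(\<Sum>\<sigma> | \<sigma> permutes {..<n}. f (map \<sigma> [0..<n])) = (\<Sum>xs\<in>dlists n n. f xs)"
proof (rule sum.reindex_bij_witness[of _ "\<lambda>xs k. if k < n then xs ! k else k" "\<lambda>\<sigma>. map \<sigma> [0..<n]"])
  fix \<sigma> assume s: "\<sigma> \<in> {\<sigma>. \<sigma> permutes {..<n}}"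
  show "(\<lambda>k. if k < n then map \<sigma> [0..<n] ! k else k) = \<sigma>"
    using s permutes_not_in[of \<sigma> "{..<n}"] by auto
  show "map \<sigma> [0..<n] \<in> dlists n n"
  proof -
    have "\<sigma> permutes {..<n}" using s by simp
    then show ?thesis
      using permutes_in_image[of \<sigma> "{..<n}"] permutes_inj_on[of \<sigma>]
      by (auto simp: dlists_def distinct_map)
  qed
next
  fix xs assume xs: "xs \<in> dlists n n"
  then have l: "length xs = n" "distinct xs" and sub: "set xs \<subseteq> {..<n}" by (auto simp: dlists_def)
  show "map (\<lambda>k. if k < n then xs ! k else k) [0..<n] = xs"
    using l by (intro nth_equalityI) auto
  have "card (set xs) = n" using l distinct_card by force
  then have "set xs = {..<n}" using sub by (intro card_subset_eq) auto
  then have "bij_betw ((!) xs) {..<n} {..<n}"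
    by (intro bij_betw_nth) (simp_all only: l)
  then have "bij_betw (\<lambda>k. if k < n then xs ! k else k) {..<n} {..<n}"
    by (subst bij_betw_cong[of _ _ "(!) xs"]) auto
  then have "(\<lambda>k. if k < n then xs ! k else k) permutes {..<n}"
    by (rule bij_imp_permutes) simp
  then show "(\<lambda>k. if k < n then xs ! k else k) \<in> {\<sigma>. \<sigma> permutes {..<n}}" by simp
qed auto

text \<open>A symmetric polynomial equals its average, and the average of a monomial is, up to a
  factor, a sum over injective index tuples.\<close>

lemma psum_alg_sym_poly_fun:
  assumes "poly_fun n G" "sym_fun n G"
  shows "psum_alg n G"
proof -
  obtain A c where G: "G = (\<lambda>x. \<Sum>e\<in>A. c e * (\<Prod>i<n. x i ^ e i))"
    using assms(1) unfolding poly_fun_def by blast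
  have "G x = (\<Sum>e\<in>A. (c e / fact n) * (\<Sum>xs\<in>dlists n (length (map e [0..<n])).
      \<Prod>j<length (map e [0..<n]). x (xs ! j) ^ (map e [0..<n] ! j)))" for x
  proof -
    have "G x = sym_avg n G x" using sym_avg_sym[OF assms(2)] by simp
    also have "\<dots> = (\<Sum>e\<in>A. (c e / fact n) * (\<Sum>\<sigma> | \<sigma> permutes {..<n}. \<Prod>i<n. x (\<sigma> i) ^ e i))"
      unfolding sym_avg_def G
      by (subst sum.swap) (simp add: sum_divide_distrib sum_distrib_left)
    also have "(\<lambda>e. \<Sum>\<sigma> | \<sigma> permutes {..<n}. \<Prod>i<n. x (\<sigma> i) ^ e i)
       = (\<lambda>e. \<Sum>xs\<in>dlists n n. \<Prod>i<n. x (xs ! i) ^ e i)"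
      using sum_permutes_dlists[of "\<lambda>xs. \<Prod>i<n. x (xs ! i) ^ _ i" n] by (auto intro!: ext)
    also have "(\<lambda>e xs. \<Prod>i<n. x (xs ! i) ^ e i) = (\<lambda>e xs. \<Prod>i<n. x (xs ! i) ^ (map e [0..<n] ! i))"
      by (intro ext prod.cong) auto
    finally show ?thesis by simp
  qed
  then have "G = (\<lambda>x. (\<Sum>e\<in>A. (c e / fact n) * (\<Sum>xs\<in>dlists n (length (map e [0..<n])).
      \<Prod>j<length (map e [0..<n]). x (xs ! j) ^ (map e [0..<n] ! j))))" by blast
  moreover have "psum_alg n (\<lambda>x. (\<Sum>e\<in>A. (c e / fact n) * (\<Sum>xs\<in>dlists n (length (map e [0..<n])).
      \<Prod>j<length (map e [0..<n]). x (xs ! j) ^ (map e [0..<n] ! j))))"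
    by (intro psum_alg_sum psum_alg.mult psum_alg.const psum_alg_dlists)
  ultimately show ?thesis by simp
qed

text \<open>The generators are homogeneous, so the algebra contains the homogeneous components of
  its elements. They are obtained as coefficients along rays through the origin;
  \<open>no_equation\<close> extracts one of them.\<close>

lemma psum_alg_graded:
  assumes "psum_alg n G"
  shows "\<exists>B :: nat \<Rightarrow> (nat \<Rightarrow> complex) \<Rightarrow> complex. (\<forall>i. psum_alg n (B i)) \<and>
     (\<forall>x. \<exists>P. (\<forall>t. G (\<lambda>k. t * x k) = poly P t) \<and> (\<forall>i. coeff P i = B i x))"
  using assms
proof induction
  case (const c)
  have "psum_alg n (\<lambda>x. if i = 0 then c else 0)" for i :: nat by (rule psum_alg.const)
  then show ?case
    by (intro exI[of _ "\<lambda>i x. if i = 0 then c else 0"])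
       (auto intro!: exI[of _ "[:c:]"] simp: coeff_pCons split: nat.split)
next
  case (psum m)
  have "psum_alg n (\<lambda>x. if i = m then \<Sum>k<n. x k ^ m else 0)" for i
    by (cases "i = m") (auto intro: psum_alg.intros)
  then show ?case
    by (intro exI[of _ "\<lambda>i x. if i = m then \<Sum>k<n. x k ^ m else 0"])
       (auto intro!: exI[of _ "monom (\<Sum>k<n. _ k ^ m) m"] simp: poly_monom power_mult_distrib sum_distrib_left algebra_simps)
next
  case (add F G)
  then obtain A B where A: "\<And>i. psum_alg n (A i)" and A': "\<And>x. \<exists>P. (\<forall>t. F (\<lambda>k. t * x k) = poly P t) \<and> (\<forall>i. coeff P i = A i x)"
    and B: "\<And>i. psum_alg n (B i)" and B': "\<And>x. \<exists>P. (\<forall>t. G (\<lambda>k. t * x k) = poly P t) \<and> (\<forall>i. coeff P i = B i x)"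
    by blast
  have "\<exists>P. (\<forall>t. F (\<lambda>k. t * x k) + G (\<lambda>k. t * x k) = poly P t) \<and> (\<forall>i. coeff P i = A i x + B i x)" for x
  proof -
    obtain P Q where "\<And>t. F (\<lambda>k. t * x k) = poly P t" "\<And>i. coeff P i = A i x"
      "\<And>t. G (\<lambda>k. t * x k) = poly Q t" "\<And>i. coeff Q i = B i x" using A'[of x] B'[of x] by blast
    then show ?thesis by (intro exI[of _ "P + Q"]) auto
  qed
  then show ?case
    by (intro exI[of _ "\<lambda>i x. A i x + B i x"]) (auto intro: psum_alg.add A B)
next
  case (mult F G)
  then obtain A B where A: "\<And>i. psum_alg n (A i)" and A': "\<And>x. \<exists>P. (\<forall>t. F (\<lambda>k. t * x k) = poly P t) \<and> (\<forall>i. coeff P i = A i x)"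
    and B: "\<And>i. psum_alg n (B i)" and B': "\<And>x. \<exists>P. (\<forall>t. G (\<lambda>k. t * x k) = poly P t) \<and> (\<forall>i. coeff P i = B i x)"
    by blast
  have "\<exists>P. (\<forall>t. F (\<lambda>k. t * x k) * G (\<lambda>k. t * x k) = poly P t) \<and> (\<forall>i. coeff P i = (\<Sum>j\<le>i. A j x * B (i - j) x))" for x
  proof -
    obtain P Q where "\<And>t. F (\<lambda>k. t * x k) = poly P t" "\<And>i. coeff P i = A i x"
      "\<And>t. G (\<lambda>k. t * x k) = poly Q t" "\<And>i. coeff Q i = B i x" using A'[of x] B'[of x] by blast
    then show ?thesis by (intro exI[of _ "P * Q"]) (auto simp: coeff_mult)
  qed
  then show ?case
    by (intro exI[of _ "\<lambda>i x. \<Sum>j\<le>i. A j x * B (i - j) x"]) (auto intro!: psum_alg_sum psum_alg.mult A B)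
qed

section \<open>A system of parameters from the strata of coinciding coordinates\<close>

text \<open>A set partition of the indices is stored as an equivalence relation, so that coarsening
  is inclusion and the stratum of a point \<open>x\<close> is \<open>ker_on n x\<close>.\<close>

definition ker_on :: "nat \<Rightarrow> (nat \<Rightarrow> 'a) \<Rightarrow> (nat \<times> nat) set" where
  "ker_on n f = {(k, l). k < n \<and> l < n \<and> f k = f l}"

abbreviation off :: "nat \<Rightarrow> (nat \<times> nat) set \<Rightarrow> (nat \<times> nat) set" where
  "off n R \<equiv> {..<n} \<times> {..<n} - R"

text \<open>Ordered pairs are used so that each difference occurs with both signs: permutations
  preserving \<open>R\<close> then leave the product unchanged, with no alternating sign.\<close>

definition omega :: "nat \<Rightarrow> (nat \<times> nat) set \<Rightarrow> (nat \<Rightarrow> complex) \<Rightarrow> complex" where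
  "omega n R x = (\<Prod>(k, l)\<in>off n R. x k - x l)"

definition strata :: "nat \<Rightarrow> nat \<Rightarrow> (nat \<times> nat) set set" where
  "strata n s = {ker_on n f | f :: nat \<Rightarrow> nat. card (f ` {..<n}) = s}"

text \<open>Divisible by every number up to \<open>n * n\<close>, hence by every degree
  \<open>card (off n R)\<close> that is positive.\<close>

definition theta_deg :: "nat \<Rightarrow> nat" where "theta_deg n = fact (n * n)"

text \<open>The exponents make the sum homogeneous of degree \<open>theta_deg n\<close>. On the points with at most
  \<open>s\<close> distinct coordinates, \<open>theta n s\<close> vanishes exactly at those with fewer than \<open>s\<close>.\<close>
definition theta :: "nat \<Rightarrow> nat \<Rightarrow> (nat \<Rightarrow> complex) \<Rightarrow> complex" where
  "theta n s x = (if s = 1 then (\<Sum>k<n. x k) ^ theta_deg n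
     else \<Sum>R\<in>strata n s. omega n R x ^ (theta_deg n div card (off n R)))"

lemma ker_on_factor:
  assumes "ker_on n f \<subseteq> ker_on n g"
  obtains h where "\<And>k. k < n \<Longrightarrow> h (f k) = g k"
proof -
  define h where "h y = g (SOME k. k < n \<and> f k = y)" for y
  have "h (f k) = g k" if "k < n" for k
  proof -
    have "(SOME l. l < n \<and> f l = f k) < n \<and> f (SOME l. l < n \<and> f l = f k) = f k"
      by (rule someI[of _ k]) (use that in simp)
    then have "(SOME l. l < n \<and> f l = f k, k) \<in> ker_on n f"
      using that by (simp add: ker_on_def)
    then show ?thesis using assms by (auto simp: ker_on_def h_def)
  qed
  then show ?thesis by (rule that)
qed

lemma card_image_mono_ker_on:
  assumes "ker_on n f \<subseteq> ker_on n g"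
  shows "card (g ` {..<n}) \<le> card (f ` {..<n})"
proof -
  obtain h where h: "\<And>k. k < n \<Longrightarrow> h (f k) = g k" using ker_on_factor[OF assms] by blast
  then have "g ` {..<n} = h ` f ` {..<n}" by (auto simp: image_iff)
  then show ?thesis using card_image_le[of "f ` {..<n}" h] by simp
qed

lemma ker_on_eqI:
  assumes "ker_on n f \<subseteq> ker_on n g" "card (f ` {..<n}) \<le> card (g ` {..<n})"
  shows "ker_on n f = ker_on n g"
proof -
  obtain h where h: "\<And>k. k < n \<Longrightarrow> h (f k) = g k" using ker_on_factor[OF assms(1)] by blast
  then have "g ` {..<n} = h ` f ` {..<n}" by (auto simp: image_iff)
  then have "card (h ` f ` {..<n}) = card (f ` {..<n})"
    using card_image_le[of "f ` {..<n}" h] assms(2) by simp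
  then have "inj_on h (f ` {..<n})" by (intro eq_card_imp_inj_on) auto
  then have "f k = f l" if "k < n" "l < n" "g k = g l" for k l
    using inj_onD[of h "f ` {..<n}" "f k" "f l"] h[of k] h[of l] that by simp
  then show ?thesis using assms(1) by (auto simp: ker_on_def)
qed

lemma card_image_ker_on_cong:
  "ker_on n f = ker_on n g \<Longrightarrow> card (f ` {..<n}) = card (g ` {..<n})"
  using card_image_mono_ker_on[of n f g] card_image_mono_ker_on[of n g f] by simp

lemma finite_off: "finite (off n R)" by simp

lemma card_off_le: "card (off n R) \<le> n * n"
  using card_mono[of "{..<n} \<times> {..<n}" "off n R"] by (auto simp: card_cartesian_product)

lemma finite_strata: "finite (strata n s)"
  by (rule finite_subset[of _ "Pow ({..<n} \<times> {..<n})"]) (auto simp: strata_def ker_on_def)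

lemma omega_ker_on_eq_0_iff: "omega n (ker_on n f) x = 0 \<longleftrightarrow> \<not> ker_on n x \<subseteq> ker_on n f"
proof
  assume "omega n (ker_on n f) x = 0"
  then show "\<not> ker_on n x \<subseteq> ker_on n f"
    by (auto simp: omega_def ker_on_def)
next
  assume "\<not> ker_on n x \<subseteq> ker_on n f"
  then obtain k l where kl: "(k, l) \<in> ker_on n x" "(k, l) \<notin> ker_on n f" by auto
  then have "(k, l) \<in> off n (ker_on n f)" "x k - x l = 0" by (auto simp: ker_on_def)
  then show "omega n (ker_on n f) x = 0"
    unfolding omega_def by (intro prod_zero) (auto intro!: bexI[of _ "(k, l)"])
qed

text \<open>The least index of each class. It turns a labelling with values of any type into one
  with values in \<open>nat\<close>, the only ones that \<open>strata\<close> admits, and it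
  retracts the indices onto class representatives.\<close>

definition rep_fun :: "(nat \<times> nat) set \<Rightarrow> nat \<Rightarrow> nat" where
  "rep_fun R k = (LEAST l. (k, l) \<in> R)"

lemma rep_fun:
  assumes "k < n"
  shows "rep_fun (ker_on n f) k < n" "f (rep_fun (ker_on n f) k) = f k"
proof -
  have "(k, rep_fun (ker_on n f) k) \<in> ker_on n f"
    unfolding rep_fun_def by (rule LeastI[of _ k]) (use assms in \<open>auto simp: ker_on_def\<close>)
  then show "rep_fun (ker_on n f) k < n" "f (rep_fun (ker_on n f) k) = f k"
    by (auto simp: ker_on_def)
qed

lemma ker_on_rep_fun: "ker_on n (rep_fun (ker_on n f)) = ker_on n f"
proof -
  define g where "g = rep_fun (ker_on n f)"
  have "g k = g l" if "k < n" "l < n" "f k = f l" for k l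
    using that by (simp add: g_def rep_fun_def ker_on_def)
  moreover have "f k = f l" if "k < n" "l < n" "g k = g l" for k l
    using rep_fun(2)[of k n f] rep_fun(2)[of l n f] that by (simp add: g_def)
  ultimately have "ker_on n g = ker_on n f" unfolding ker_on_def by blast
  then show ?thesis by (simp add: g_def)
qed

lemma ker_on_in_strata: "ker_on n f \<in> strata n (card (f ` {..<n}))"
  unfolding strata_def using ker_on_rep_fun[of n f] card_image_ker_on_cong[OF ker_on_rep_fun[of n f]]
  by blast

lemma strata_off_nonempty:
  assumes "R \<in> strata n s" "s \<ge> 2"
  shows "card (off n R) > 0"
proof -
  obtain f :: "nat \<Rightarrow> nat" where f: "R = ker_on n f" "card (f ` {..<n}) = s"
    using assms(1) by (auto simp: strata_def)
  have "off n R \<noteq> {}"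
  proof
    assume *: "off n R = {}"
    have "f k = f 0" if "k < n" for k
    proof -
      have "(k, 0) \<in> {..<n} \<times> {..<n}" using that by auto
      then have "(k, 0) \<in> ker_on n f" using * f(1) by blast
      then show ?thesis by (simp add: ker_on_def)
    qed
    then have sub: "f ` {..<n} \<subseteq> {f 0}" by blast
    from card_mono[OF _ sub] have "card (f ` {..<n}) \<le> 1" by simp
    then show False using f(2) assms(2) by linarith
  qed
  then show ?thesis by (simp add: card_gt_0_iff)
qed

lemma theta_exponent:
  assumes "R \<in> strata n s" "s \<ge> 2"
  shows "card (off n R) * (theta_deg n div card (off n R)) = theta_deg n"
    "theta_deg n div card (off n R) > 0"
proof -
  have "card (off n R) dvd theta_deg n"
    unfolding theta_deg_def using strata_off_nonempty[OF assms] card_off_le by (intro dvd_fact) auto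
  then show *: "card (off n R) * (theta_deg n div card (off n R)) = theta_deg n" by simp
  show "theta_deg n div card (off n R) > 0"
    by (rule ccontr) (use * in \<open>simp add: theta_deg_def\<close>)
qed

text \<open>If no factor vanishes, all coincidences of \<open>x\<close> are among those of
  \<open>R\<close>; having at most \<open>s\<close> values then forces equality. Thus at most one
  summand of \<open>theta\<close> survives at such a point.\<close>

lemma strata_omega_nonzero:
  assumes "R \<in> strata n s" "card (x ` {..<n}) \<le> s" "omega n R x \<noteq> 0"
  shows "R = ker_on n x \<and> card (x ` {..<n}) = s"
proof -
  obtain f :: "nat \<Rightarrow> nat" where f: "R = ker_on n f" "card (f ` {..<n}) = s"
    using assms(1) by (auto simp: strata_def)
  have "ker_on n x \<subseteq> ker_on n f" using assms(3) f by (simp add: omega_ker_on_eq_0_iff)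
  then have "ker_on n x = ker_on n f" using assms(2) f by (intro ker_on_eqI) auto
  then show ?thesis using f card_image_ker_on_cong by metis
qed

lemma theta_eq:
  assumes "s \<ge> 2" "card (x ` {..<n}) = s"
  shows "theta n s x = omega n (ker_on n x) x ^ (theta_deg n div card (off n (ker_on n x)))"
proof -
  have R: "ker_on n x \<in> strata n s" using ker_on_in_strata[of n x] assms by simp
  have "theta n s x = (\<Sum>R\<in>strata n s. omega n R x ^ (theta_deg n div card (off n R)))"
    using assms by (simp add: theta_def)
  also have "\<dots> = (\<Sum>R\<in>{ker_on n x}. omega n R x ^ (theta_deg n div card (off n R)))"
  proof (rule sum.mono_neutral_right[OF finite_strata])
    show "\<forall>R\<in>strata n s - {ker_on n x}. omega n R x ^ (theta_deg n div card (off n R)) = 0"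
      using strata_omega_nonzero[of _ n s x] assms theta_exponent(2)[of _ n s]
      by (auto simp: power_0_left)
  qed (use R in auto)
  finally show ?thesis by simp
qed

lemma theta_eq_0:
  assumes "s \<ge> 2" "card (x ` {..<n}) < s"
  shows "theta n s x = 0"
proof -
  have "omega n R x ^ (theta_deg n div card (off n R)) = 0" if "R \<in> strata n s" for R
    using strata_omega_nonzero[OF that, of x] assms theta_exponent(2)[OF that]
    by (auto simp: power_0_left)
  then have "(\<Sum>R\<in>strata n s. omega n R x ^ (theta_deg n div card (off n R))) = 0"
    by (intro sum.neutral) blast
  then show ?thesis using assms by (simp add: theta_def)
qed

lemma theta_neq_0:
  assumes "s \<ge> 2" "card (x ` {..<n}) = s"
  shows "theta n s x \<noteq> 0"
  unfolding theta_eq[OF assms] by (simp add: omega_ker_on_eq_0_iff)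

lemma poly_fun_omega: "poly_fun n (omega n R)"
proof -
  have "omega n R = (\<lambda>x. \<Prod>p\<in>off n R. x (fst p) - x (snd p))"
    by (auto simp: omega_def split_def)
  then show ?thesis by (auto intro!: poly_fun_prod poly_fun_diff poly_fun_coord)
qed

lemma poly_fun_theta: "poly_fun n (theta n s)"
  unfolding theta_def[abs_def]
  by (cases "s = 1") (auto intro!: poly_fun_power poly_fun_sum poly_fun_coord poly_fun_omega)

lemma omega_scale: "omega n R (\<lambda>k. t * x k) = t ^ card (off n R) * omega n R x"
proof -
  have "omega n R (\<lambda>k. t * x k) = (\<Prod>p\<in>off n R. t * (case p of (k, l) \<Rightarrow> x k - x l))"
    unfolding omega_def by (intro prod.cong) (auto simp: algebra_simps)
  then show ?thesis by (simp add: omega_def prod.distrib)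
qed

lemma theta_scale: "s \<ge> 1 \<Longrightarrow> theta n s (\<lambda>k. t * x k) = t ^ theta_deg n * theta n s x"
proof (cases "s = 1")
  case False
  assume "s \<ge> 1"
  then have s: "s \<ge> 2" using False by simp
  have "omega n R (\<lambda>k. t * x k) ^ (theta_deg n div card (off n R))
      = t ^ theta_deg n * omega n R x ^ (theta_deg n div card (off n R))" if "R \<in> strata n s" for R
    using theta_exponent(1)[OF that s] by (simp add: omega_scale power_mult_distrib power_mult[symmetric])
  then show ?thesis using False by (simp add: theta_def sum_distrib_left)
qed (simp add: theta_def sum_distrib_left[symmetric] power_mult_distrib)

lemma omega_permute:
  assumes "\<sigma> permutes {..<n}"
  shows "omega n (map_prod \<sigma> \<sigma> ` R) x = omega n R (x \<circ> \<sigma>)"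
proof -
  have bij: "bij \<sigma>" using assms by (rule permutes_bij)
  then have "inj (map_prod \<sigma> \<sigma>)" by (intro prod.inj_map) (auto intro: bij_is_inj)
  then have "off n (map_prod \<sigma> \<sigma> ` R) = map_prod \<sigma> \<sigma> ` off n R"
    using permutes_image[OF assms] by (simp add: image_set_diff map_prod_surj_on)
  then show ?thesis
    unfolding omega_def using \<open>inj (map_prod \<sigma> \<sigma>)\<close>
    by (simp add: prod.reindex inj_on_subset split_def)
qed

lemma card_off_permute:
  assumes "\<sigma> permutes {..<n}"
  shows "card (off n (map_prod \<sigma> \<sigma> ` R)) = card (off n R)"
proof -
  have bij: "bij \<sigma>" using assms by (rule permutes_bij)
  then have "inj (map_prod \<sigma> \<sigma>)" by (intro prod.inj_map) (auto intro: bij_is_inj)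
  then have "off n (map_prod \<sigma> \<sigma> ` R) = map_prod \<sigma> \<sigma> ` off n R"
    using permutes_image[OF assms] by (simp add: image_set_diff map_prod_surj_on)
  then show ?thesis
    using \<open>inj (map_prod \<sigma> \<sigma>)\<close> by (simp add: card_image inj_on_subset)
qed

lemma strata_permute:
  assumes "\<sigma> permutes {..<n}" "R \<in> strata n s"
  shows "map_prod \<sigma> \<sigma> ` R \<in> strata n s"
proof -
  obtain f :: "nat \<Rightarrow> nat" where f: "R = ker_on n f" "card (f ` {..<n}) = s"
    using assms(2) by (auto simp: strata_def)
  define \<tau> where "\<tau> = inv_into UNIV \<sigma>"
  have \<tau>: "\<tau> permutes {..<n}" unfolding \<tau>_def by (rule permutes_inv[OF assms(1)])
  have st: "\<sigma> (\<tau> k) = k" "\<tau> (\<sigma> k) = k" for k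
    using permutes_inverses[OF assms(1)] by (auto simp: \<tau>_def)
  have lt: "\<sigma> k < n \<longleftrightarrow> k < n" "\<tau> k < n \<longleftrightarrow> k < n" for k
    using permutes_in_image[OF assms(1), of k] permutes_in_image[OF \<tau>, of k] by auto
  have "map_prod \<sigma> \<sigma> ` R = ker_on n (f \<circ> \<tau>)"
  proof
    show "ker_on n (f \<circ> \<tau>) \<subseteq> map_prod \<sigma> \<sigma> ` R"
    proof
      fix p assume "p \<in> ker_on n (f \<circ> \<tau>)"
      then have "map_prod \<tau> \<tau> p \<in> R" "p = map_prod \<sigma> \<sigma> (map_prod \<tau> \<tau> p)"
        by (auto simp: f ker_on_def lt st)
      then show "p \<in> map_prod \<sigma> \<sigma> ` R" by blast
    qed
  qed (auto simp: f ker_on_def lt st)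
  moreover have "card ((f \<circ> \<tau>) ` {..<n}) = s"
    unfolding image_comp[symmetric] permutes_image[OF \<tau>] by (rule f(2))
  ultimately show ?thesis unfolding strata_def by blast
qed

lemma sym_fun_theta: "sym_fun n (theta n s)"
  unfolding sym_fun_def
proof (intro allI impI)
  fix \<sigma> x assume s: "\<sigma> permutes {..<n}"
  define \<tau> where "\<tau> = inv_into UNIV \<sigma>"
  have \<tau>: "\<tau> permutes {..<n}" unfolding \<tau>_def by (rule permutes_inv[OF s])
  have st: "\<sigma> (\<tau> k) = k" "\<tau> (\<sigma> k) = k" for k
    using permutes_inverses[OF s] by (auto simp: \<tau>_def)
  have inv: "map_prod \<sigma> \<sigma> ` map_prod \<tau> \<tau> ` R = R" "map_prod \<tau> \<tau> ` map_prod \<sigma> \<sigma> ` R = R" for R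
    by (auto simp: image_image map_prod_def st split_def)
  show "theta n s (x \<circ> \<sigma>) = theta n s x" for s
  proof (cases "s = 1")
    case True
    have "(\<Sum>k<n. x (\<sigma> k)) = (\<Sum>k<n. x k)"
      using sum.permute[OF s, of x] by (simp add: comp_def)
    then show ?thesis using True by (simp add: theta_def)
  next
    case False
    have "(\<Sum>R\<in>strata n s. omega n R (x \<circ> \<sigma>) ^ (theta_deg n div card (off n R)))
        = (\<Sum>R\<in>strata n s. omega n R x ^ (theta_deg n div card (off n R)))"
      by (rule sum.reindex_bij_witness[of _ "\<lambda>R. map_prod \<tau> \<tau> ` R" "\<lambda>R. map_prod \<sigma> \<sigma> ` R"])
         (simp_all only: inv strata_permute[OF s] strata_permute[OF \<tau>] omega_permute[OF s] card_off_permute[OF s])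
    then show ?thesis using False by (simp add: theta_def)
  qed
qed

section \<open>Radical membership for the parameters, with explicit exponents\<close>

lemma radical_step:
  assumes "poly_fun n v" "poly_fun n a" "poly_fun n U" "finite A" "i \<notin> A"
    and "\<And>j. poly_fun n (c j)"
    and "\<And>x. x \<in> Y \<Longrightarrow> (v x ^ E - a x * U x) ^ N = (\<Sum>j\<in>A. th j x * c j x)"
    and "\<And>x. x \<in> Y \<Longrightarrow> th i x = a x"
  shows "\<exists>c. (\<forall>j. poly_fun n (c j)) \<and> (\<forall>x\<in>Y. v x ^ (E * N) = (\<Sum>j\<in>insert i A. th j x * c j x))"
proof -
  \<comment> \<open>The cofactor of \<open>y - z\<close> in \<open>y ^ N - z ^ N\<close> for
    \<open>y = v x ^ E\<close> and \<open>z = y - a x * U x\<close>.\<close>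
  define w where "w x = U x * (\<Sum>k<N. (v x ^ E - a x * U x) ^ (N - Suc k) * (v x ^ E) ^ k)" for x
  have w: "poly_fun n w"
    unfolding w_def[abs_def] by (intro poly_fun_mult poly_fun_sum poly_fun_power poly_fun_diff assms)
  have eq: "(v x ^ E) ^ N = a x * w x + (v x ^ E - a x * U x) ^ N" for x
    using power_diff_sumr2[of "v x ^ E" N "v x ^ E - a x * U x"] by (simp add: w_def algebra_simps)
  show ?thesis
    by (rule exI[of _ "c(i := w)"])
       (use assms(4-8) w eq in \<open>auto simp: power_mult intro!: sum.cong\<close>)
qed

text \<open>Pulled back along the retraction to class representatives, \<open>v\<close> vanishes
  whenever two representatives coincide, so each difference divides it separately. Multiplying these
  factorisations over all pairs costs a power of \<open>v\<close> but avoids any coprimality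
  argument.\<close>

lemma poly_fun_stratum_factor:
  assumes v: "poly_fun n v" and R: "R \<in> strata n s"
    and v0: "\<And>x. card (x ` {..<n}) < s \<Longrightarrow> v x = 0"
  shows "\<exists>W. poly_fun n W \<and> (\<forall>x. ker_on n x = R \<longrightarrow> v x ^ card (off n R) = omega n R x * W x)"
proof -
  obtain f :: "nat \<Rightarrow> nat" where f: "R = ker_on n f" "card (f ` {..<n}) = s"
    using R by (auto simp: strata_def)
  define \<rho> where "\<rho> = rep_fun R"
  have \<rho>n: "\<rho> k < n" if "k < n" for k using rep_fun[OF that, of f] by (simp add: \<rho>_def f)
  have \<rho>R: "ker_on n \<rho> = R" using ker_on_rep_fun[of n f] by (simp add: \<rho>_def f)
  have card\<rho>: "card (\<rho> ` {..<n}) = s" using card_image_ker_on_cong[of n \<rho> f] \<rho>R f by simp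
  define V where "V x = v (\<lambda>k. x (\<rho> k))" for x
  have V: "poly_fun n V" unfolding V_def
    by (rule poly_fun_subst[OF v]) (auto intro: poly_fun_coord \<rho>n)
  have "\<exists>w. poly_fun n w \<and> (\<forall>x. V x = (x (\<rho> (fst p)) - x (\<rho> (snd p))) * w x)" if "p \<in> off n R" for p
  proof (rule poly_fun_factor_diff[OF V])
    obtain k l where kl: "p = (k, l)" "k < n" "l < n" "(k, l) \<notin> R" using \<open>p \<in> off n R\<close> by (cases p) auto
    show "\<rho> (fst p) < n" "\<rho> (snd p) < n" using kl \<rho>n by auto
    fix x :: "nat \<Rightarrow> complex" assume x: "x (\<rho> (fst p)) = x (\<rho> (snd p))"
    have sub: "ker_on n \<rho> \<subseteq> ker_on n (\<lambda>k. x (\<rho> k))" by (auto simp: ker_on_def)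
    have "card ((\<lambda>k. x (\<rho> k)) ` {..<n}) < s"
    proof (rule ccontr)
      assume "\<not> ?thesis"
      then have "ker_on n \<rho> = ker_on n (\<lambda>k. x (\<rho> k))"
        using card\<rho> by (intro ker_on_eqI sub) auto
      moreover have "(k, l) \<in> ker_on n (\<lambda>k. x (\<rho> k))" using x kl by (simp add: ker_on_def)
      ultimately show False using kl(4) \<rho>R by simp
    qed
    then show "V x = 0" unfolding V_def by (rule v0)
  qed
  then obtain w where w: "\<And>p. p \<in> off n R \<Longrightarrow> poly_fun n (w p)"
    "\<And>p x. p \<in> off n R \<Longrightarrow> V x = (x (\<rho> (fst p)) - x (\<rho> (snd p))) * w p x"
    by metis
  define W where "W x = (\<Prod>p\<in>off n R. w p x)" for x
  have "poly_fun n W" unfolding W_def[abs_def] by (intro poly_fun_prod w)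
  moreover have "v x ^ card (off n R) = omega n R x * W x" if x: "ker_on n x = R" for x
  proof -
    have xr: "x (\<rho> k) = x k" if "k < n" for k
      using rep_fun(2)[OF that, of x] x by (simp add: \<rho>_def)
    then have "V x = v x" unfolding V_def by (intro poly_fun_cong[OF v]) auto
    have "v x ^ card (off n R) = (\<Prod>p\<in>off n R. V x)" using \<open>V x = v x\<close> by simp
    also have "\<dots> = (\<Prod>p\<in>off n R. (x (fst p) - x (snd p)) * w p x)"
      using w(2) xr by (intro prod.cong refl) (auto simp: mem_Times_iff)
    also have "\<dots> = omega n R x * W x"
      by (simp add: omega_def W_def prod.distrib split_def)
    finally show ?thesis .
  qed
  ultimately show ?thesis by blast
qed

lemma theta_divides_power:
  assumes v: "poly_fun n v" and n: "n > 0" and s: "s \<ge> 2" and e: "e > 0"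
    and v0: "\<And>x. card (x ` {..<n}) < s \<Longrightarrow> v x = 0"
  shows "\<exists>E U. poly_fun n U \<and> (\<forall>x. card (x ` {..<n}) \<le> s \<longrightarrow> v x ^ E = theta n s x ^ e * U x)"
proof -
  define m where "m R = theta_deg n div card (off n R)" for R
  \<comment> \<open>A common exponent for all strata, from \<open>card (off n R) \<le> n * n\<close>
    and \<open>m R \<le> theta_deg n\<close>.\<close>
  define E where "E = n * n * (theta_deg n * e + 1)"
  have "\<exists>W. poly_fun n W \<and> (\<forall>x. ker_on n x = R \<longrightarrow> v x ^ E = omega n R x ^ (m R * e + 1) * W x)"
    if R: "R \<in> strata n s" for R
  proof -
    obtain W where W: "poly_fun n W" "\<And>x. ker_on n x = R \<Longrightarrow> v x ^ card (off n R) = omega n R x * W x"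
      using poly_fun_stratum_factor[OF v R v0] by blast
    have "m R \<le> theta_deg n" by (simp add: m_def)
    then have "card (off n R) * (m R * e + 1) \<le> E"
      unfolding E_def by (intro mult_le_mono card_off_le add_le_mono) auto
    then have "v x ^ E = (v x ^ card (off n R)) ^ (m R * e + 1) * v x ^ (E - card (off n R) * (m R * e + 1))" for x
      by (simp add: power_mult[symmetric] power_add[symmetric])
    then have "v x ^ E = omega n R x ^ (m R * e + 1) * (W x ^ (m R * e + 1) * v x ^ (E - card (off n R) * (m R * e + 1)))"
      if "ker_on n x = R" for x
      using W(2)[OF that] by (simp add: power_mult_distrib mult.assoc)
    then show ?thesis
      by (intro exI[of _ "\<lambda>x. W x ^ (m R * e + 1) * v x ^ (E - card (off n R) * (m R * e + 1))"])
         (use W(1) v in \<open>auto intro!: poly_fun_mult poly_fun_power\<close>)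
  qed
  then obtain W where W: "\<And>R. R \<in> strata n s \<Longrightarrow> poly_fun n (W R)"
    "\<And>R x. R \<in> strata n s \<Longrightarrow> ker_on n x = R \<Longrightarrow> v x ^ E = omega n R x ^ (m R * e + 1) * W R x"
    by metis
  \<comment> \<open>The spare factor \<open>omega n R x\<close>, from the \<open>+ 1\<close> in the
    exponent, kills the summand of \<open>R\<close> on every other stratum with \<open>s\<close>
    classes, so the local cofactors glue to one polynomial.\<close>
  define U where "U x = (\<Sum>R\<in>strata n s. omega n R x * W R x)" for x
  have "poly_fun n U" unfolding U_def[abs_def]
    by (intro poly_fun_sum poly_fun_mult poly_fun_omega W)
  moreover have "v x ^ E = theta n s x ^ e * U x" if le: "card (x ` {..<n}) \<le> s" for x
  proof (cases "card (x ` {..<n}) = s")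
    case True
    define R where "R = ker_on n x"
    have R: "R \<in> strata n s" using ker_on_in_strata[of n x] True by (simp add: R_def)
    have "U x = (\<Sum>R\<in>{R}. omega n R x * W R x)" unfolding U_def
    proof (rule sum.mono_neutral_right[OF finite_strata])
      show "\<forall>S\<in>strata n s - {R}. omega n S x * W S x = 0"
        using strata_omega_nonzero[of _ n s x] le by (auto simp: R_def)
    qed (use R in auto)
    moreover have "theta n s x = omega n R x ^ m R"
      using theta_eq[OF s True] by (simp add: R_def m_def)
    ultimately show ?thesis using W(2)[OF R, of x]
      by (simp add: R_def power_mult[symmetric] power_add algebra_simps)
  next
    case False
    then have "card (x ` {..<n}) < s" using le by simp
    then have "v x = 0" "theta n s x = 0" using v0 theta_eq_0[OF s] by auto
    moreover have "E > 0" using n by (simp add: E_def)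
    ultimately show ?thesis using e by (simp add: power_0_left)
  qed
  ultimately show ?thesis by blast
qed

text \<open>Induction from \<open>s = r\<close> downwards: subtracting a multiple of a power of
  \<open>theta n (Suc s)\<close> from a power of \<open>v\<close> makes it vanish on the points with
  at most \<open>Suc s\<close> values as well.\<close>

lemma strata_radical:
  assumes e: "\<And>j. e j > 0" and n: "n > 0"
    and "1 \<le> s" "s \<le> r" "poly_fun n v" "\<And>x. card (x ` {..<n}) \<le> s \<Longrightarrow> v x = 0"
  shows "\<exists>N c. (\<forall>j. poly_fun n (c j)) \<and>
    (\<forall>x. card (x ` {..<n}) \<le> r \<longrightarrow> v x ^ N = (\<Sum>j\<in>{s<..r}. theta n j x ^ e j * c j x))"
  using assms(4,3,5-)
proof (induction s arbitrary: v rule: inc_induct)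
  case base
  then show ?case by (intro exI[of _ 1] exI[of _ "\<lambda>_ _. 0"]) (auto intro: poly_fun_const)
next
  case (step s)
  obtain E U where U: "poly_fun n U"
    "\<And>x. card (x ` {..<n}) \<le> Suc s \<Longrightarrow> v x ^ E = theta n (Suc s) x ^ e (Suc s) * U x"
    using theta_divides_power[OF step.prems(2) n, of "Suc s" "e (Suc s)"] e step.prems by auto
  obtain N c where c: "\<And>j. poly_fun n (c j)"
    "\<And>x. card (x ` {..<n}) \<le> r \<Longrightarrow>
      (v x ^ E - theta n (Suc s) x ^ e (Suc s) * U x) ^ N = (\<Sum>j\<in>{Suc s<..r}. theta n j x ^ e j * c j x)"
  proof -
    have "poly_fun n (\<lambda>x. v x ^ E - theta n (Suc s) x ^ e (Suc s) * U x)"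
      by (intro poly_fun_diff poly_fun_mult poly_fun_power poly_fun_theta step.prems(2) U(1))
    from step.IH[OF _ this] U(2) show ?thesis using that by force
  qed
  obtain c' where c': "\<And>j. poly_fun n (c' j)"
    "\<And>x. card (x ` {..<n}) \<le> r \<Longrightarrow> v x ^ (E * N) = (\<Sum>j\<in>insert (Suc s) {Suc s<..r}. theta n j x ^ e j * c' j x)"
    using radical_step[of n v "\<lambda>x. theta n (Suc s) x ^ e (Suc s)" U "{Suc s<..r}" "Suc s" c
        "{x. card (x ` {..<n}) \<le> r}" E N "\<lambda>j x. theta n j x ^ e j"] c U(1) step.prems(2)
    by (auto intro!: poly_fun_power poly_fun_theta)
  have "insert (Suc s) {Suc s<..r} = {s<..r}" using step.hyps by auto
  then show ?case using c' by metis
qed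

text \<open>An effective Nullstellensatz: on the points with at most \<open>r\<close> values the
  parameters have only the origin as common zero. The points with a single value are treated by
  hand, the rest by \<open>strata_radical\<close>.\<close>

lemma theta_radical:
  assumes e: "\<And>j. e j > 0" and n: "n > 0" and r: "r \<ge> 1"
    and v: "poly_fun n v" "v (\<lambda>_. 0) = 0"
  shows "\<exists>N c. (\<forall>j. poly_fun n (c j)) \<and>
    (\<forall>x. card (x ` {..<n}) \<le> r \<longrightarrow> v x ^ N = (\<Sum>j\<in>{1..r}. theta n j x ^ e j * c j x))"
proof -
  obtain P where P: "\<And>t. v (\<lambda>k. poly [:0, 1:] t) = poly P t"
    using poly_fun_comp_poly[OF v(1), of "\<lambda>_. [:0, 1:]"] by blast
  have "poly P 0 = 0" using P[of 0] v(2) by simp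
  then obtain Q where Q: "P = pCons 0 Q" by (cases P) auto
  \<comment> \<open>On the diagonal \<open>theta n 1\<close> is the power \<open>theta_deg n\<close>
    of \<open>n * x 0\<close>, while \<open>v\<close> is divisible by \<open>x 0\<close>; this
    exponent makes the two match.\<close>
  define E where "E = theta_deg n * e 1"
  define U where "U x = poly Q (x 0) ^ E / of_nat n ^ E" for x :: "nat \<Rightarrow> complex"
  have "poly_fun n (\<lambda>x. poly Q (x 0))"
    unfolding poly_altdef by (intro poly_fun_sum poly_fun_mult poly_fun_const poly_fun_power poly_fun_coord n)
  then have U: "poly_fun n U" unfolding U_def divide_inverse
    by (intro poly_fun_mult poly_fun_power poly_fun_const)
  have one: "v x ^ E = theta n 1 x ^ e 1 * U x" if x: "card (x ` {..<n}) \<le> 1" for x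
  proof -
    have "\<forall>a\<in>x ` {..<n}. \<forall>b\<in>x ` {..<n}. a = b"
      by (subst card_le_Suc0_iff_eq[symmetric]) (use x in simp_all)
    then have x0: "x k = x 0" if "k < n" for k using that n by blast
    have "v x = v (\<lambda>k. x 0)" by (intro poly_fun_cong[OF v(1)] x0)
    then have "v x = x 0 * poly Q (x 0)" using P[of "x 0"] Q by simp
    moreover have "(\<Sum>k<n. x k) = of_nat n * x 0"
    proof -
      have "(\<Sum>k<n. x k) = (\<Sum>k<n. x 0)" by (intro sum.cong refl x0) auto
      then show ?thesis by simp
    qed
    ultimately show ?thesis using n
      by (simp add: theta_def U_def E_def power_mult[symmetric] power_mult_distrib)
  qed
  have "\<exists>N c. (\<forall>j. poly_fun n (c j)) \<and> (\<forall>x. card (x ` {..<n}) \<le> r \<longrightarrow>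
      (v x ^ E - theta n 1 x ^ e 1 * U x) ^ N = (\<Sum>j\<in>{1<..r}. theta n j x ^ e j * c j x))"
    by (rule strata_radical[OF e n _ r])
       (auto simp: one intro!: poly_fun_diff poly_fun_mult poly_fun_power poly_fun_theta v(1) U)
  then obtain N c where c: "\<And>j. poly_fun n (c j)"
    "\<And>x. card (x ` {..<n}) \<le> r \<Longrightarrow>
      (v x ^ E - theta n 1 x ^ e 1 * U x) ^ N = (\<Sum>j\<in>{1<..r}. theta n j x ^ e j * c j x)" by blast
  obtain c' where c': "\<And>j. poly_fun n (c' j)"
    "\<And>x. card (x ` {..<n}) \<le> r \<Longrightarrow> v x ^ (E * N) = (\<Sum>j\<in>insert 1 {1<..r}. theta n j x ^ e j * c' j x)"
    using radical_step[of n v "\<lambda>x. theta n 1 x ^ e 1" U "{1<..r}" 1 c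
        "{x. card (x ` {..<n}) \<le> r}" E N "\<lambda>j x. theta n j x ^ e j"] c U v(1)
    by (auto intro!: poly_fun_power poly_fun_theta)
  have "insert 1 {1<..r} = {1..r}" using r by auto
  then show ?thesis using c' by metis
qed

section \<open>Symmetrisation over blocks of coordinates\<close>

lemma fibres_eq_permutes:
  fixes f g :: "nat \<Rightarrow> 'b"
  assumes "\<And>y. card {k. k < n \<and> f k = y} = card {k. k < n \<and> g k = y}"
  obtains \<rho> where "\<rho> permutes {..<n}" "\<And>k. k < n \<Longrightarrow> f k = g (\<rho> k)"
proof -
  have "count (image_mset h (mset_set {..<n})) y = card {k. k < n \<and> h k = y}" for h :: "nat \<Rightarrow> 'b" and y
  proof -
    have "h -` {y} \<inter> {..<n} = {k. k < n \<and> h k = y}" by auto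
    then show ?thesis by (simp add: count_image_mset)
  qed
  then have "image_mset f (mset_set {..<n}) = image_mset g (mset_set {..<n})"
    using assms by (intro multiset_eqI) simp
  from image_mset_eq_implies_permutes[OF _ this] obtain \<rho>
    where "\<rho> permutes {..<n}" "\<forall>k\<in>{..<n}. f k = g (\<rho> k)" by auto
  then show ?thesis using that by auto
qed

lemma prod_pairs_permute:
  fixes x :: "nat \<Rightarrow> complex"
  assumes "finite S" "\<rho> permutes {..<n}" "\<And>k l. (k, l) \<in> S \<Longrightarrow> (\<rho> k, \<rho> l) \<in> S"
  shows "(\<Prod>(k, l)\<in>S. (x \<circ> \<rho>) k - (x \<circ> \<rho>) l) = (\<Prod>(k, l)\<in>S. x k - x l)"
proof -
  have inj: "inj_on (map_prod \<rho> \<rho>) S"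
    using prod.inj_map[OF permutes_inj[OF assms(2)] permutes_inj[OF assms(2)]] inj_on_subset by blast
  have "map_prod \<rho> \<rho> ` S \<subseteq> S" using assms(3) by auto
  then have "map_prod \<rho> \<rho> ` S = S" using endo_inj_surj[OF assms(1) _ inj] by blast
  then have "(\<Prod>(k, l)\<in>S. x k - x l) = (\<Prod>(k, l)\<in>map_prod \<rho> \<rho> ` S. x k - x l)" by simp
  then show ?thesis by (simp add: prod.reindex[OF inj] split_def)
qed

lemma sum_permute_subset:
  assumes "finite A" "\<rho> permutes S" "\<And>k. k \<in> A \<Longrightarrow> \<rho> k \<in> A"
  shows "(\<Sum>k\<in>A. g (\<rho> k)) = (\<Sum>k\<in>A. g k)"
proof -
  have inj: "inj_on \<rho> A" using permutes_inj_on[OF assms(2)] .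
  have "\<rho> ` A \<subseteq> A" using assms(3) by auto
  then have "\<rho> ` A = A" using endo_inj_surj[OF assms(1) _ inj] by blast
  then show ?thesis using sum.reindex[OF inj, of g] by simp
qed

lemma pair_eq_of_sum_and_squares:
  fixes a b c d :: nat
  assumes "a + b = c + d" "a\<^sup>2 + b\<^sup>2 = c\<^sup>2 + d\<^sup>2"
  shows "a = c \<and> b = d \<or> a = d \<and> b = c"
proof -
  have 1: "int a + int b = int c + int d" using assms(1) by linarith
  have 2: "(int a)\<^sup>2 + (int b)\<^sup>2 = (int c)\<^sup>2 + (int d)\<^sup>2"
    using assms(2) by (metis of_nat_add of_nat_power)
  have b: "int b = int c + int d - int a" using 1 by simp
  have "2 * ((int a - int c) * (int a - int d)) = 0"
    using 2 unfolding b by (simp add: power2_eq_square algebra_simps)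
  then show ?thesis using assms(1) by auto
qed

locale blocks =
  fixes n r :: nat and \<beta> L :: "nat \<Rightarrow> nat"
  assumes \<beta>_less: "k < n \<Longrightarrow> \<beta> k < r"
    and card_fibre: "i < r \<Longrightarrow> card {k. k < n \<and> \<beta> k = i} = L i"
    and L_pos: "i < r \<Longrightarrow> L i > 0"
begin

text \<open>The coordinates from \<open>n\<close> on are \<open>0\<close>, in agreement with
  \<open>cspace\<close>.\<close>

definition pt :: "(nat \<Rightarrow> complex) \<Rightarrow> nat \<Rightarrow> complex" where
  "pt z = (\<lambda>k. if k < n then z (\<beta> k) else 0)"

text \<open>The group through which the symmetric group acts on the parameters: parameters related
  by it give points of one orbit, so invariants pull back to functions fixed by it.\<close>

definition wperms :: "(nat \<Rightarrow> nat) set" where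
  "wperms = {w. w permutes {..<r} \<and> (\<forall>i<r. L (w i) = L i)}"

abbreviation K :: "(nat \<times> nat) set" where "K \<equiv> ker_on n \<beta>"

lemma fibre_ex: "i < r \<Longrightarrow> \<exists>k<n. \<beta> k = i"
proof -
  assume "i < r"
  then have "card {k. k < n \<and> \<beta> k = i} > 0" using card_fibre L_pos by simp
  then have "{k. k < n \<and> \<beta> k = i} \<noteq> {}" by fastforce
  then show ?thesis by blast
qed

lemma image_\<beta>: "\<beta> ` {..<n} = {..<r}"
proof
  show "{..<r} \<subseteq> \<beta> ` {..<n}" using fibre_ex by blast
qed (use \<beta>_less in auto)

lemma sum_fibres:
  fixes h :: "nat \<Rightarrow> 'b::semiring_1"
  assumes "A \<subseteq> {..<r}"
  shows "(\<Sum>k | k < n \<and> \<beta> k \<in> A. h (\<beta> k)) = (\<Sum>i\<in>A. of_nat (L i) * h i)"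
proof -
  have fin: "finite A" using assms finite_subset by blast
  have "(\<Sum>k | k < n \<and> \<beta> k \<in> A. h (\<beta> k)) = (\<Sum>i\<in>A. \<Sum>k | k \<in> {k. k < n \<and> \<beta> k \<in> A} \<and> \<beta> k = i. h (\<beta> k))"
    by (rule sum.group[symmetric]) (use fin in auto)
  also have "\<dots> = (\<Sum>i\<in>A. of_nat (L i) * h i)"
  proof (rule sum.cong[OF refl])
    fix i assume i: "i \<in> A"
    have "{k. k \<in> {k. k < n \<and> \<beta> k \<in> A} \<and> \<beta> k = i} = {k. k < n \<and> \<beta> k = i}" using i by auto
    then show "(\<Sum>k | k \<in> {k. k < n \<and> \<beta> k \<in> A} \<and> \<beta> k = i. h (\<beta> k)) = of_nat (L i) * h i"
      using card_fibre[of i] i assms by auto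
  qed
  finally show ?thesis .
qed

lemma sum_pt: "(\<Sum>k<n. h (pt z k)) = (\<Sum>i<r. of_nat (L i) * h (z i))"
proof -
  have "{k. k < n \<and> \<beta> k \<in> {..<r}} = {..<n}" using \<beta>_less by auto
  then have "(\<Sum>k<n. h (z (\<beta> k))) = (\<Sum>i<r. of_nat (L i) * h (z i))"
    using sum_fibres[of "{..<r}" "\<lambda>i. h (z i)"] by simp
  then show ?thesis by (simp add: pt_def)
qed

lemma wperms_id: "id \<in> wperms" by (simp add: wperms_def permutes_id)

lemma wperms_permutes: "w \<in> wperms \<Longrightarrow> w permutes {..<r}" by (simp add: wperms_def)

lemma wperms_less: "w \<in> wperms \<Longrightarrow> w i < r \<longleftrightarrow> i < r"
  using permutes_in_image[OF wperms_permutes, of w i] by simp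

lemma wperms_L: "w \<in> wperms \<Longrightarrow> i < r \<Longrightarrow> L (w i) = L i" by (simp add: wperms_def)

lemma wperms_comp: "w \<in> wperms \<Longrightarrow> w' \<in> wperms \<Longrightarrow> w \<circ> w' \<in> wperms"
  using wperms_less[of w'] by (auto simp: wperms_def intro: permutes_compose)

lemma wperms_inv:
  assumes "w \<in> wperms"
  shows "inv_into UNIV w \<in> wperms"
proof -
  have p: "inv_into UNIV w permutes {..<r}" using permutes_inv[OF wperms_permutes[OF assms]] .
  moreover have "L (inv_into UNIV w i) = L i" if "i < r" for i
  proof -
    have "inv_into UNIV w i < r" using permutes_in_image[OF p, of i] that by simp
    from wperms_L[OF assms this] show ?thesis
      using permutes_inverses(1)[OF wperms_permutes[OF assms], of i] by simp
  qed
  ultimately show ?thesis by (simp add: wperms_def)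
qed

lemma finite_wperms: "finite wperms"
  by (rule finite_subset[of _ "{w. w permutes {..<r}}"]) (auto simp: wperms_def intro: finite_permutations)

lemma sum_wperms_comp:
  assumes "w' \<in> wperms"
  shows "(\<Sum>w\<in>wperms. f (w \<circ> w')) = (\<Sum>w\<in>wperms. f w)"
proof (rule sum.reindex_bij_witness[of _ "\<lambda>w. w \<circ> inv_into UNIV w'" "\<lambda>w. w \<circ> w'"])
  have "inv_into UNIV w' \<circ> w' = id" "w' \<circ> inv_into UNIV w' = id"
    using permutes_inv_o[OF wperms_permutes[OF assms]] by auto
  then show "w \<circ> w' \<circ> inv_into UNIV w' = w" "w \<circ> inv_into UNIV w' \<circ> w' = w" for w
    by (simp_all add: o_assoc[symmetric])
qed (use assms wperms_comp wperms_inv in auto)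

lemma wperms_lift:
  assumes "w \<in> wperms"
  obtains \<sigma> where "\<sigma> permutes {..<n}" "\<And>k. k < n \<Longrightarrow> w (\<beta> k) = \<beta> (\<sigma> k)"
proof -
  have p: "w permutes {..<r}" using wperms_permutes[OF assms] .
  have "card {k. k < n \<and> w (\<beta> k) = y} = card {k. k < n \<and> \<beta> k = y}" for y
  proof (cases "y < r")
    case True
    define x where "x = inv_into UNIV w y"
    have x: "w x = y" using permutes_inverses(1)[OF p, of y] by (simp add: x_def)
    then have xr: "x < r" using wperms_less[OF assms, of x] True by simp
    have "{k. k < n \<and> w (\<beta> k) = y} = {k. k < n \<and> \<beta> k = x}"
      using permutes_inj[OF p] x by (auto dest: injD)
    then show ?thesis using card_fibre[OF xr] card_fibre[OF True] wperms_L[OF assms xr] x by simp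
  next
    case False
    then have "{k. k < n \<and> w (\<beta> k) = y} = {}" "{k. k < n \<and> \<beta> k = y} = {}"
      using \<beta>_less wperms_less[OF assms] by auto
    then show ?thesis by (simp only:)
  qed
  then show ?thesis using fibres_eq_permutes[of n "\<lambda>k. w (\<beta> k)" \<beta>] that by blast
qed

lemma pt_comp_wperm:
  assumes "\<sigma> permutes {..<n}" "\<And>k. k < n \<Longrightarrow> w (\<beta> k) = \<beta> (\<sigma> k)"
  shows "pt (z \<circ> w) = pt z \<circ> \<sigma>"
proof
  fix k
  show "pt (z \<circ> w) k = (pt z \<circ> \<sigma>) k"
    using assms permutes_in_image[OF assms(1), of k] by (auto simp: pt_def)
qed

lemma sym_fun_pt_wperm:
  assumes "sym_fun n G" "w \<in> wperms"
  shows "G (pt (z \<circ> w)) = G (pt z)"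
proof -
  obtain \<sigma> where s: "\<sigma> permutes {..<n}" "\<And>k. k < n \<Longrightarrow> w (\<beta> k) = \<beta> (\<sigma> k)"
    using wperms_lift[OF assms(2)] by blast
  then show ?thesis using pt_comp_wperm[of \<sigma> w z] assms(1) by (simp add: sym_fun_def)
qed

lemma fibre_perm:
  assumes "\<And>k. k < n \<Longrightarrow> f k < r" "\<And>i. i < r \<Longrightarrow> card {k. k < n \<and> f k = i} = L i"
    and "ker_on n f \<subseteq> K"
  obtains w where "w \<in> wperms" "\<And>k. k < n \<Longrightarrow> f k = w (\<beta> k)"
proof -
  have surj: "f ` {..<n} = {..<r}"
  proof
    show "{..<r} \<subseteq> f ` {..<n}"
    proof
      fix i assume "i \<in> {..<r}"
      then have "card {k. k < n \<and> f k = i} > 0" using assms(2) L_pos by simp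
      then have "{k. k < n \<and> f k = i} \<noteq> {}" by fastforce
      then show "i \<in> f ` {..<n}" by auto
    qed
  qed (use assms(1) in auto)
  then have eq: "ker_on n f = K" by (intro ker_on_eqI assms(3)) (simp add: image_\<beta>)
  obtain h where h: "\<And>k. k < n \<Longrightarrow> h (\<beta> k) = f k"
    using ker_on_factor[of n \<beta> f] eq by blast
  define w where "w i = (if i < r then h i else i)" for i
  have wf: "w (\<beta> k) = f k" if "k < n" for k using that h \<beta>_less by (simp add: w_def)
  have p: "w permutes {..<r}"
  proof (rule inj_imp_permutes)
    have "w ` {..<r} = (\<lambda>k. w (\<beta> k)) ` {..<n}" by (simp add: image_\<beta>[symmetric] image_image)
    also have "\<dots> = f ` {..<n}" using wf by (intro image_cong) auto
    finally have "w ` {..<r} = {..<r}" using surj by simp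
    then show "inj_on w {..<r}" by (intro eq_card_imp_inj_on) auto
    show "w i \<in> {..<r}" if "i \<in> {..<r}" for i using \<open>w ` {..<r} = {..<r}\<close> that by blast
  qed (auto simp: w_def)
  have "L (w i) = L i" if i: "i < r" for i
  proof -
    have wi: "w i < r" using permutes_in_image[OF p, of i] i by simp
    have "f k = w i \<longleftrightarrow> \<beta> k = i" if "k < n" for k
      unfolding wf[OF that, symmetric] by (rule inj_eq[OF permutes_inj[OF p]])
    then have "{k. k < n \<and> f k = w i} = {k. k < n \<and> \<beta> k = i}" by blast
    then show ?thesis using assms(2)[OF wi] card_fibre[OF i] by simp
  qed
  then have "w \<in> wperms" using p by (simp add: wperms_def)
  then show ?thesis using that wf by metis
qed

lemma card_fibre_permute:
  assumes "\<sigma> permutes {..<n}"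
  shows "card {k. k < n \<and> P (\<sigma> k)} = card {k. k < n \<and> P k}"
proof -
  have "\<sigma> ` {k. k < n \<and> P (\<sigma> k)} = {k. k < n \<and> P k}"
  proof
    show "{k. k < n \<and> P k} \<subseteq> \<sigma> ` {k. k < n \<and> P (\<sigma> k)}"
    proof
      fix k assume k: "k \<in> {k. k < n \<and> P k}"
      obtain l where l: "l \<in> {..<n}" "k = \<sigma> l" using permutes_image[OF assms] k by blast
      have "l \<in> {k. k < n \<and> P (\<sigma> k)}" using k l by simp
      then show "k \<in> \<sigma> ` {k. k < n \<and> P (\<sigma> k)}" using l(2) by blast
    qed
  qed (use permutes_in_image[OF assms] in auto)
  moreover have "inj_on \<sigma> {k. k < n \<and> P (\<sigma> k)}" using permutes_inj_on[OF assms] .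
  ultimately show ?thesis using card_image by metis
qed

section \<open>Lifting functions of the block values to symmetric polynomials\<close>

definition lifts :: "((nat \<Rightarrow> complex) \<Rightarrow> complex) \<Rightarrow> bool" where
  "lifts F \<longleftrightarrow> (\<exists>G. poly_fun n G \<and> sym_fun n G \<and> (\<forall>z. G (pt z) = F z))"

lemma lifts_sum:
  assumes "\<And>a. a \<in> A \<Longrightarrow> lifts (F a)"
  shows "lifts (\<lambda>z. \<Sum>a\<in>A. F a z)"
proof -
  obtain G where G: "\<And>a. a \<in> A \<Longrightarrow> poly_fun n (G a) \<and> sym_fun n (G a) \<and> (\<forall>z. G a (pt z) = F a z)"
    using assms unfolding lifts_def by metis
  show ?thesis unfolding lifts_def
    by (rule exI[of _ "\<lambda>x. \<Sum>a\<in>A. G a x"]) (use G in \<open>auto simp: sym_fun_def intro!: poly_fun_sum\<close>)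
qed

text \<open>No orbit has to be counted: after summing over \<open>wperms\<close>, every permutation of the
  coordinates contributes either zero or the full sum on the right.\<close>
lemma lifts_sum_wperms:
  assumes \<Gamma>: "poly_fun n \<Gamma>"
    and alt: "\<And>\<sigma>. \<sigma> permutes {..<n} \<Longrightarrow>
      (\<forall>z. \<Gamma> (pt z \<circ> \<sigma>) = 0) \<or> (\<exists>w\<in>wperms. \<forall>z. \<Gamma> (pt z \<circ> \<sigma>) = \<Gamma> (pt (z \<circ> w)))"
  shows "lifts (\<lambda>z. \<Sum>w\<in>wperms. \<Gamma> (pt (z \<circ> w)))"
proof (cases "\<forall>z. \<Gamma> (pt z) = 0")
  case True
  then show ?thesis unfolding lifts_def
    by (intro exI[of _ "\<lambda>_. 0"]) (auto simp: sym_fun_def intro: poly_fun_const)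
next
  case False
  define S where "S z = (\<Sum>w\<in>wperms. \<Gamma> (pt (z \<circ> w)))" for z
  define G where "G x = (\<Sum>\<sigma> | \<sigma> permutes {..<n}. \<Gamma> (x \<circ> \<sigma>))" for x
  define N where "N = {\<sigma>. \<sigma> permutes {..<n} \<and> \<not> (\<forall>z. \<Gamma> (pt z \<circ> \<sigma>) = 0)}"
  have finN: "finite N" unfolding N_def
    by (rule finite_subset[of _ "{\<sigma>. \<sigma> permutes {..<n}}"]) (auto intro: finite_permutations)
  have "id \<in> N" using False by (simp add: N_def permutes_id)
  then have N0: "card N \<noteq> 0" using finN by auto
  have "card wperms \<noteq> 0" using wperms_id finite_wperms by auto
  have pG: "poly_fun n G" and sG: "sym_fun n G"
    unfolding G_def[abs_def] by (rule poly_fun_sum_permutes[OF \<Gamma>], rule sym_fun_sum_permutes)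
  have "of_nat (card wperms) * G (pt z) = of_nat (card N) * S z" for z
  proof -
    have "of_nat (card wperms) * G (pt z) = (\<Sum>w\<in>wperms. G (pt (z \<circ> w)))"
      using sym_fun_pt_wperm[OF sG] by simp
    also have "\<dots> = (\<Sum>\<sigma> | \<sigma> permutes {..<n}. \<Sum>w\<in>wperms. \<Gamma> (pt (z \<circ> w) \<circ> \<sigma>))"
      unfolding G_def by (rule sum.swap)
    also have "\<dots> = (\<Sum>\<sigma> | \<sigma> permutes {..<n}. if \<sigma> \<in> N then S z else 0)"
    proof (rule sum.cong[OF refl])
      fix \<sigma> assume s: "\<sigma> \<in> {\<sigma>. \<sigma> permutes {..<n}}"
      show "(\<Sum>w\<in>wperms. \<Gamma> (pt (z \<circ> w) \<circ> \<sigma>)) = (if \<sigma> \<in> N then S z else 0)"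
      proof (cases "\<sigma> \<in> N")
        case True
        then obtain w' where w': "w' \<in> wperms" "\<And>z. \<Gamma> (pt z \<circ> \<sigma>) = \<Gamma> (pt (z \<circ> w'))"
          using alt[of \<sigma>] s unfolding N_def by blast
        have "(\<Sum>w\<in>wperms. \<Gamma> (pt (z \<circ> w) \<circ> \<sigma>)) = (\<Sum>w\<in>wperms. \<Gamma> (pt (z \<circ> (w \<circ> w'))))"
          by (simp add: w'(2) o_assoc)
        also have "\<dots> = S z" unfolding S_def by (rule sum_wperms_comp[OF w'(1)])
        finally show ?thesis using True by simp
      next
        case False
        then have "\<Gamma> (pt z' \<circ> \<sigma>) = 0" for z' using s unfolding N_def by blast
        then show ?thesis using False by simp
      qed
    qed
    also have "\<dots> = (\<Sum>\<sigma>\<in>N. S z)"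
    proof -
      have "{\<sigma>. \<sigma> permutes {..<n}} \<inter> N = N" by (auto simp: N_def)
      then show ?thesis by (simp add: sum.If_cases finite_permutations)
    qed
    finally show ?thesis by simp
  qed
  then have "(of_nat (card wperms) / of_nat (card N)) * G (pt z) = S z" for z
    using N0 by (simp add: field_simps)
  moreover have "poly_fun n (\<lambda>x. (of_nat (card wperms) / of_nat (card N)) * G x)"
    by (intro poly_fun_mult poly_fun_const pG)
  moreover have "sym_fun n (\<lambda>x. (of_nat (card wperms) / of_nat (card N)) * G x)"
    using sG by (simp add: sym_fun_def)
  ultimately have "lifts S" unfolding lifts_def by blast
  then show ?thesis by (simp add: S_def[abs_def])
qed

lemma poly_fun_pt: "poly_fun n G \<Longrightarrow> poly_fun r (\<lambda>z. G (pt z))"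
proof -
  assume G: "poly_fun n G"
  have "poly_fun r (\<lambda>z. G (\<lambda>k. z (\<beta> k)))"
    by (rule poly_fun_subst[OF G]) (auto intro: poly_fun_coord \<beta>_less)
  moreover have "G (\<lambda>k. z (\<beta> k)) = G (pt z)" for z
    by (rule poly_fun_cong[OF G]) (simp add: pt_def)
  ultimately show ?thesis by simp
qed

lemma ker_on_pt: "K \<subseteq> ker_on n (pt z)" by (auto simp: ker_on_def pt_def)

text \<open>The permuted point has at least the coincidences of
  \<open>\<beta> \<circ> \<sigma>\<close>, and one of them makes a factor vanish. This is how the
  unwanted permutations are made to contribute zero.\<close>

lemma ker_on_perm_not_subset:
  assumes "\<sigma> permutes {..<n}" "\<not> ker_on n (\<beta> \<circ> \<sigma>) \<subseteq> ker_on n f"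
  shows "omega n (ker_on n f) (pt z \<circ> \<sigma>) = 0"
proof -
  have lt: "\<sigma> k < n" if "k < n" for k using permutes_in_image[OF assms(1), of k] that by simp
  have "ker_on n (\<beta> \<circ> \<sigma>) \<subseteq> ker_on n (pt z \<circ> \<sigma>)"
  proof (rule subrelI)
    fix k l assume "(k, l) \<in> ker_on n (\<beta> \<circ> \<sigma>)"
    then have "k < n" "l < n" "\<beta> (\<sigma> k) = \<beta> (\<sigma> l)" by (auto simp: ker_on_def)
    then show "(k, l) \<in> ker_on n (pt z \<circ> \<sigma>)" by (simp add: ker_on_def pt_def lt)
  qed
  from subset_trans[OF this] assms(2) show ?thesis
    by (auto simp only: omega_ker_on_eq_0_iff)
qed

text \<open>The factor \<open>omega n K\<close> acts as a conductor element: it vanishes at every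
  permuted point except those obtained by a size-preserving permutation of blocks, so an arbitrary
  polynomial in the block values may follow it.\<close>

lemma lifts_omega_full:
  assumes \<Psi>: "poly_fun r \<Psi>"
  shows "lifts (\<lambda>z. \<Sum>w\<in>wperms. omega n K (pt (z \<circ> w)) * \<Psi> (z \<circ> w))"
proof -
  obtain k where k: "\<And>i. i < r \<Longrightarrow> k i < n" "\<And>i. i < r \<Longrightarrow> \<beta> (k i) = i"
    using fibre_ex by metis
  define \<Gamma> where "\<Gamma> x = omega n K x * \<Psi> (\<lambda>i. x (k i))" for x
  have "poly_fun n (\<lambda>x. \<Psi> (\<lambda>i. x (k i)))"
    by (rule poly_fun_subst[OF \<Psi>]) (auto intro: poly_fun_coord k)
  then have p: "poly_fun n \<Gamma>" unfolding \<Gamma>_def[abs_def] by (intro poly_fun_mult poly_fun_omega)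
  have pt: "\<Gamma> (pt z) = omega n K (pt z) * \<Psi> z" for z
  proof -
    have "\<Psi> (\<lambda>i. pt z (k i)) = \<Psi> z" by (rule poly_fun_cong[OF \<Psi>]) (simp add: pt_def k)
    then show ?thesis by (simp add: \<Gamma>_def)
  qed
  have "lifts (\<lambda>z. \<Sum>w\<in>wperms. \<Gamma> (pt (z \<circ> w)))"
  proof (rule lifts_sum_wperms[OF p])
    fix \<sigma> assume s: "\<sigma> permutes {..<n}"
    show "(\<forall>z. \<Gamma> (pt z \<circ> \<sigma>) = 0) \<or> (\<exists>w\<in>wperms. \<forall>z. \<Gamma> (pt z \<circ> \<sigma>) = \<Gamma> (pt (z \<circ> w)))"
    proof (cases "ker_on n (\<beta> \<circ> \<sigma>) \<subseteq> K")
      case True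
      have 1: "(\<beta> \<circ> \<sigma>) k < r" if "k < n" for k
        using permutes_in_image[OF s, of k] that \<beta>_less by simp
      have 2: "card {k. k < n \<and> (\<beta> \<circ> \<sigma>) k = i} = L i" if "i < r" for i
        using card_fibre_permute[OF s, of "\<lambda>k. \<beta> k = i"] card_fibre[OF that] by simp
      obtain w where w: "w \<in> wperms" "\<And>k. k < n \<Longrightarrow> (\<beta> \<circ> \<sigma>) k = w (\<beta> k)"
        using fibre_perm[OF 1 2 True] by blast
      have "pt z \<circ> \<sigma> = pt (z \<circ> w)" for z
        using pt_comp_wperm[OF s, of w z] w(2) by simp
      then show ?thesis using w(1) by auto
    next
      case False
      then show ?thesis using ker_on_perm_not_subset[OF s False] by (simp add: \<Gamma>_def)
    qed
  qed
  then show ?thesis by (simp add: pt)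
qed

text \<open>By \<open>sep\<close> no single block has size \<open>L i + L j\<close>, so the fibre
  over \<open>i\<close> has at least two elements. The fibre over \<open>j\<close> is empty and all
  others are nonempty, so counting the \<open>r\<close> blocks leaves two over \<open>i\<close> and
  one elsewhere. Comparing the sums of \<open>L\<close> and of its squares identifies the two sizes
  as \<open>L i\<close> and \<open>L j\<close>.\<close>

lemma merge_perm:
  assumes ij: "i < r" "j < r" "i \<noteq> j" and sep: "\<And>b. b < r \<Longrightarrow> L b \<noteq> L i + L j"
    and \<eta>: "\<And>b. b < r \<Longrightarrow> \<eta> b < r"
    and sums: "\<And>m. m < r \<Longrightarrow>
      (\<Sum>b | b < r \<and> \<eta> b = m. L b) = (if m = i then L i + L j else if m = j then 0 else L m)"
  obtains v where "v \<in> wperms" "\<And>b. b < r \<Longrightarrow> (if v b = j then i else v b) = \<eta> b"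
proof -
  define F where "F m = {b. b < r \<and> \<eta> b = m}" for m
  define M where "M = {..<r} - {i, j}"
  have fin: "finite (F m)" for m by (simp add: F_def)
  have split: "(\<Sum>m<r. h m) = h i + h j + (\<Sum>m\<in>M. h m)" for h :: "nat \<Rightarrow> nat"
  proof -
    have "{..<r} = insert i (insert j M)" "i \<notin> M" "j \<notin> M" "finite M"
      using ij by (auto simp: M_def)
    then show ?thesis using ij(3) by simp
  qed
  have total: "(\<Sum>m<r. \<Sum>b\<in>F m. h b) = (\<Sum>b<r. h b)" for h :: "nat \<Rightarrow> nat"
  proof -
    have "(\<Sum>m<r. \<Sum>b | b \<in> {..<r} \<and> \<eta> b = m. h b) = (\<Sum>b<r. h b)"
      by (rule sum.group) (use \<eta> in auto)
    then show ?thesis by (simp add: F_def)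
  qed
  have F_ne: "F m \<noteq> {}" if "m \<in> M \<or> m = i" for m
  proof
    assume "F m = {}"
    then have "(\<Sum>b\<in>F m. L b) = 0" by simp
    then show False using sums[of m] that L_pos[of m] ij by (auto simp: F_def M_def split: if_splits)
  qed
  have Fj: "F j = {}"
  proof (rule ccontr)
    assume "F j \<noteq> {}"
    then obtain b where "b \<in> F j" by blast
    moreover have "(\<Sum>b\<in>F j. L b) = 0" using sums[of j] ij by (simp add: F_def)
    ultimately show False using fin[of j] L_pos[of b] by (auto simp: F_def)
  qed
  have "card (F i) \<noteq> 1"
  proof
    assume "card (F i) = 1"
    then obtain b where b: "F i = {b}" by (auto simp: card_1_singleton_iff)
    then have "b < r" by (auto simp: F_def)
    moreover have "L b = L i + L j" using sums[of i] ij b by (simp add: F_def)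
    ultimately show False using sep by blast
  qed
  moreover have "card (F i) \<noteq> 0" using F_ne[of i] fin by simp
  ultimately have ci: "card (F i) \<ge> 2" by linarith
  have cM: "card M = r - 2" using ij by (simp add: M_def card_Diff_subset)
  have "r \<ge> 2" using ij by linarith
  have "r = (\<Sum>m<r. card (F m))" using total[of "\<lambda>_. 1"] by simp
  then have eqr: "r = card (F i) + (\<Sum>m\<in>M. card (F m))" using split[of "\<lambda>m. card (F m)"] Fj by simp
  have ge: "card (F m) \<ge> 1" if "m \<in> M" for m
    using F_ne[of m] that fin[of m] by (simp add: Suc_le_eq card_gt_0_iff)
  have "(\<Sum>m\<in>M. card (F m)) = (\<Sum>m\<in>M. (card (F m) - 1) + 1)"
    by (intro sum.cong refl le_add_diff_inverse2[symmetric] ge)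
  then have "(\<Sum>m\<in>M. card (F m)) = (\<Sum>m\<in>M. card (F m) - 1) + (r - 2)"
    by (simp only: sum.distrib) (simp add: cM)
  then have "card (F i) = 2" "(\<Sum>m\<in>M. card (F m) - 1) = 0" using eqr ci \<open>r \<ge> 2\<close> by linarith+
  then have c1: "card (F m) = 1" if "m \<in> M" for m
  proof -
    have "finite M" by (simp add: M_def)
    then have "card (F m) - 1 = 0" using \<open>(\<Sum>m\<in>M. card (F m) - 1) = 0\<close> that by simp
    then show ?thesis using ge[OF that] by linarith
  qed
  obtain b b' where bb: "F i = {b, b'}" "b \<noteq> b'" using \<open>card (F i) = 2\<close> by (auto simp: card_2_iff)
  have L1: "L b + L b' = L i + L j" using sums[of i] ij bb by (simp add: F_def[symmetric])
  have "(\<Sum>x\<in>F m. (L x)\<^sup>2) = (L m)\<^sup>2" if m: "m \<in> M" for m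
  proof -
    obtain x where x: "F m = {x}" using c1[OF m] by (auto simp: card_1_singleton_iff)
    then have "L x = L m" using sums[of m] m by (auto simp: M_def F_def[symmetric])
    then show ?thesis using x by simp
  qed
  then have "(\<Sum>x<r. (L x)\<^sup>2) = (L b)\<^sup>2 + (L b')\<^sup>2 + (\<Sum>m\<in>M. (L m)\<^sup>2)"
    using total[of "\<lambda>x. (L x)\<^sup>2"] split[of "\<lambda>m. \<Sum>x\<in>F m. (L x)\<^sup>2"] bb Fj by simp
  then have L2: "(L b)\<^sup>2 + (L b')\<^sup>2 = (L i)\<^sup>2 + (L j)\<^sup>2"
    using split[of "\<lambda>x. (L x)\<^sup>2"] by simp
  have "\<exists>c c'. F i = {c, c'} \<and> c \<noteq> c' \<and> L c = L i \<and> L c' = L j"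
    using pair_eq_of_sum_and_squares[OF L1 L2] bb by (metis insert_commute)
  then obtain c c' where cc: "F i = {c, c'}" "c \<noteq> c'" "L c = L i" "L c' = L j" by blast
  define v where "v x = (if x = c then i else if x = c' then j else if x < r then \<eta> x else x)" for x
  have cr: "c < r" "c' < r" "\<eta> c = i" "\<eta> c' = i" using cc by (auto simp: F_def set_eq_iff)
  have \<eta>M: "\<eta> x \<in> M" if "x < r" "x \<noteq> c" "x \<noteq> c'" for x
  proof -
    have "x \<notin> F i" "x \<notin> F j" using cc that Fj by auto
    then show ?thesis using \<eta>[OF that(1)] that by (auto simp: F_def M_def)
  qed
  have \<eta>inj: "x = y" if "x < r" "y < r" "\<eta> x = \<eta> y" "\<eta> x \<in> M" for x y
  proof -
    have "x \<in> F (\<eta> x)" "y \<in> F (\<eta> x)" using that by (auto simp: F_def)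
    then show ?thesis using c1[OF that(4)] by (auto simp: card_1_singleton_iff)
  qed
  have "v permutes {..<r}"
  proof (rule inj_imp_permutes)
    show "inj_on v {..<r}"
    proof (rule inj_onI)
      fix x y assume xy: "x \<in> {..<r}" "y \<in> {..<r}" "v x = v y"
      have "i \<notin> M" "j \<notin> M" by (auto simp: M_def)
      then show "x = y" using xy \<eta>M[of x] \<eta>M[of y] \<eta>inj[of x y] ij(3)
        by (auto simp: v_def split: if_splits)
    qed
    show "v x \<in> {..<r}" if "x \<in> {..<r}" for x using that \<eta> ij by (auto simp: v_def)
  qed (auto simp: v_def cr)
  moreover have "L (v x) = L x" if x: "x < r" for x
  proof (cases "x = c \<or> x = c'")
    case True
    then show ?thesis using cc by (auto simp: v_def)
  next
    case False
    have "F (\<eta> x) = {x}"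
      using \<eta>inj[OF _ x] \<eta>M[OF x] False x by (auto simp: F_def)
    then show ?thesis using sums[of "\<eta> x"] \<eta>M[OF x] \<eta>[OF x] False x
      by (auto simp: v_def F_def[symmetric] M_def)
  qed
  ultimately have "v \<in> wperms" by (simp add: wperms_def)
  moreover have "(if v x = j then i else v x) = \<eta> x" if x: "x < r" for x
    using \<eta>M[OF x] x cr ij by (auto simp: v_def M_def)
  ultimately show ?thesis using that by blast
qed

text \<open>Here the factor vanishes on fewer permuted points than \<open>omega n K\<close> does. By
  \<open>merge_perm\<close> the surviving permutations are block permutations followed by a
  rearrangement inside the merged classes, and \<open>inv\<close> absorbs the latter.\<close>

lemma lifts_omega_merged:
  assumes ij: "i < r" "j < r" "i \<noteq> j" and sep: "\<And>b. b < r \<Longrightarrow> L b \<noteq> L i + L j"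
  defines "\<psi> \<equiv> \<lambda>k. if \<beta> k = j then i else \<beta> k"
  assumes \<Phi>: "poly_fun n \<Phi>"
    and inv: "\<And>\<rho> x. \<rho> permutes {..<n} \<Longrightarrow> (\<And>k. k < n \<Longrightarrow> \<psi> (\<rho> k) = \<psi> k) \<Longrightarrow> \<Phi> (x \<circ> \<rho>) = \<Phi> x"
  shows "lifts (\<lambda>z. \<Sum>w\<in>wperms. omega n (ker_on n \<psi>) (pt (z \<circ> w)) * \<Phi> (pt (z \<circ> w)))"
proof -
  define \<Gamma> where "\<Gamma> x = omega n (ker_on n \<psi>) x * \<Phi> x" for x
  have p: "poly_fun n \<Gamma>" unfolding \<Gamma>_def[abs_def] by (intro poly_fun_mult poly_fun_omega \<Phi>)
  have inv\<Gamma>: "\<Gamma> (x \<circ> \<rho>) = \<Gamma> x" if \<rho>: "\<rho> permutes {..<n}" "\<And>k. k < n \<Longrightarrow> \<psi> (\<rho> k) = \<psi> k" for \<rho> x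
  proof -
    have lt: "\<rho> k < n \<longleftrightarrow> k < n" for k using permutes_in_image[OF \<rho>(1), of k] by simp
    have "omega n (ker_on n \<psi>) (x \<circ> \<rho>) = omega n (ker_on n \<psi>) x"
      unfolding omega_def by (rule prod_pairs_permute[OF _ \<rho>(1)]) (auto simp: ker_on_def lt \<rho>(2))
    then show ?thesis using inv[OF \<rho>] by (simp add: \<Gamma>_def)
  qed
  have "lifts (\<lambda>z. \<Sum>w\<in>wperms. \<Gamma> (pt (z \<circ> w)))"
  proof (rule lifts_sum_wperms[OF p])
    fix \<sigma> assume s: "\<sigma> permutes {..<n}"
    have slt: "\<sigma> k < n \<longleftrightarrow> k < n" for k using permutes_in_image[OF s, of k] by simp
    show "(\<forall>z. \<Gamma> (pt z \<circ> \<sigma>) = 0) \<or> (\<exists>w\<in>wperms. \<forall>z. \<Gamma> (pt z \<circ> \<sigma>) = \<Gamma> (pt (z \<circ> w)))"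
    proof (cases "ker_on n (\<beta> \<circ> \<sigma>) \<subseteq> ker_on n \<psi>")
      case True
      obtain \<eta> where \<eta>: "\<And>k. k < n \<Longrightarrow> \<eta> ((\<beta> \<circ> \<sigma>) k) = \<psi> k"
        using ker_on_factor[OF True] by blast
      have \<psi>r: "\<psi> k < r" if "k < n" for k using \<beta>_less[OF that] ij by (simp add: \<psi>_def)
      have \<eta>r: "\<eta> b < r" if "b < r" for b
      proof -
        obtain k where k: "k < n" "\<beta> k = b" using fibre_ex[OF \<open>b < r\<close>] by blast
        obtain l where l: "l \<in> {..<n}" "k = \<sigma> l" using permutes_image[OF s] k by blast
        then show ?thesis using \<eta>[of l] \<psi>r[of l] k by simp
      qed
      have "(\<Sum>b | b < r \<and> \<eta> b = m. L b) = (if m = i then L i + L j else if m = j then 0 else L m)"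
        if m: "m < r" for m
      proof -
        have "(\<Sum>b | b < r \<and> \<eta> b = m. L b) = card {k. k < n \<and> \<eta> (\<beta> k) = m}"
        proof -
          have "{k. k < n \<and> \<beta> k \<in> {b. b < r \<and> \<eta> b = m}} = {k. k < n \<and> \<eta> (\<beta> k) = m}"
            using \<beta>_less by auto
          moreover have sub: "{b. b < r \<and> \<eta> b = m} \<subseteq> {..<r}" by auto
          note sum_fibres[OF sub, of "\<lambda>_. 1 :: nat"]
          ultimately show ?thesis by (simp only: card_eq_sum of_nat_id mult_1_right)
        qed
        also have "\<dots> = card {k. k < n \<and> \<eta> (\<beta> (\<sigma> k)) = m}"
          using card_fibre_permute[OF s, of "\<lambda>k. \<eta> (\<beta> k) = m"] by simp
        also have "\<dots> = card {k. k < n \<and> \<psi> k = m}"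
          using \<eta> by (intro arg_cong[of _ _ card] Collect_cong) auto
        also have "\<dots> = (if m = i then L i + L j else if m = j then 0 else L m)"
        proof -
          define A where "A = (if m = i then {i, j} else if m = j then {} else {m})"
          have "{k. k < n \<and> \<psi> k = m} = {k. k < n \<and> \<beta> k \<in> A}"
            unfolding A_def \<psi>_def using ij by (intro Collect_cong) auto
          moreover have "A \<subseteq> {..<r}" using ij m by (auto simp: A_def)
          ultimately have "card {k. k < n \<and> \<psi> k = m} = (\<Sum>b\<in>A. L b)"
            using sum_fibres[of A "\<lambda>_. 1 :: nat"] by simp
          then show ?thesis using ij by (simp add: A_def)
        qed
        finally show ?thesis .
      qed
      from merge_perm[OF ij sep \<eta>r this] obtain v where v: "v \<in> wperms"
        "\<And>b. b < r \<Longrightarrow> (if v b = j then i else v b) = \<eta> b" by blast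
      define u where "u = inv_into UNIV v"
      have vu: "v (u x) = x" "u (v x) = x" for x
        using permutes_inverses[OF wperms_permutes[OF v(1)]] by (auto simp: u_def)
      have u: "u \<in> wperms" unfolding u_def by (rule wperms_inv[OF v(1)])
      \<comment> \<open>The labellings \<open>v \<circ> \<beta> \<circ> \<sigma>\<close> and
        \<open>\<beta>\<close> have equal class sizes and so differ by a permutation
        \<open>\<rho>\<close>. It preserves the merged classes, and
        \<open>pt z \<circ> \<sigma>\<close> becomes \<open>pt (z \<circ> u) \<circ> \<rho>\<close>
        with \<open>u\<close> the inverse of \<open>v\<close>.\<close>
      have "card {k. k < n \<and> v (\<beta> (\<sigma> k)) = y} = card {k. k < n \<and> \<beta> k = y}" for y
      proof -
        have "card {k. k < n \<and> v (\<beta> (\<sigma> k)) = y} = card {k. k < n \<and> v (\<beta> k) = y}"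
          using card_fibre_permute[OF s, of "\<lambda>k. v (\<beta> k) = y"] by simp
        also have "\<dots> = card {k. k < n \<and> \<beta> k = y}"
        proof -
          obtain \<tau> where t: "\<tau> permutes {..<n}" "\<And>k. k < n \<Longrightarrow> v (\<beta> k) = \<beta> (\<tau> k)"
            using wperms_lift[OF v(1)] by blast
          have "{k. k < n \<and> v (\<beta> k) = y} = {k. k < n \<and> \<beta> (\<tau> k) = y}"
            using t(2) by (intro Collect_cong) auto
          then show ?thesis using card_fibre_permute[OF t(1), of "\<lambda>k. \<beta> k = y"] by simp
        qed
        finally show ?thesis .
      qed
      then obtain \<rho> where \<rho>: "\<rho> permutes {..<n}" "\<And>k. k < n \<Longrightarrow> v (\<beta> (\<sigma> k)) = \<beta> (\<rho> k)"
        using fibres_eq_permutes[of n "\<lambda>k. v (\<beta> (\<sigma> k))" \<beta>] by blast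
      have "\<psi> (\<rho> k) = \<psi> k" if k: "k < n" for k
      proof -
        have "\<psi> (\<rho> k) = (if v (\<beta> (\<sigma> k)) = j then i else v (\<beta> (\<sigma> k)))"
          unfolding \<psi>_def \<rho>(2)[OF k] ..
        also have "\<dots> = \<eta> (\<beta> (\<sigma> k))" using v(2) \<beta>_less slt[of k] k by blast
        finally show ?thesis using \<eta>[OF k] by simp
      qed
      from inv\<Gamma>[OF \<rho>(1) this] have "\<Gamma> (pt (z \<circ> u) \<circ> \<rho>) = \<Gamma> (pt (z \<circ> u))" for z by blast
      moreover have "pt (z \<circ> u) \<circ> \<rho> = pt z \<circ> \<sigma>" for z
      proof
        fix k
        have "\<rho> k < n \<longleftrightarrow> k < n" using permutes_in_image[OF \<rho>(1), of k] by simp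
        then show "(pt (z \<circ> u) \<circ> \<rho>) k = (pt z \<circ> \<sigma>) k"
          using \<rho>(2)[of k, symmetric] slt[of k] by (simp add: pt_def vu)
      qed
      ultimately have "\<forall>z. \<Gamma> (pt z \<circ> \<sigma>) = \<Gamma> (pt (z \<circ> u))" by simp
      then show ?thesis using u by blast
    next
      case False
      then show ?thesis using ker_on_perm_not_subset[OF s False] by (simp add: \<Gamma>_def)
    qed
  qed
  then show ?thesis by (simp add: \<Gamma>_def)
qed

end

section \<open>A quintic form with cusps along three lines\<close>

text \<open>Forms of degree five in the differences of three points have dimension six. Three cusp
  conditions leave at least three dimensions, whereas the power sums give only \<open>P 5\<close>
  and \<open>P 2 * P 3\<close>. The double factors settle the conditions at \<open>y = t\<close> and
  \<open>x = t\<close>; the one at \<open>x = y\<close> then determines the linear factor up to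
  scale.\<close>

definition quintic :: "complex \<Rightarrow> complex \<Rightarrow> complex \<Rightarrow> complex \<Rightarrow> complex \<Rightarrow> complex" where
  "quintic u v x y t = (y - t)\<^sup>2 * (x - t)\<^sup>2 * ((2 * u - 3 * v) * (y - t) + (2 * v - 3 * u) * (x - t))"

lemma weighted_mean_offsets:
  fixes u v x y :: complex
  assumes "u + v \<noteq> 0"
  shows "(u * x + v * y) / (u + v) + v * ((x - y) / (u + v)) = x"
    and "(u * x + v * y) / (u + v) - u * ((x - y) / (u + v)) = y"
proof -
  have "(u * x + v * y) / (u + v) + v * ((x - y) / (u + v)) = ((u + v) * x) / (u + v)"
    unfolding times_divide_eq_right add_divide_distrib[symmetric] by (simp add: algebra_simps)
  then show "(u * x + v * y) / (u + v) + v * ((x - y) / (u + v)) = x" using assms by simp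
  have "(u * x + v * y) / (u + v) - u * ((x - y) / (u + v)) = ((u + v) * y) / (u + v)"
    unfolding times_divide_eq_right diff_divide_distrib[symmetric] by (simp add: algebra_simps)
  then show "(u * x + v * y) / (u + v) - u * ((x - y) / (u + v)) = y" using assms by simp
qed

text \<open>\<open>F x y t\<close> is a quintic form in the offset \<open>e\<close> from \<open>t\<close> to the weighted mean of \<open>x, y\<close> and in
  the scaled difference \<open>d\<close>, without the monomial \<open>e^4 * d\<close>. Thus it can be written in terms of
  the central moments of the two-point measure with weights \<open>a, b\<close>.\<close>
definition no_linear_term :: "complex \<Rightarrow> complex \<Rightarrow> (complex \<Rightarrow> complex \<Rightarrow> complex \<Rightarrow> complex) \<Rightarrow> bool" where
  "no_linear_term a b F \<longleftrightarrow> (\<exists>c0 c2 c3 c4 c5. \<forall>x y t e d.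
     e = (a * x + b * y) / (a + b) - t \<longrightarrow> d = (x - y) / (a + b) \<longrightarrow>
     F x y t = c0 * e ^ 5 + c2 * (e ^ 3 * d\<^sup>2) + c3 * (e\<^sup>2 * d ^ 3) + c4 * (e * d ^ 4) + c5 * d ^ 5)"

lemma quintic_no_linear_term_12:
  assumes "u + v \<noteq> 0"
  shows "no_linear_term u v (\<lambda>x y t. quintic u v x y t)"
proof -
  have eq: "quintic u v x y t = - (u + v) * e ^ 5 + (- (u + v) * ((v - u)\<^sup>2 - 2 * u * v - 4 * (u - v)\<^sup>2)) * (e ^ 3 * d\<^sup>2)
      + (- (u + v) * (2 * (u - v) * u * v + 2 * (u - v) * ((u - v)\<^sup>2 - 2 * u * v))) * (e\<^sup>2 * d ^ 3)
      + (- (u + v) * (u\<^sup>2 * v\<^sup>2 + 4 * (u - v)\<^sup>2 * u * v)) * (e * d ^ 4)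
      + (- (u + v) * (2 * (u - v) * u\<^sup>2 * v\<^sup>2)) * d ^ 5"
    if ed: "e = (u * x + v * y) / (u + v) - t" "d = (x - y) / (u + v)" for x y t e d
  proof -
    have x: "x - t = e + v * d" and y: "y - t = e - u * d"
      using weighted_mean_offsets[OF assms, of x y] unfolding ed by (auto simp: algebra_simps)
    show ?thesis unfolding quintic_def x y
      by (simp add: algebra_simps eval_nat_numeral)
  qed
  show ?thesis unfolding no_linear_term_def
    by (intro exI allI impI) (rule eq)
qed

text \<open>The factor \<open>(x - y)\<^sup>2\<close> is a multiple of \<open>d\<^sup>2\<close>, so
  no term is linear in \<open>d\<close>. This covers the two collisions at which the quintic
  vanishes doubly.\<close>

lemma cusp_no_linear_term:
  assumes "a + b \<noteq> 0"
    and F: "\<And>x y t. F x y t = (x - y)\<^sup>2 * (y - t)\<^sup>2 * (g * (x - y) + h * (y - t))"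
  shows "no_linear_term a b F"
proof -
  have eq: "F x y t = 0 * e ^ 5 + ((a + b)\<^sup>2 * h) * (e ^ 3 * d\<^sup>2)
      + ((a + b)\<^sup>2 * (g * (a + b) - 3 * a * h)) * (e\<^sup>2 * d ^ 3)
      + ((a + b)\<^sup>2 * (- 2 * a * (g * (a + b) - a * h) + a\<^sup>2 * h)) * (e * d ^ 4)
      + ((a + b)\<^sup>2 * (a\<^sup>2 * (g * (a + b) - a * h))) * d ^ 5"
    if ed: "e = (a * x + b * y) / (a + b) - t" "d = (x - y) / (a + b)" for x y t e d
  proof -
    have x: "x - y = (a + b) * d" and y: "y - t = e - a * d"
      using weighted_mean_offsets[OF assms(1), of x y] assms(1) unfolding ed by (auto simp: diff_add_eq)
    show ?thesis unfolding F x y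
      by (simp add: algebra_simps eval_nat_numeral)
  qed
  show ?thesis unfolding no_linear_term_def
    by (intro exI allI impI) (rule eq)
qed

lemma quintic_no_linear_term_13:
  assumes "u + w \<noteq> 0"
  shows "no_linear_term u w (\<lambda>x t y. quintic u v x y t)"
proof (rule cusp_no_linear_term[OF assms])
  show "quintic u v x y t = (x - t)\<^sup>2 * (t - y)\<^sup>2 * ((2 * v - 3 * u) * (x - t) + (- (2 * u - 3 * v)) * (t - y))" for x t y
    unfolding quintic_def by (simp add: algebra_simps power2_eq_square)
qed

lemma quintic_no_linear_term_23:
  assumes "v + w \<noteq> 0"
  shows "no_linear_term v w (\<lambda>y t x. quintic u v x y t)"
proof (rule cusp_no_linear_term[OF assms])
  show "quintic u v x y t = (y - t)\<^sup>2 * (t - x)\<^sup>2 * ((2 * u - 3 * v) * (y - t) + (- (2 * v - 3 * u)) * (t - x))" for x t y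
    unfolding quintic_def by (simp add: algebra_simps power2_eq_square)
qed

text \<open>The equation is evaluated at the points of the plane where two coordinates coincide.\<close>
lemma quintic_not_moments:
  fixes u v w \<kappa> \<alpha> \<alpha>' :: complex
  assumes nz: "u \<noteq> 0" "v \<noteq> 0" "w \<noteq> 0" "u + v \<noteq> 0" "u + w \<noteq> 0" "v + w \<noteq> 0" "u + v + w \<noteq> 0"
    and ne: "u \<noteq> v" "u \<noteq> v + w" "v \<noteq> u + w"
    and eq: "\<And>x y t. u * x + v * y + w * t = 0 \<Longrightarrow> \<kappa> * quintic u v x y t
       = \<alpha> * (u * x ^ 5 + v * y ^ 5 + w * t ^ 5)
        + \<alpha>' * ((u * x\<^sup>2 + v * y\<^sup>2 + w * t\<^sup>2) * (u * x ^ 3 + v * y ^ 3 + w * t ^ 3))"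
  shows "\<kappa> = 0"
proof -
  define W where "W = u + v + w"
  \<comment> \<open>Masses \<open>p\<close> and \<open>s\<close> at \<open>s\<close> and
    \<open>- p\<close> have mean zero; a collision of two of the three points gives such a
    configuration. At the first two collisions used below a double factor makes
    \<open>quintic\<close> zero, and \<open>ne\<close> makes the common factor \<open>s - p\<close>
    nonzero.\<close>
  have key: "\<alpha> * (W\<^sup>2 - 2 * (p * s)) + \<alpha>' * (p * s * W) = 0"
    if "p * s \<noteq> 0" "s \<noteq> p" "W = s + p"
      "\<alpha> * (p * s ^ 5 + s * (- p) ^ 5) + \<alpha>' * ((p * s\<^sup>2 + s * (- p)\<^sup>2) * (p * s ^ 3 + s * (- p) ^ 3)) = 0" for p s
  proof -
    have "\<alpha> * (p * s ^ 5 + s * (- p) ^ 5) + \<alpha>' * ((p * s\<^sup>2 + s * (- p)\<^sup>2) * (p * s ^ 3 + s * (- p) ^ 3))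
        = (p * s * (s - p) * (s + p)) * (\<alpha> * ((s + p)\<^sup>2 - 2 * (p * s)) + \<alpha>' * (p * s * (s + p)))"
      by (simp add: algebra_simps eval_nat_numeral)
    then show ?thesis using that nz(7) by (auto simp: W_def)
  qed
  have 1: "\<alpha> * (W\<^sup>2 - 2 * (u * (v + w))) + \<alpha>' * (u * (v + w) * W) = 0"
  proof (rule key)
    show "u * (v + w) \<noteq> 0"
      using nz by simp
    show "\<alpha> * (u * (v + w) ^ 5 + (v + w) * (- u) ^ 5)
      + \<alpha>' * ((u * (v + w)\<^sup>2 + (v + w) * (- u)\<^sup>2) * (u * (v + w) ^ 3 + (v + w) * (- u) ^ 3)) = 0"
      using eq[of "v + w" "- u" "- u"] by (simp add: quintic_def algebra_simps)
  qed (use ne in \<open>auto simp: W_def\<close>)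
  have 2: "\<alpha> * (W\<^sup>2 - 2 * (v * (u + w))) + \<alpha>' * (v * (u + w) * W) = 0"
  proof (rule key)
    show "v * (u + w) \<noteq> 0"
      using nz by simp
    show "\<alpha> * (v * (u + w) ^ 5 + (u + w) * (- v) ^ 5)
      + \<alpha>' * ((v * (u + w)\<^sup>2 + (u + w) * (- v)\<^sup>2) * (v * (u + w) ^ 3 + (u + w) * (- v) ^ 3)) = 0"
      using eq[of "- v" "u + w" "- v"] by (simp add: quintic_def algebra_simps)
  qed (use ne in \<open>auto simp: W_def\<close>)
  have "(w * (u - v)) * (\<alpha>' * W - 2 * \<alpha>)
      = (\<alpha> * (W\<^sup>2 - 2 * (u * (v + w))) + \<alpha>' * (u * (v + w) * W))
       - (\<alpha> * (W\<^sup>2 - 2 * (v * (u + w))) + \<alpha>' * (v * (u + w) * W))"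
    by (simp add: algebra_simps)
  then have "(w * (u - v)) * (\<alpha>' * W - 2 * \<alpha>) = 0" unfolding 1 2 by simp
  then have a': "\<alpha>' * W = 2 * \<alpha>" using nz ne by simp
  have "\<alpha> * (W\<^sup>2 - 2 * (u * (v + w))) + \<alpha>' * (u * (v + w) * W)
      = \<alpha> * (W\<^sup>2 - 2 * (u * (v + w))) + (\<alpha>' * W) * (u * (v + w))" by simp
  then have "\<alpha> * W\<^sup>2 = 0" using 1 unfolding a' by (simp add: algebra_simps)
  then have "\<alpha> = 0" using nz by (simp add: W_def)
  then have "\<alpha>' = 0" using a' nz by (simp add: W_def)
  then have "\<kappa> * quintic u v (- w) (- w) (u + v) = 0"
    using eq[of "- w" "- w" "u + v"] \<open>\<alpha> = 0\<close> by (simp add: algebra_simps)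
  moreover have "quintic u v (- w) (- w) (u + v) = W ^ 5 * (u + v)"
    unfolding quintic_def W_def by (simp add: algebra_simps eval_nat_numeral)
  ultimately show ?thesis using nz by (simp add: W_def)
qed

section \<open>The witness attached to three blocks\<close>

locale triple = blocks +
  fixes i1 i2 i3 :: nat
  assumes i_less: "i1 < r" "i2 < r" "i3 < r"
    and L_distinct: "L i1 \<noteq> L i2" "L i1 \<noteq> L i3" "L i2 \<noteq> L i3"
    and L_sep: "\<And>b. b < r \<Longrightarrow> L b \<noteq> L i1 + L i2" "\<And>b. b < r \<Longrightarrow> L b \<noteq> L i1 + L i3"
      "\<And>b. b < r \<Longrightarrow> L b \<noteq> L i2 + L i3"
begin

abbreviation T :: "nat set" where "T \<equiv> {i1, i2, i3}"

definition offT :: "(nat \<times> nat) set" where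
  "offT = {(k, l). k < n \<and> l < n \<and> \<beta> k \<noteq> \<beta> l \<and> \<not> (\<beta> k \<in> T \<and> \<beta> l \<in> T)}"

definition DT :: "(nat \<Rightarrow> complex) \<Rightarrow> complex" where
  "DT x = (\<Prod>(k, l)\<in>offT. x k - x l)"

definition quin :: "(nat \<Rightarrow> complex) \<Rightarrow> complex" where
  "quin z = quintic (of_nat (L i1)) (of_nat (L i2)) (z i1) (z i2) (z i3)"

text \<open>One factor \<open>DT\<close> suffices to supply the missing part of
  \<open>omega n K\<close> in \<open>lifts_theta_second_term\<close>. The cube is needed on the
  slice at the triple collision: if \<open>w\<close> moves the triple, \<open>DT\<close> has order
  at least two there, so its cube has order at least six, beyond the degree five of the
  quintic.\<close>

definition Psi :: "(nat \<Rightarrow> complex) \<Rightarrow> complex" where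
  "Psi z = DT (pt z) ^ 3 * quin z"

definition wit :: "(nat \<Rightarrow> complex) \<Rightarrow> complex" where
  "wit z = (\<Sum>w\<in>wperms. Psi (z \<circ> w))"

lemma i_distinct: "i1 \<noteq> i2" "i1 \<noteq> i3" "i2 \<noteq> i3" using L_distinct by auto

lemma finite_offT: "finite offT"
  by (rule finite_subset[of _ "{..<n} \<times> {..<n}"]) (auto simp: offT_def)

lemma poly_fun_DT: "poly_fun n DT"
proof -
  have "DT = (\<lambda>x. \<Prod>p\<in>offT. x (fst p) - x (snd p))" by (auto simp: DT_def split_def)
  then show ?thesis by (auto intro!: poly_fun_prod poly_fun_diff poly_fun_coord simp: offT_def)
qed

lemma poly_fun_quin: "poly_fun r quin"
  unfolding quin_def[abs_def] quintic_def
  by (intro poly_fun_mult poly_fun_add poly_fun_diff poly_fun_power poly_fun_const poly_fun_coord i_less)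

lemma poly_fun_Psi: "poly_fun r Psi"
  unfolding Psi_def[abs_def]
  by (intro poly_fun_mult poly_fun_power poly_fun_pt poly_fun_DT poly_fun_quin)

lemma quin_scale: "quin (\<lambda>k. t * z k) = t ^ 5 * quin z"
proof -
  have eq: "(t * A)\<^sup>2 * (t * B)\<^sup>2 * (p * (t * A) + q * (t * B)) = t ^ 5 * (A\<^sup>2 * B\<^sup>2 * (p * A + q * B))"
    for A B p q :: complex by (simp add: algebra_simps eval_nat_numeral)
  have d: "t * z i - t * z j = t * (z i - z j)" for i j by (simp only: right_diff_distrib)
  show ?thesis unfolding quin_def quintic_def d by (rule eq)
qed

lemma pt_scale: "pt (\<lambda>k. t * z k) = (\<lambda>k. t * pt z k)" by (auto simp: pt_def)

lemma DT_scale: "DT (\<lambda>k. t * x k) = t ^ card offT * DT x"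
proof -
  have "DT (\<lambda>k. t * x k) = (\<Prod>p\<in>offT. t * (case p of (k, l) \<Rightarrow> x k - x l))"
    unfolding DT_def by (intro prod.cong) (auto simp: algebra_simps)
  then show ?thesis by (simp add: DT_def prod.distrib)
qed

lemma wit_scale: "wit (\<lambda>k. t * z k) = t ^ (card offT * 3 + 5) * wit z"
proof -
  have "Psi (\<lambda>k. t * z k) = t ^ (card offT * 3 + 5) * Psi z" for z
    by (simp add: Psi_def pt_scale DT_scale quin_scale power_mult_distrib power_add power_mult)
  from this[of "z \<circ> _"] have "Psi ((\<lambda>k. t * z k) \<circ> w) = t ^ (card offT * 3 + 5) * Psi (z \<circ> w)" for w
    by (simp add: comp_def)
  then show ?thesis by (simp add: wit_def sum_distrib_left)
qed

text \<open>A function invariant under rearrangement of the merged class cannot see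
  \<open>z i\<close> and \<open>z j\<close> separately, but it sees their weighted mean and, through
  the second and third central moments, \<open>d\<^sup>2\<close> and \<open>d ^ 3\<close>. Together
  with \<open>e\<close> these generate every term allowed by \<open>no_linear_term\<close>.\<close>

lemma lifts_merged:
  assumes T: "T = {i, j, c}" and ijc: "i < r" "j < r" "c < r" "i \<noteq> j" "i \<noteq> c" "j \<noteq> c"
    and L: "L i \<noteq> L j" and sep: "\<And>b. b < r \<Longrightarrow> L b \<noteq> L i + L j"
    and F: "no_linear_term (of_nat (L i)) (of_nat (L j)) F" "\<And>z. quin z = F (z i) (z j) (z c)"
    and m: "m > 0"
  defines "\<psi> \<equiv> \<lambda>k. if \<beta> k = j then i else \<beta> k"
  shows "lifts (\<lambda>z. \<Sum>w\<in>wperms. omega n (ker_on n \<psi>) (pt (z \<circ> w)) ^ m * Psi (z \<circ> w))"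
proof -
  define a b g where "a = (of_nat (L i) :: complex)" and "b = (of_nat (L j) :: complex)"
    and "g = (of_nat (L c) :: complex)"
  have pos: "a \<noteq> 0" "b \<noteq> 0" "g \<noteq> 0" "a \<noteq> b" "a + b \<noteq> 0"
    using L_pos[of i] L_pos[of j] L_pos[of c] ijc L
    by (auto simp: a_def b_def g_def simp flip: of_nat_add)
  obtain c0 c2 c3 c4 c5 where c: "\<And>x y t e d. e = (a * x + b * y) / (a + b) - t \<Longrightarrow> d = (x - y) / (a + b) \<Longrightarrow>
     F x y t = c0 * e ^ 5 + c2 * (e ^ 3 * d\<^sup>2) + c3 * (e\<^sup>2 * d ^ 3) + c4 * (e * d ^ 4) + c5 * d ^ 5"
    using F(1) unfolding no_linear_term_def a_def[symmetric] b_def[symmetric] by blast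
  define A where "A = {k. k < n \<and> \<psi> k = i}"
  define B where "B = {k. k < n \<and> \<psi> k = c}"
  define mu where "mu x = (\<Sum>k\<in>A. x k) / (a + b)" for x
  define e where "e x = mu x - (\<Sum>k\<in>B. x k) / g" for x
  \<comment> \<open>At \<open>pt z\<close> the deviations from the mean are \<open>b * d\<close>
    with mass \<open>a\<close> and \<open>- a * d\<close> with mass \<open>b\<close>. The
    denominators normalise the central moments to \<open>d\<^sup>2\<close> and \<open>d ^ 3\<close>;
    the factor \<open>b - a\<close> is nonzero because the two sizes differ.\<close>
  define s2 where "s2 x = (\<Sum>k\<in>A. (x k - mu x)\<^sup>2) / (a * b * (a + b))" for x
  define s3 where "s3 x = (\<Sum>k\<in>A. (x k - mu x) ^ 3) / (a * b * (b - a) * (b + a))" for x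
  define H where "H x = c0 * e x ^ 5 + c2 * (e x ^ 3 * s2 x) + c3 * ((e x)\<^sup>2 * s3 x)
    + c4 * (e x * (s2 x)\<^sup>2) + c5 * (s2 x * s3 x)" for x
  \<comment> \<open>The exponent is \<open>m - 1\<close> because \<open>lifts_omega_merged\<close>
    supplies one factor itself.\<close>
  define \<Phi> where "\<Phi> x = omega n (ker_on n \<psi>) x ^ (m - 1) * (DT x ^ 3 * H x)" for x
  have fin: "finite A" "finite B" by (auto simp: A_def B_def)
  have lt: "k \<in> A \<Longrightarrow> k < n" "k \<in> B \<Longrightarrow> k < n" for k by (auto simp: A_def B_def)
  have pmu: "poly_fun n mu" unfolding mu_def[abs_def] divide_inverse
    by (intro poly_fun_mult poly_fun_sum poly_fun_const poly_fun_coord lt)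
  have pe: "poly_fun n e" unfolding e_def[abs_def] divide_inverse
    by (intro poly_fun_mult poly_fun_diff poly_fun_sum poly_fun_const poly_fun_coord lt pmu)
  have p2: "poly_fun n s2" unfolding s2_def[abs_def] divide_inverse
    by (intro poly_fun_mult poly_fun_diff poly_fun_power poly_fun_sum poly_fun_const poly_fun_coord lt pmu)
  have p3: "poly_fun n s3" unfolding s3_def[abs_def] divide_inverse
    by (intro poly_fun_mult poly_fun_diff poly_fun_power poly_fun_sum poly_fun_const poly_fun_coord lt pmu)
  have "poly_fun n H" unfolding H_def[abs_def]
    by (intro poly_fun_add poly_fun_mult poly_fun_power poly_fun_const pe p2 p3)
  then have p\<Phi>: "poly_fun n \<Phi>" unfolding \<Phi>_def[abs_def]
    by (intro poly_fun_mult poly_fun_power poly_fun_omega poly_fun_DT)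
  have inv: "\<Phi> (x \<circ> \<rho>) = \<Phi> x" if \<rho>: "\<rho> permutes {..<n}" "\<And>k. k < n \<Longrightarrow> \<psi> (\<rho> k) = \<psi> k" for \<rho> x
  proof -
    have lt: "\<rho> k < n \<longleftrightarrow> k < n" for k using permutes_in_image[OF \<rho>(1), of k] by simp
    have "omega n (ker_on n \<psi>) (x \<circ> \<rho>) = omega n (ker_on n \<psi>) x"
      unfolding omega_def by (rule prod_pairs_permute[OF _ \<rho>(1)]) (auto simp: ker_on_def lt \<rho>(2))
    moreover have "DT (x \<circ> \<rho>) = DT x"
      unfolding DT_def
    proof (rule prod_pairs_permute[OF finite_offT \<rho>(1)])
      \<comment> \<open>Since \<open>i\<close> and \<open>j\<close> both belong to the triple,
        \<open>offT\<close> depends only on the merged classes.\<close>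
      have offT: "(k, l) \<in> offT \<longleftrightarrow> k < n \<and> l < n \<and> \<psi> k \<noteq> \<psi> l \<and> \<not> (\<psi> k \<in> {i, c} \<and> \<psi> l \<in> {i, c})" for k l
        unfolding offT_def T \<psi>_def using ijc by auto
      show "(\<rho> k, \<rho> l) \<in> offT" if "(k, l) \<in> offT" for k l
      proof -
        have kl: "k < n" "l < n" using that by (auto simp: offT_def)
        show ?thesis using that unfolding offT lt \<rho>(2)[OF kl(1)] \<rho>(2)[OF kl(2)] .
      qed
    qed
    moreover have sA: "(\<Sum>k\<in>A. h ((x \<circ> \<rho>) k)) = (\<Sum>k\<in>A. h (x k))" for h :: "complex \<Rightarrow> complex"
      using sum_permute_subset[OF fin(1) \<rho>(1), of "\<lambda>k. h (x k)"] by (simp add: A_def lt \<rho>(2))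
    have sB: "(\<Sum>k\<in>B. (x \<circ> \<rho>) k) = (\<Sum>k\<in>B. x k)"
      using sum_permute_subset[OF fin(2) \<rho>(1), of x] by (simp add: B_def lt \<rho>(2))
    have mu: "mu (x \<circ> \<rho>) = mu x" using sA[of "\<lambda>y. y"] by (simp add: mu_def)
    have "H (x \<circ> \<rho>) = H x"
      unfolding H_def e_def s2_def s3_def mu sA[of "\<lambda>y. (y - mu x)\<^sup>2"] sA[of "\<lambda>y. (y - mu x) ^ 3"] sB ..
    ultimately show ?thesis by (simp add: \<Phi>_def)
  qed
  have H: "H (pt z) = quin z" for z
  proof -
    define d where "d = (z i - z j) / (a + b)"
    have sA: "(\<Sum>k\<in>A. h (pt z k)) = a * h (z i) + b * h (z j)" for h :: "complex \<Rightarrow> complex"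
    proof -
      have A: "A = {k. k < n \<and> \<beta> k \<in> {i, j}}" by (auto simp: A_def \<psi>_def)
      have "(\<Sum>k\<in>A. h (pt z k)) = (\<Sum>k\<in>A. h (z (\<beta> k)))"
        by (intro sum.cong) (auto simp: A_def pt_def)
      then show ?thesis
        unfolding A using sum_fibres[of "{i, j}" "\<lambda>i. h (z i)"] ijc by (simp add: a_def b_def)
    qed
    have B: "B = {k. k < n \<and> \<beta> k \<in> {c}}" using ijc by (auto simp: B_def \<psi>_def)
    have "(\<Sum>k\<in>B. pt z k) = (\<Sum>k\<in>B. z (\<beta> k))"
      by (intro sum.cong) (auto simp: B_def pt_def)
    then have sB: "(\<Sum>k\<in>B. pt z k) = g * z c"
      unfolding B using sum_fibres[of "{c}" z] ijc by (simp add: g_def)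
    have mu: "mu (pt z) = (a * z i + b * z j) / (a + b)" using sA[of "\<lambda>y. y"] by (simp add: mu_def)
    have e: "e (pt z) = (a * z i + b * z j) / (a + b) - z c"
      using pos by (simp add: e_def mu sB)
    have zi: "z i - mu (pt z) = b * d" and zj: "z j - mu (pt z) = - a * d"
      using weighted_mean_offsets[OF pos(5), of "z i" "z j"] unfolding mu d_def
      by (simp_all only: diff_eq_eq eq_diff_eq minus_mult_left[symmetric] add.commute[of _ "_ / _"]) (simp_all add: add.commute)
    have 2: "s2 (pt z) = d\<^sup>2"
    proof -
      have "a * (b * d)\<^sup>2 + b * (- a * d)\<^sup>2 = d\<^sup>2 * (a * b * (a + b))"
        by (simp add: algebra_simps power2_eq_square)
      then show ?thesis unfolding s2_def sA[of "\<lambda>y. (y - mu (pt z))\<^sup>2"] zi zj using pos by simp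
    qed
    have 3: "s3 (pt z) = d ^ 3"
    proof -
      have "a * (b * d) ^ 3 + b * (- a * d) ^ 3 = d ^ 3 * (a * b * (b - a) * (b + a))"
        by (simp add: algebra_simps power3_eq_cube)
      moreover have "b + a \<noteq> 0" using pos by (simp add: add.commute)
      ultimately show ?thesis unfolding s3_def sA[of "\<lambda>y. (y - mu (pt z)) ^ 3"] zi zj using pos by simp
    qed
    have "quin z = c0 * e (pt z) ^ 5 + c2 * (e (pt z) ^ 3 * d\<^sup>2) + c3 * ((e (pt z))\<^sup>2 * d ^ 3)
        + c4 * (e (pt z) * d ^ 4) + c5 * d ^ 5"
      unfolding F(2) by (rule c[OF e d_def])
    then show ?thesis unfolding H_def 2 3 by (simp add: power_add[symmetric] power_mult[symmetric])
  qed
  have "omega n (ker_on n \<psi>) (pt z) * \<Phi> (pt z) = omega n (ker_on n \<psi>) (pt z) ^ m * Psi z" for z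
    unfolding \<Phi>_def Psi_def H using m by (cases m) auto
  then show ?thesis
    using lifts_omega_merged[OF ijc(1,2,4) sep p\<Phi>] inv unfolding \<psi>_def by simp
qed

section \<open>The products of the witness with the two top parameters\<close>

lemma r_ge_3: "r \<ge> 3"
proof -
  have "card T \<le> card {..<r}" by (rule card_mono) (use i_less in auto)
  then show ?thesis using i_distinct by simp
qed

lemma K_strata: "K \<in> strata n r"
  using ker_on_in_strata[of n \<beta>] by (simp add: image_\<beta>)

text \<open>Every point \<open>pt z\<close> has the coincidences of \<open>K\<close>, so a stratum
  with \<open>r\<close> classes other than \<open>K\<close> contributes nothing; for parameters with
  a coincidence both sides vanish.\<close>

lemma theta_top_pt: "theta n r (pt z) = omega n K (pt z) ^ (theta_deg n div card (off n K))"
proof (cases "card (pt z ` {..<n}) < r")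
  case True
  have "\<not> ker_on n (pt z) \<subseteq> K"
  proof
    assume "ker_on n (pt z) \<subseteq> K"
    then have "ker_on n (pt z) = K" using ker_on_pt by blast
    from card_image_ker_on_cong[OF this] True show False by (simp add: image_\<beta>)
  qed
  then have "omega n K (pt z) = 0" unfolding omega_ker_on_eq_0_iff .
  then show ?thesis using theta_eq_0[OF _ True] theta_exponent(2)[OF K_strata] r_ge_3
    by (simp add: power_0_left)
next
  case False
  then have "K = ker_on n (pt z)" by (intro ker_on_eqI ker_on_pt) (simp add: image_\<beta>)
  moreover from card_image_ker_on_cong[OF this] have "card (pt z ` {..<n}) = r" by (simp add: image_\<beta>)
  ultimately show ?thesis using theta_eq[of r "pt z" n] r_ge_3 by simp
qed

lemma sym_mult_wit:
  assumes "sym_fun n S"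
  shows "S (pt z) * wit z = (\<Sum>w\<in>wperms. S (pt (z \<circ> w)) * Psi (z \<circ> w))"
  using sym_fun_pt_wperm[OF assms] by (simp add: wit_def sum_distrib_left)

lemma lifts_omega_power_full:
  assumes "m > 0" "poly_fun r \<Psi>"
  shows "lifts (\<lambda>z. \<Sum>w\<in>wperms. omega n K (pt (z \<circ> w)) ^ m * \<Psi> (z \<circ> w))"
proof -
  have "poly_fun r (\<lambda>z. omega n K (pt z) ^ (m - 1) * \<Psi> z)"
    by (intro poly_fun_mult poly_fun_power poly_fun_pt poly_fun_omega assms)
  from lifts_omega_full[OF this] have "lifts (\<lambda>z. \<Sum>w\<in>wperms. omega n K (pt (z \<circ> w)) * (omega n K (pt (z \<circ> w)) ^ (m - 1) * \<Psi> (z \<circ> w)))" .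
  moreover have "omega n K x * (omega n K x ^ (m - 1) * y) = omega n K x ^ m * y" for x y
    using assms(1) by (simp add: mult.assoc[symmetric] power_Suc[symmetric] del: power_Suc)
  ultimately show ?thesis by (simp only:)
qed

lemma lifts_theta_top: "lifts (\<lambda>z. theta n r (pt z) * wit z)"
  unfolding sym_mult_wit[OF sym_fun_theta]
  unfolding theta_top_pt
  by (rule lifts_omega_power_full) (use theta_exponent(2)[OF K_strata] r_ge_3 poly_fun_Psi in auto)

lemma strata_second:
  assumes "R \<in> strata n (r - 1)" "K \<subseteq> R"
  obtains i j where "i < r" "j < r" "i \<noteq> j" "R = ker_on n (\<lambda>k. if \<beta> k = j then i else \<beta> k)"
proof -
  obtain f :: "nat \<Rightarrow> nat" where f: "R = ker_on n f" "card (f ` {..<n}) = r - 1"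
    using assms(1) by (auto simp: strata_def)
  obtain h where h: "\<And>k. k < n \<Longrightarrow> h (\<beta> k) = f k"
    using ker_on_factor[of n \<beta> f] assms(2) f by blast
  have "h ` {..<r} = (\<lambda>k. h (\<beta> k)) ` {..<n}" by (simp add: image_\<beta>[symmetric] image_image)
  also have "\<dots> = f ` {..<n}" using h by (intro image_cong) auto
  finally have "card (h ` {..<r}) \<noteq> card {..<r}" using f r_ge_3 by simp
  then have "\<not> inj_on h {..<r}" using card_image by blast
  then obtain i j where ij: "i < r" "j < r" "i \<noteq> j" "h i = h j" by (auto simp: inj_on_def)
  define \<psi> where "\<psi> k = (if \<beta> k = j then i else \<beta> k)" for k
  have h\<psi>: "h (\<psi> k) = f k" if "k < n" for k using h[OF that] ij by (auto simp: \<psi>_def)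
  have "ker_on n \<psi> = R" unfolding f(1)
  proof (rule ker_on_eqI)
    show "ker_on n \<psi> \<subseteq> ker_on n f"
    proof (rule subrelI)
      fix k l assume "(k, l) \<in> ker_on n \<psi>"
      then have kl: "k < n" "l < n" "\<psi> k = \<psi> l" by (auto simp: ker_on_def)
      then show "(k, l) \<in> ker_on n f" using h\<psi>[of k] h\<psi>[of l] by (simp add: ker_on_def)
    qed
    have "\<psi> ` {..<n} \<subseteq> {..<r} - {j}" using \<beta>_less ij by (auto simp: \<psi>_def)
    from card_mono[OF _ this] show "card (\<psi> ` {..<n}) \<le> card (f ` {..<n})"
      using ij by (simp add: f card_Diff_subset)
  qed
  then show ?thesis using that ij unfolding \<psi>_def by blast
qed

text \<open>The stratum merges two blocks. If both lie in the triple, the cusp condition of the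
  quintic applies; otherwise \<open>DT\<close> contains the differences that
  \<open>omega n R\<close> lacks, and \<open>lifts_omega_full\<close> applies.\<close>

lemma lifts_theta_second_term:
  assumes R: "R \<in> strata n (r - 1)" "K \<subseteq> R" and m: "m > 0"
  shows "lifts (\<lambda>z. \<Sum>w\<in>wperms. omega n R (pt (z \<circ> w)) ^ m * Psi (z \<circ> w))"
proof -
  obtain i j where ij: "i < r" "j < r" "i \<noteq> j" and Rij: "R = ker_on n (\<lambda>k. if \<beta> k = j then i else \<beta> k)"
    using strata_second[OF R] by blast
  have swap: "R = ker_on n (\<lambda>k. if \<beta> k = i then j else \<beta> k)"
  proof -
    have "((if x = j then i else x) = (if y = j then i else y))
        = ((if x = i then j else x) = (if y = i then j else y))" for x y :: nat by auto
    then show ?thesis unfolding Rij ker_on_def by (simp only:)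
  qed
  show ?thesis
  proof (cases "i \<in> T \<and> j \<in> T")
    case True
    define u v w where "u = (of_nat (L i1) :: complex)" and "v = (of_nat (L i2) :: complex)"
      and "w = (of_nat (L i3) :: complex)"
    have nz: "u + v \<noteq> 0" "u + w \<noteq> 0" "v + w \<noteq> 0"
      using L_pos[OF i_less(1)] L_pos[OF i_less(2)] L_pos[OF i_less(3)]
      by (auto simp: u_def v_def w_def simp flip: of_nat_add)
    have 12: "lifts (\<lambda>z. \<Sum>w\<in>wperms. omega n (ker_on n (\<lambda>k. if \<beta> k = i2 then i1 else \<beta> k)) (pt (z \<circ> w)) ^ m * Psi (z \<circ> w))"
      by (rule lifts_merged[where c = i3, OF _ _ _ _ _ _ _ _ _ quintic_no_linear_term_12[OF nz(1), unfolded u_def v_def] _ m])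
         (use i_less i_distinct L_distinct L_sep in \<open>auto simp: quin_def\<close>)
    have 13: "lifts (\<lambda>z. \<Sum>w\<in>wperms. omega n (ker_on n (\<lambda>k. if \<beta> k = i3 then i1 else \<beta> k)) (pt (z \<circ> w)) ^ m * Psi (z \<circ> w))"
      by (rule lifts_merged[where c = i2, OF _ _ _ _ _ _ _ _ _ quintic_no_linear_term_13[OF nz(2), of v, unfolded u_def v_def w_def] _ m])
         (use i_less i_distinct L_distinct L_sep in \<open>auto simp: quin_def\<close>)
    have 23: "lifts (\<lambda>z. \<Sum>w\<in>wperms. omega n (ker_on n (\<lambda>k. if \<beta> k = i3 then i2 else \<beta> k)) (pt (z \<circ> w)) ^ m * Psi (z \<circ> w))"
      by (rule lifts_merged[where c = i1, OF _ _ _ _ _ _ _ _ _ quintic_no_linear_term_23[OF nz(3), of u, unfolded u_def v_def w_def] _ m])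
         (use i_less i_distinct L_distinct L_sep in \<open>auto simp: quin_def\<close>)
    consider "i = i1" "j = i2" | "i = i2" "j = i1" | "i = i1" "j = i3" | "i = i3" "j = i1"
      | "i = i2" "j = i3" | "i = i3" "j = i2" using True ij by auto
    then show ?thesis
    proof cases
      case 1 show ?thesis unfolding Rij 1 by (rule 12)
    next
      case 2 show ?thesis unfolding swap 2 by (rule 12)
    next
      case 3 show ?thesis unfolding Rij 3 by (rule 13)
    next
      case 4 show ?thesis unfolding swap 4 by (rule 13)
    next
      case 5 show ?thesis unfolding Rij 5 by (rule 23)
    next
      case 6 show ?thesis unfolding swap 6 by (rule 23)
    qed
  next
    case False
    define rest where "rest x = (\<Prod>(k, l)\<in>off n R \<inter> offT. x k - x l)" for x :: "nat \<Rightarrow> complex"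
    \<comment> \<open>A pair separated by \<open>K\<close> but not by \<open>R\<close> lies in the
      two merged blocks, which are not both in the triple. Hence \<open>omega n R * DT\<close> is a
      multiple of \<open>omega n K\<close>, with the overlap collected in
      \<open>rest\<close>.\<close>
    have un: "off n R \<union> offT = off n K"
    proof
      show "off n R \<union> offT \<subseteq> off n K" using R(2) by (auto simp: offT_def ker_on_def)
      show "off n K \<subseteq> off n R \<union> offT"
      proof (rule subrelI)
        fix k l assume "(k, l) \<in> off n K"
        then have kl: "k < n" "l < n" "\<beta> k \<noteq> \<beta> l" by (auto simp: ker_on_def)
        show "(k, l) \<in> off n R \<union> offT"
        proof (cases "(k, l) \<in> R")
          case True
          then have "{\<beta> k, \<beta> l} = {i, j}" using kl(3) unfolding Rij ker_on_def by (auto split: if_splits)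
          then show ?thesis using kl False unfolding offT_def by (auto simp: doubleton_eq_iff)
        qed (use kl in auto)
      qed
    qed
    have fac: "omega n R x * DT x = omega n K x * rest x" for x
      using prod.union_inter[OF finite_off finite_offT, of "\<lambda>(k, l). x k - x l" n R]
      by (simp add: un omega_def DT_def rest_def)
    have "rest = (\<lambda>x. \<Prod>p\<in>off n R \<inter> offT. x (fst p) - x (snd p))" by (auto simp: rest_def split_def)
    then have prest: "poly_fun n rest"
      by (auto intro!: poly_fun_prod poly_fun_diff poly_fun_coord)
    have "poly_fun r (\<lambda>z. rest (pt z) * (omega n R (pt z) ^ (m - 1) * (DT (pt z) ^ 2 * quin z)))"
      by (intro poly_fun_mult poly_fun_power poly_fun_pt prest poly_fun_omega poly_fun_DT poly_fun_quin)
    from lifts_omega_full[OF this]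
    have "lifts (\<lambda>z. \<Sum>w\<in>wperms. omega n K (pt (z \<circ> w)) *
       (rest (pt (z \<circ> w)) * (omega n R (pt (z \<circ> w)) ^ (m - 1) * (DT (pt (z \<circ> w)) ^ 2 * quin (z \<circ> w)))))" .
    moreover have "omega n K (pt z) * (rest (pt z) * (omega n R (pt z) ^ (m - 1) * (DT (pt z) ^ 2 * quin z)))
        = omega n R (pt z) ^ m * Psi z" for z
    proof -
      have "omega n K (pt z) * (rest (pt z) * (omega n R (pt z) ^ (m - 1) * (DT (pt z) ^ 2 * quin z)))
        = (omega n R (pt z) * DT (pt z)) * (omega n R (pt z) ^ (m - 1) * (DT (pt z) ^ 2 * quin z))"
        unfolding fac by (simp only: mult.assoc)
      also have "\<dots> = omega n R (pt z) ^ Suc (m - 1) * (DT (pt z) ^ Suc 2 * quin z)"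
        by (simp only: power_Suc mult_ac)
      finally show ?thesis using m by (simp add: Psi_def eval_nat_numeral)
    qed
    ultimately show ?thesis by simp
  qed
qed

text \<open>On the image of \<open>pt\<close> only strata that coarsen \<open>K\<close> contribute,
  and each of these is handled by \<open>lifts_theta_second_term\<close>.\<close>

lemma lifts_theta_second: "lifts (\<lambda>z. theta n (r - 1) (pt z) * wit z)"
proof -
  define m where "m R = theta_deg n div card (off n R)" for R
  define S where "S = {R \<in> strata n (r - 1). K \<subseteq> R}"
  have mpos: "m R > 0" if "R \<in> strata n (r - 1)" for R
    unfolding m_def by (rule theta_exponent(2)[OF that]) (use r_ge_3 in simp)
  have eq: "theta n (r - 1) (pt z) = (\<Sum>R\<in>S. omega n R (pt z) ^ m R)" for z
  proof -
    have "theta n (r - 1) (pt z) = (\<Sum>R\<in>strata n (r - 1). omega n R (pt z) ^ m R)"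
    proof -
      have "r - 1 \<noteq> 1" using r_ge_3 by linarith
      then show ?thesis by (simp only: theta_def m_def if_False)
    qed
    also have "\<dots> = (\<Sum>R\<in>S. omega n R (pt z) ^ m R)"
    proof (rule sum.mono_neutral_right[OF finite_strata])
      show "\<forall>R\<in>strata n (r - 1) - S. omega n R (pt z) ^ m R = 0"
      proof
        fix R assume R: "R \<in> strata n (r - 1) - S"
        then obtain f :: "nat \<Rightarrow> nat" where f: "R = ker_on n f" by (auto simp: strata_def)
        have "\<not> K \<subseteq> R" using R by (auto simp: S_def)
        then have "\<not> ker_on n (pt z) \<subseteq> R" using ker_on_pt by blast
        then have "omega n R (pt z) = 0" unfolding f omega_ker_on_eq_0_iff .
        then show "omega n R (pt z) ^ m R = 0" using mpos[of R] R by simp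
      qed
    qed (auto simp: S_def)
    finally show ?thesis .
  qed
  have "theta n (r - 1) (pt z) * wit z
     = (\<Sum>R\<in>S. \<Sum>w\<in>wperms. omega n R (pt (z \<circ> w)) ^ m R * Psi (z \<circ> w))" for z
    unfolding sym_mult_wit[OF sym_fun_theta]
    unfolding eq sum_distrib_right by (rule sum.swap)
  moreover have "lifts (\<lambda>z. \<Sum>R\<in>S. \<Sum>w\<in>wperms. omega n R (pt (z \<circ> w)) ^ m R * Psi (z \<circ> w))"
    by (rule lifts_sum, rule lifts_theta_second_term) (use mpos in \<open>auto simp: S_def\<close>)
  ultimately show ?thesis by (simp only:)
qed

section \<open>Expansion at a triple collision: the witness is not a polynomial in power
  sums\<close>

definition cs :: "complex \<Rightarrow> complex \<Rightarrow> complex \<Rightarrow> nat \<Rightarrow> complex poly" where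
  "cs x y t i = (if i = i1 then [:0, x:] else if i = i2 then [:0, y:] else if i = i3 then [:0, t:]
     else [:of_nat (Suc i):])"

text \<open>At \<open>\<tau> = 0\<close> the three chosen blocks collide at the origin while the
  others rest at distinct nonzero constants, so the low coefficients in \<open>\<tau>\<close> show
  the local structure at a triple collision only.\<close>

definition zs :: "complex \<Rightarrow> complex \<Rightarrow> complex \<Rightarrow> complex \<Rightarrow> nat \<Rightarrow> complex" where
  "zs x y t \<tau> i = poly (cs x y t i) \<tau>"

definition pm :: "complex \<Rightarrow> complex \<Rightarrow> complex \<Rightarrow> nat \<Rightarrow> complex" where
  "pm x y t m = of_nat (L i1) * x ^ m + of_nat (L i2) * y ^ m + of_nat (L i3) * t ^ m"

text \<open>On a slice with vanishing first moment, the products of power sums of degree at most \<open>5\<close> are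
  \<open>1\<close>, \<open>P 2\<close>, \<open>P 3\<close>, \<open>P 4\<close>, \<open>(P 2)\<^sup>2\<close>, \<open>P 5\<close> and \<open>P 2 * P 3\<close>.\<close>
definition moment_coeffs :: "(nat \<Rightarrow> complex) \<Rightarrow> (nat \<Rightarrow> complex) \<Rightarrow> complex poly \<Rightarrow> bool" where
  "moment_coeffs a P B \<longleftrightarrow> coeff B 0 = a 0 \<and> coeff B 1 = 0 \<and> coeff B 2 = a 1 * P 2 \<and>
     coeff B 3 = a 2 * P 3 \<and> coeff B 4 = a 3 * P 4 + a 4 * (P 2)\<^sup>2 \<and>
     coeff B 5 = a 5 * P 5 + a 6 * (P 2 * P 3)"

text \<open>The scalars \<open>a\<close> are chosen before \<open>x y t\<close>. This uniformity
  turns the fifth coefficient into one identity of forms on the whole plane, as required by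
  \<open>quintic_not_moments\<close>.\<close>

lemma psum_alg_slice:
  assumes "psum_alg n G"
  shows "\<exists>a. \<forall>x y t. pm x y t 1 = 0 \<longrightarrow>
     (\<exists>B. (\<forall>\<tau>. G (pt (zs x y t \<tau>)) = poly B \<tau>) \<and> moment_coeffs a (pm x y t) B)"
  using assms
proof induction
  case (const c)
  show ?case
    by (intro exI[of _ "\<lambda>i. if i = 0 then c else 0"] allI impI exI[of _ "[:c:]"])
       (auto simp: moment_coeffs_def eval_nat_numeral)
next
  case (psum m)
  define C where "C = (\<Sum>i\<in>{..<r} - T. of_nat (L i) * of_nat (Suc i) ^ m :: complex)"
  \<comment> \<open>The pairs \<open>(i, m)\<close> record at which index
    \<open>moment_coeffs\<close> lists the single power sum \<open>P m\<close>. For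
    \<open>m = 0\<close> the moving blocks too contribute a constant, their total weight.\<close>
  define a where "a = (\<lambda>i::nat. if i = 0 then C + (if m = 0 then of_nat (L i1 + L i2 + L i3) else 0)
     else if (i, m) \<in> {(1, 2), (2, 3), (3, 4), (5, 5)} then 1 else 0 :: complex)"
  show ?case
  proof (intro exI[of _ a] allI impI)
    fix x y t assume p1: "pm x y t 1 = 0"
    have "(\<Sum>k<n. pt (zs x y t \<tau>) k ^ m) = poly ([:C:] + monom (pm x y t m) m) \<tau>" for \<tau>
    proof -
      have "{..<r} = ({..<r} - T) \<union> T" using i_less by auto
      then have "(\<Sum>i<r. of_nat (L i) * zs x y t \<tau> i ^ m)
          = (\<Sum>i\<in>{..<r} - T. of_nat (L i) * zs x y t \<tau> i ^ m) + (\<Sum>i\<in>T. of_nat (L i) * zs x y t \<tau> i ^ m)"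
        using sum.union_disjoint[of "{..<r} - T" T "\<lambda>i. of_nat (L i) * zs x y t \<tau> i ^ m"] by auto
      also have "(\<Sum>i\<in>{..<r} - T. of_nat (L i) * zs x y t \<tau> i ^ m) = C"
        unfolding C_def by (intro sum.cong) (auto simp: zs_def cs_def)
      also have "(\<Sum>i\<in>T. of_nat (L i) * zs x y t \<tau> i ^ m) = pm x y t m * \<tau> ^ m"
        using i_distinct by (simp add: zs_def cs_def pm_def power_mult_distrib algebra_simps)
      finally show ?thesis using sum_pt[of "\<lambda>y. y ^ m" "zs x y t \<tau>"] by (simp add: poly_monom)
    qed
    moreover have "moment_coeffs a (pm x y t) ([:C:] + monom (pm x y t m) m)"
      using p1 by (auto simp: moment_coeffs_def a_def coeff_pCons pm_def split: nat.splits)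
    ultimately show "\<exists>B. (\<forall>\<tau>. (\<Sum>k<n. pt (zs x y t \<tau>) k ^ m) = poly B \<tau>) \<and> moment_coeffs a (pm x y t) B"
      by blast
  qed
next
  case (add F G)
  then obtain a b where a: "\<And>x y t. pm x y t 1 = 0 \<Longrightarrow>
      (\<exists>B. (\<forall>\<tau>. F (pt (zs x y t \<tau>)) = poly B \<tau>) \<and> moment_coeffs a (pm x y t) B)"
    and b: "\<And>x y t. pm x y t 1 = 0 \<Longrightarrow>
      (\<exists>B. (\<forall>\<tau>. G (pt (zs x y t \<tau>)) = poly B \<tau>) \<and> moment_coeffs b (pm x y t) B)" by blast
  show ?case
  proof (intro exI[of _ "\<lambda>i. a i + b i"] allI impI)
    fix x y t assume p1: "pm x y t 1 = 0"
    obtain A B where "\<And>\<tau>. F (pt (zs x y t \<tau>)) = poly A \<tau>" "moment_coeffs a (pm x y t) A"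
      "\<And>\<tau>. G (pt (zs x y t \<tau>)) = poly B \<tau>" "moment_coeffs b (pm x y t) B"
      using a[OF p1] b[OF p1] by blast
    then show "\<exists>B. (\<forall>\<tau>. F (pt (zs x y t \<tau>)) + G (pt (zs x y t \<tau>)) = poly B \<tau>) \<and>
        moment_coeffs (\<lambda>i. a i + b i) (pm x y t) B"
      by (intro exI[of _ "A + B"]) (auto simp: moment_coeffs_def algebra_simps)
  qed
next
  case (mult F G)
  then obtain a b where a: "\<And>x y t. pm x y t 1 = 0 \<Longrightarrow>
      (\<exists>B. (\<forall>\<tau>. F (pt (zs x y t \<tau>)) = poly B \<tau>) \<and> moment_coeffs a (pm x y t) B)"
    and b: "\<And>x y t. pm x y t 1 = 0 \<Longrightarrow>
      (\<exists>B. (\<forall>\<tau>. G (pt (zs x y t \<tau>)) = poly B \<tau>) \<and> moment_coeffs b (pm x y t) B)" by blast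
  \<comment> \<open>The product truncated at degree five; the vanishing linear coefficients leave
    only these mixed terms.\<close>
  define c where "c = (\<lambda>i. [a 0 * b 0, a 0 * b 1 + a 1 * b 0, a 0 * b 2 + a 2 * b 0, a 0 * b 3 + a 3 * b 0,
     a 0 * b 4 + a 4 * b 0 + a 1 * b 1, a 0 * b 5 + a 5 * b 0, a 0 * b 6 + a 6 * b 0 + a 1 * b 2 + a 2 * b 1] ! i)"
  show ?case
  proof (intro exI[of _ c] allI impI)
    fix x y t assume p1: "pm x y t 1 = 0"
    obtain A B where "\<And>\<tau>. F (pt (zs x y t \<tau>)) = poly A \<tau>" and A: "moment_coeffs a (pm x y t) A"
      and "\<And>\<tau>. G (pt (zs x y t \<tau>)) = poly B \<tau>" and B: "moment_coeffs b (pm x y t) B"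
      using a[OF p1] b[OF p1] by blast
    moreover have "moment_coeffs c (pm x y t) (A * B)"
    proof -
      have "coeff (A * B) 0 = coeff A 0 * coeff B 0"
        "coeff (A * B) 1 = coeff A 0 * coeff B 1 + coeff A 1 * coeff B 0"
        "coeff (A * B) 2 = coeff A 0 * coeff B 2 + coeff A 1 * coeff B 1 + coeff A 2 * coeff B 0"
        "coeff (A * B) 3 = coeff A 0 * coeff B 3 + coeff A 1 * coeff B 2 + coeff A 2 * coeff B 1 + coeff A 3 * coeff B 0"
        "coeff (A * B) 4 = coeff A 0 * coeff B 4 + coeff A 1 * coeff B 3 + coeff A 2 * coeff B 2 + coeff A 3 * coeff B 1
           + coeff A 4 * coeff B 0"
        "coeff (A * B) 5 = coeff A 0 * coeff B 5 + coeff A 1 * coeff B 4 + coeff A 2 * coeff B 3 + coeff A 3 * coeff B 2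
           + coeff A 4 * coeff B 1 + coeff A 5 * coeff B 0"
        by (simp_all add: coeff_mult eval_nat_numeral)
      then show ?thesis using A B
        unfolding moment_coeffs_def c_def by (simp add: algebra_simps power2_eq_square)
    qed
    ultimately show "\<exists>B. (\<forall>\<tau>. F (pt (zs x y t \<tau>)) * G (pt (zs x y t \<tau>)) = poly B \<tau>) \<and>
        moment_coeffs c (pm x y t) B"
      by (intro exI[of _ "A * B"]) auto
  qed
qed

definition stabT :: "(nat \<Rightarrow> nat) set" where "stabT = {w \<in> wperms. w ` T = T}"

definition slice_DT :: "complex \<Rightarrow> complex \<Rightarrow> complex \<Rightarrow> (nat \<Rightarrow> nat) \<Rightarrow> complex poly" where
  "slice_DT x y t w = (\<Prod>(k, l)\<in>offT. cs x y t (w (\<beta> k)) - cs x y t (w (\<beta> l)))"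

lemma poly_slice_DT: "poly (slice_DT x y t w) \<tau> = DT (pt (zs x y t \<tau> \<circ> w))"
  unfolding slice_DT_def DT_def poly_prod
  by (intro prod.cong) (auto simp: offT_def pt_def zs_def)

lemma DT_stabT:
  assumes "w \<in> stabT"
  shows "DT (pt (z \<circ> w)) = DT (pt z)"
proof -
  have w: "w \<in> wperms" "w ` T = T" using assms by (auto simp: stabT_def)
  obtain \<sigma> where s: "\<sigma> permutes {..<n}" "\<And>k. k < n \<Longrightarrow> w (\<beta> k) = \<beta> (\<sigma> k)"
    using wperms_lift[OF w(1)] by blast
  have inj: "inj w" using permutes_inj[OF wperms_permutes[OF w(1)]] .
  have wT: "w x \<in> T \<longleftrightarrow> x \<in> T" for x
    using inj_image_mem_iff[OF inj, of x T] unfolding w(2) .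
  have "DT (pt z \<circ> \<sigma>) = DT (pt z)"
    unfolding DT_def
  proof (rule prod_pairs_permute[OF finite_offT s(1)])
    fix k l assume "(k, l) \<in> offT"
    then have kl: "k < n" "l < n" "\<beta> k \<noteq> \<beta> l" "\<not> (\<beta> k \<in> T \<and> \<beta> l \<in> T)" by (auto simp: offT_def)
    have "\<sigma> k < n" "\<sigma> l < n" using permutes_in_image[OF s(1)] kl by auto
    moreover have "\<beta> (\<sigma> k) \<noteq> \<beta> (\<sigma> l)"
      unfolding s(2)[OF kl(1), symmetric] s(2)[OF kl(2), symmetric] inj_eq[OF inj] by (rule kl(3))
    moreover have "\<not> (\<beta> (\<sigma> k) \<in> T \<and> \<beta> (\<sigma> l) \<in> T)"
      unfolding s(2)[OF kl(1), symmetric] s(2)[OF kl(2), symmetric] wT by (rule kl(4))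
    ultimately show "(\<sigma> k, \<sigma> l) \<in> offT" unfolding offT_def by blast
  qed
  then show ?thesis using pt_comp_wperm[OF s] by simp
qed

lemma stabT_fixes:
  assumes "w \<in> stabT"
  shows "w i1 = i1" "w i2 = i2" "w i3 = i3"
proof -
  have w: "w \<in> wperms" "w ` T = T" using assms by (auto simp: stabT_def)
  have "w i1 \<in> T" "w i2 \<in> T" "w i3 \<in> T" using w(2) by blast+
  moreover have "L (w i1) = L i1" "L (w i2) = L i2" "L (w i3) = L i3"
    using wperms_L[OF w(1)] i_less by auto
  ultimately show "w i1 = i1" "w i2 = i2" "w i3 = i3" using L_distinct by auto
qed

text \<open>If \<open>w\<close> moves the triple, some block outside it is sent into it, and so is a
  second block. Their values both vanish at \<open>\<tau> = 0\<close>, while their difference is a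
  factor of \<open>DT\<close>; it occurs in both orders, whence order two.\<close>

lemma slice_DT_divisible:
  assumes "w \<in> wperms" "w \<notin> stabT"
  obtains A where "slice_DT x y t w = monom 1 2 * A"
proof -
  have p: "w permutes {..<r}" using wperms_permutes[OF assms(1)] .
  have "w ` T \<noteq> T" using assms by (simp add: stabT_def)
  have inj: "inj w" using permutes_inj[OF p] .
  define V where "V = w -` T"
  have VT: "w ` V = T" using permutes_surj[OF p] by (auto simp: V_def)
  have cV: "card V = 3" using card_image[of w V] inj_on_subset[OF inj] VT i_distinct by simp
  have "V \<noteq> T" using VT \<open>w ` T \<noteq> T\<close> by auto
  moreover have "card T = 3" using i_distinct by simp
  ultimately have "\<not> V \<subseteq> T" using card_subset_eq[of T V] cV by auto
  then obtain a where a: "a \<in> V" "a \<notin> T" by blast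
  have "V \<noteq> {a}" using cV by auto
  then obtain b where b: "b \<in> V" "b \<noteq> a" using a by blast
  have "w a < r" "w b < r" using a b i_less by (auto simp: V_def)
  then have "a < r" "b < r" using wperms_less[OF assms(1)] by auto
  then obtain k l where kl: "k < n" "\<beta> k = a" "l < n" "\<beta> l = b" using fibre_ex by meson
  have off: "(k, l) \<in> offT" "(l, k) \<in> offT" using kl a b by (auto simp: offT_def)
  define g where "g p = cs x y t (w (\<beta> (fst p))) - cs x y t (w (\<beta> (snd p)))" for p
  define A' where "A' = (\<Prod>p\<in>offT - {(k, l)} - {(l, k)}. g p)"
  have "\<exists>s. cs x y t i = [:0, s:]" if "i \<in> T" for i using that by (auto simp: cs_def)
  then obtain s s' where s: "cs x y t (w a) = [:0, s:]" "cs x y t (w b) = [:0, s':]"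
    using a b unfolding V_def by blast
  have "g (k, l) * g (l, k) = monom 1 2 * [:- (s - s')\<^sup>2:]"
    unfolding g_def fst_conv snd_conv kl s
    by (simp add: monom_altdef power2_eq_square algebra_simps)
  moreover have "slice_DT x y t w = g (k, l) * (g (l, k) * A')"
  proof -
    have "slice_DT x y t w = (\<Prod>p\<in>offT. g p)" by (simp add: slice_DT_def g_def split_def)
    also have "\<dots> = g (k, l) * (\<Prod>p\<in>offT - {(k, l)}. g p)"
      by (rule prod.remove[OF finite_offT off(1)])
    also have "(\<Prod>p\<in>offT - {(k, l)}. g p) = g (l, k) * A'"
      unfolding A'_def by (rule prod.remove) (use finite_offT off kl b in auto)
    finally show ?thesis .
  qed
  ultimately have "slice_DT x y t w = monom 1 2 * ([:- (s - s')\<^sup>2:] * A')"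
    by (metis mult.assoc)
  then show ?thesis by (rule that)
qed

text \<open>Summands with \<open>w\<close> in \<open>stabT\<close> fix the three indices, because
  the three sizes differ. Each contributes the quintic times the nonzero value of
  \<open>DT ^ 3\<close> at the collision point. All other summands have order at least six and leave
  the coefficient at five unchanged, so no cancellation can occur.\<close>

lemma wit_slice:
  "\<exists>\<kappa>. \<kappa> \<noteq> 0 \<and> (\<forall>x y t. \<exists>W. (\<forall>\<tau>. wit (zs x y t \<tau>) = poly W \<tau>) \<and>
     coeff W 5 = \<kappa> * quintic (of_nat (L i1)) (of_nat (L i2)) x y t)"
proof -
  define \<zeta> where "\<zeta> i = (if i \<in> T then 0 else of_nat (Suc i) :: complex)" for i
  define \<kappa> where "\<kappa> = of_nat (card stabT) * DT (pt \<zeta>) ^ 3"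
  have fin: "finite stabT" unfolding stabT_def using finite_wperms by simp
  have "id \<in> stabT" using wperms_id by (simp add: stabT_def)
  then have "card stabT \<noteq> 0" using fin by auto
  moreover have "DT (pt \<zeta>) \<noteq> 0"
  proof -
    have "pt \<zeta> k - pt \<zeta> l \<noteq> 0" if "(k, l) \<in> offT" for k l
    proof -
      have kl: "k < n" "l < n" "\<beta> k \<noteq> \<beta> l" "\<not> (\<beta> k \<in> T \<and> \<beta> l \<in> T)" using that by (auto simp: offT_def)
      have "\<zeta> (\<beta> k) \<noteq> \<zeta> (\<beta> l)"
      proof (cases "\<beta> k \<in> T")
        case True
        then have "\<zeta> (\<beta> k) = 0" "\<zeta> (\<beta> l) = of_nat (Suc (\<beta> l))" using kl(4) by (auto simp: \<zeta>_def)
        then show ?thesis by (simp del: of_nat_Suc)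
      next
        case False
        then have k: "\<zeta> (\<beta> k) = of_nat (Suc (\<beta> k))" by (simp add: \<zeta>_def del: of_nat_Suc)
        show ?thesis
        proof (cases "\<beta> l \<in> T")
          case True
          then have "\<zeta> (\<beta> l) = 0" by (simp add: \<zeta>_def)
          then show ?thesis unfolding k by (simp del: of_nat_Suc)
        next
          case False
          then have "\<zeta> (\<beta> l) = of_nat (Suc (\<beta> l))" by (simp add: \<zeta>_def del: of_nat_Suc)
          then show ?thesis unfolding k using kl(3) by (simp del: of_nat_Suc)
        qed
      qed
      then show ?thesis using kl by (simp add: pt_def)
    qed
    then show ?thesis unfolding DT_def using finite_offT by auto
  qed
  ultimately have "\<kappa> \<noteq> 0" by (simp add: \<kappa>_def)
  moreover have "\<exists>W. (\<forall>\<tau>. wit (zs x y t \<tau>) = poly W \<tau>) \<and>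
     coeff W 5 = \<kappa> * quintic (of_nat (L i1)) (of_nat (L i2)) x y t" for x y t
  proof -
    define q where "q = quintic (of_nat (L i1)) (of_nat (L i2)) x y t"
    have "\<exists>W. (\<forall>\<tau>. Psi (zs x y t \<tau> \<circ> w) = poly W \<tau>) \<and>
        coeff W 5 = (if w \<in> stabT then DT (pt \<zeta>) ^ 3 * q else 0)" if w: "w \<in> wperms" for w
    proof (cases "w \<in> stabT")
      case True
      have "quin (zs x y t \<tau> \<circ> w) = quin (\<lambda>i. \<tau> * (if i = i1 then x else if i = i2 then y else t))" for \<tau>
        unfolding quin_def using stabT_fixes[OF True] i_distinct
        by (simp add: zs_def cs_def)
      also have "quin (\<lambda>i. \<tau> * (if i = i1 then x else if i = i2 then y else t)) = \<tau> ^ 5 * q" for \<tau>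
        unfolding quin_scale unfolding quin_def q_def using i_distinct by simp
      finally have "Psi (zs x y t \<tau> \<circ> w) = poly (slice_DT x y t w ^ 3 * monom q 5) \<tau>" for \<tau>
        by (simp add: Psi_def poly_slice_DT poly_monom)
      moreover have "coeff (slice_DT x y t w ^ 3 * monom q 5) 5 = DT (pt \<zeta>) ^ 3 * q"
      proof -
        have z0: "zs x y t 0 = \<zeta>" by (auto simp: zs_def cs_def \<zeta>_def)
        have "coeff (slice_DT x y t w ^ 3 * monom q 5) 5 = coeff (slice_DT x y t w ^ 3) 0 * q"
          by (subst mult.commute) (simp add: coeff_monom_mult)
        also have "coeff (slice_DT x y t w ^ 3) 0 = DT (pt \<zeta>) ^ 3"
          unfolding poly_0_coeff_0[symmetric] poly_power poly_slice_DT z0 DT_stabT[OF True] ..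
        finally show ?thesis .
      qed
      ultimately show ?thesis using True
        by (intro exI[of _ "slice_DT x y t w ^ 3 * monom q 5"] conjI allI) simp_all
    next
      case False
      obtain A where A: "slice_DT x y t w = monom 1 2 * A" using slice_DT_divisible[OF w False] by blast
      obtain Q where Q: "\<And>\<tau>. quin (\<lambda>i. poly (cs x y t (w i)) \<tau>) = poly Q \<tau>"
        using poly_fun_comp_poly[OF poly_fun_quin, of "\<lambda>i. cs x y t (w i)"] by blast
      have "Psi (zs x y t \<tau> \<circ> w) = poly (slice_DT x y t w ^ 3 * Q) \<tau>" for \<tau>
        using Q[of \<tau>] by (simp add: Psi_def poly_slice_DT comp_def zs_def)
      moreover have "coeff (slice_DT x y t w ^ 3 * Q) 5 = 0"
      proof -
        have "slice_DT x y t w ^ 3 * Q = monom 1 6 * (A ^ 3 * Q)"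
          unfolding A by (simp add: power_mult_distrib monom_power mult.assoc)
        then show ?thesis by (simp only:) (simp add: coeff_monom_mult)
      qed
      ultimately show ?thesis using False
        by (intro exI[of _ "slice_DT x y t w ^ 3 * Q"] conjI allI) simp_all
    qed
    then obtain W where W: "\<And>w \<tau>. w \<in> wperms \<Longrightarrow> Psi (zs x y t \<tau> \<circ> w) = poly (W w) \<tau>"
      "\<And>w. w \<in> wperms \<Longrightarrow> coeff (W w) 5 = (if w \<in> stabT then DT (pt \<zeta>) ^ 3 * q else 0)"
      by metis
    have "coeff (\<Sum>w\<in>wperms. W w) 5 = (\<Sum>w\<in>wperms. if w \<in> stabT then DT (pt \<zeta>) ^ 3 * q else 0)"
      unfolding coeff_sum using W(2) by (intro sum.cong) auto
    also have "\<dots> = (\<Sum>w\<in>stabT. DT (pt \<zeta>) ^ 3 * q)"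
      using finite_wperms by (intro sum.mono_neutral_cong_right) (auto simp: stabT_def)
    also have "\<dots> = \<kappa> * q" by (simp add: \<kappa>_def)
    finally have "coeff (\<Sum>w\<in>wperms. W w) 5 = \<kappa> * q" .
    moreover have "wit (zs x y t \<tau>) = poly (\<Sum>w\<in>wperms. W w) \<tau>" for \<tau>
      using W(1) by (simp add: wit_def poly_sum)
    ultimately show ?thesis unfolding q_def by blast
  qed
  ultimately show ?thesis by blast
qed

lemma wit_not_psum_alg:
  assumes "psum_alg n G"
  shows "\<exists>z. wit z \<noteq> G (pt z)"
proof (rule ccontr)
  assume "\<not> ?thesis"
  then have eq: "wit z = G (pt z)" for z by blast
  obtain a where a: "\<And>x y t. pm x y t 1 = 0 \<Longrightarrow>
     (\<exists>B. (\<forall>\<tau>. G (pt (zs x y t \<tau>)) = poly B \<tau>) \<and> moment_coeffs a (pm x y t) B)"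
    using psum_alg_slice[OF assms] by blast
  obtain \<kappa> where \<kappa>: "\<kappa> \<noteq> 0" "\<And>x y t. \<exists>W. (\<forall>\<tau>. wit (zs x y t \<tau>) = poly W \<tau>) \<and>
     coeff W 5 = \<kappa> * quintic (of_nat (L i1)) (of_nat (L i2)) x y t"
    using wit_slice by blast
  have key: "\<kappa> * quintic (of_nat (L i1)) (of_nat (L i2)) x y t
      = a 5 * pm x y t 5 + a 6 * (pm x y t 2 * pm x y t 3)" if p1: "pm x y t 1 = 0" for x y t
  proof -
    obtain B W where B: "\<And>\<tau>. G (pt (zs x y t \<tau>)) = poly B \<tau>" "moment_coeffs a (pm x y t) B"
      and W: "\<And>\<tau>. wit (zs x y t \<tau>) = poly W \<tau>"
        "coeff W 5 = \<kappa> * quintic (of_nat (L i1)) (of_nat (L i2)) x y t"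
      using a[OF p1] \<kappa>(2)[of x y t] by blast
    have "poly W = poly B" using eq B(1) W(1) by auto
    then have "W = B" by (simp add: poly_eq_poly_eq_iff)
    then show ?thesis using B(2) W(2) by (simp add: moment_coeffs_def)
  qed
  have "\<kappa> = 0"
  proof (rule quintic_not_moments[of "of_nat (L i1)" "of_nat (L i2)" "of_nat (L i3)" \<kappa> "a 5" "a 6"])
    show "\<kappa> * quintic (of_nat (L i1)) (of_nat (L i2)) x y t =
       a 5 * (of_nat (L i1) * x ^ 5 + of_nat (L i2) * y ^ 5 + of_nat (L i3) * t ^ 5) +
       a 6 * ((of_nat (L i1) * x\<^sup>2 + of_nat (L i2) * y\<^sup>2 + of_nat (L i3) * t\<^sup>2) *
         (of_nat (L i1) * x ^ 3 + of_nat (L i2) * y ^ 3 + of_nat (L i3) * t ^ 3))"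
      if "of_nat (L i1) * x + of_nat (L i2) * y + of_nat (L i3) * t = 0" for x y t
      using key[of x y t] that by (simp add: pm_def)
  qed (use L_pos[OF i_less(1)] L_pos[OF i_less(2)] L_pos[OF i_less(3)] L_distinct
        L_sep(2)[OF i_less(2)] L_sep(3)[OF i_less(1)] in \<open>simp_all flip: of_nat_add\<close>)
  then show False using \<kappa>(1) by simp
qed

text \<open>Along rays through the origin, the component of degree \<open>theta_deg n\<close> plus
  the degree of \<open>wit\<close> loses all high powers and retains one homogeneous component of
  \<open>b\<close>, a polynomial in power sums. As \<open>theta n r\<close> is not identically zero
  on the irreducible parameter space it cancels, and \<open>wit\<close> equals that component,
  against \<open>wit_not_psum_alg\<close>.\<close>

lemma no_equation:
  assumes g: "\<And>z. g (pt z) = theta n r (pt z) * wit z"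
    and b: "poly_fun n b" "sym_fun n b"
    and v: "\<And>j. poly_fun n (v j)"
    and e: "\<And>j. j \<in> J \<Longrightarrow> e j \<ge> card offT * 3 + 7"
    and J: "\<And>j. j \<in> J \<Longrightarrow> j \<ge> 1"
    and eq: "\<And>z. g (pt z) = theta n r (pt z) * b (pt z) + (\<Sum>j\<in>J. theta n j (pt z) ^ e j * v j (pt z))"
  shows False
proof -
  define M where "M = theta_deg n"
  define df where "df = card offT * 3 + 5"
  have M: "M \<ge> 1" by (simp add: M_def theta_deg_def Suc_le_eq)
  obtain B where B: "\<And>i. psum_alg n (B i)"
    "\<And>x. \<exists>P. (\<forall>t. b (\<lambda>k. t * x k) = poly P t) \<and> (\<forall>i. coeff P i = B i x)"
    using psum_alg_graded[OF psum_alg_sym_poly_fun[OF b]] by blast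
  have main: "theta n r (pt z) * (wit z - B df (pt z)) = 0" for z
  proof -
    define x where "x = pt z"
    obtain P where P: "\<And>t. b (\<lambda>k. t * x k) = poly P t" "\<And>i. coeff P i = B i x" using B(2)[of x] by blast
    have "\<exists>V. \<forall>t. v j (\<lambda>k. t * x k) = poly V t" for j
      using poly_fun_comp_poly[OF v[of j], of "\<lambda>k. [:0, x k:]"] by simp
    then obtain V where V: "\<And>j t. v j (\<lambda>k. t * x k) = poly (V j) t" by metis
    have "poly (monom (theta n r x * wit z) (M + df)) t
        = poly (monom (theta n r x) M * P + (\<Sum>j\<in>J. monom (theta n j x ^ e j) (M * e j) * V j)) t" for t
    proof -
      have th: "theta n j (\<lambda>k. t * x k) = t ^ M * theta n j x" if "j \<ge> 1" for j
        using theta_scale[OF that] by (simp add: M_def)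
      have r1: "1 \<le> r" using r_ge_3 by simp
      have "t ^ M * theta n r x * (t ^ df * wit z)
         = t ^ M * theta n r x * poly P t + (\<Sum>j\<in>J. (t ^ M * theta n j x) ^ e j * poly (V j) t)"
        using g[of "\<lambda>k. t * z k"] eq[of "\<lambda>k. t * z k"]
        unfolding pt_scale x_def[symmetric] th[OF r1] P(1) V wit_scale df_def[symmetric]
        using th J by (simp cong: sum.cong)
      then show ?thesis
        by (simp add: poly_monom poly_sum power_add power_mult power_mult_distrib mult_ac)
    qed
    then have "poly (monom (theta n r x * wit z) (M + df))
        = poly (monom (theta n r x) M * P + (\<Sum>j\<in>J. monom (theta n j x ^ e j) (M * e j) * V j))" by blast
    then have "monom (theta n r x * wit z) (M + df)
        = monom (theta n r x) M * P + (\<Sum>j\<in>J. monom (theta n j x ^ e j) (M * e j) * V j)"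
      by (simp only: poly_eq_poly_eq_iff)
    then have "coeff (monom (theta n r x * wit z) (M + df)) (M + df)
        = coeff (monom (theta n r x) M * P + (\<Sum>j\<in>J. monom (theta n j x ^ e j) (M * e j) * V j)) (M + df)"
      by simp
    moreover have "coeff (monom (theta n j x ^ e j) (M * e j) * V j) (M + df) = 0" if "j \<in> J" for j
    proof -
      \<comment> \<open>From \<open>e j \<ge> df + 2\<close> every summand starts in degree at least
        \<open>M * (df + 2)\<close>, which is above \<open>M + df\<close>.\<close>
      have "df \<le> M * df" using mult_le_mono1[OF M, of df] by linarith
      then have "M + df < M * (df + 2)" unfolding distrib_left using M by linarith
      also have "\<dots> \<le> M * e j" using e[OF that] by (simp add: df_def)
      finally show ?thesis by (simp add: coeff_monom_mult)
    qed
    ultimately have "theta n r x * wit z = theta n r x * B df x"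
      by (simp add: coeff_sum coeff_monom_mult P(2))
    then show ?thesis by (simp add: x_def algebra_simps)
  qed
  have pw: "poly_fun r wit"
  proof -
    have "poly_fun r (\<lambda>z. Psi (z \<circ> w))" if "w \<in> wperms" for w
      by (rule poly_fun_compose_permutes[OF poly_fun_Psi wperms_permutes[OF that]])
    then show ?thesis unfolding wit_def[abs_def] by (rule poly_fun_sum)
  qed
  have "poly_fun r (\<lambda>z. B df (pt z))" by (rule poly_fun_pt[OF poly_fun_psum_alg[OF B(1)]])
  have "(\<forall>z\<in>UNIV. theta n r (pt z) = 0) \<or> (\<forall>z\<in>UNIV. wit z - B df (pt z) = 0)"
    by (rule poly_fun_mult_eq_0[of r])
       (auto intro!: poly_fun_pt poly_fun_theta poly_fun_diff pw \<open>poly_fun r (\<lambda>z. B df (pt z))\<close> simp: main[simplified])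
  moreover have "theta n r (pt of_nat) \<noteq> 0"
  proof (rule theta_neq_0)
    have "pt of_nat ` {..<n} = of_nat ` \<beta> ` {..<n}" by (auto simp: pt_def image_iff)
    then show "card (pt of_nat ` {..<n}) = r"
      by (simp add: image_\<beta> card_image inj_on_def)
  qed (use r_ge_3 in simp)
  ultimately have "wit z = B df (pt z)" for z by auto
  then show False using wit_not_psum_alg[OF B(1)[of df]] by blast
qed

section \<open>The arrangement in block coordinates\<close>

definition XX :: "(nat \<Rightarrow> complex) set" where
  "XX = {pt z \<circ> \<sigma> | z \<sigma>. \<sigma> permutes {..<n}}"

lemma pt_XX: "pt z \<in> XX"
  unfolding XX_def using permutes_id[of "{..<n}"] by (intro CollectI exI[of _ z] exI[of _ id]) auto

lemma sym_eq_XX: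
  assumes "sym_fun n f" "sym_fun n g" "\<And>z. f (pt z) = g (pt z)" "x \<in> XX"
  shows "f x = g x"
  using assms by (auto simp: XX_def sym_fun_def)

lemma X_permute: "x \<in> XX \<Longrightarrow> \<sigma> permutes {..<n} \<Longrightarrow> x \<circ> \<sigma> \<in> XX"
proof -
  assume "x \<in> XX" and s: "\<sigma> permutes {..<n}"
  then obtain z \<tau> where x: "x = pt z \<circ> \<tau>" "\<tau> permutes {..<n}" by (auto simp: XX_def)
  have "x \<circ> \<sigma> = pt z \<circ> (\<tau> \<circ> \<sigma>)" by (simp add: x(1) o_assoc)
  then show "x \<circ> \<sigma> \<in> XX" unfolding XX_def using permutes_compose[OF s x(2)] by blast
qed

lemma card_XX:
  assumes "x \<in> XX"
  shows "card (x ` {..<n}) \<le> r"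
proof -
  obtain z \<sigma> where x: "x = pt z \<circ> \<sigma>" "\<sigma> permutes {..<n}" using assms by (auto simp: XX_def)
  have "x ` {..<n} = pt z ` {..<n}"
    unfolding x(1) image_comp[symmetric] permutes_image[OF x(2)] ..
  also have "card (pt z ` {..<n}) \<le> card (\<beta> ` {..<n})"
    by (rule card_image_mono_ker_on[OF ker_on_pt])
  finally show ?thesis by (simp add: image_\<beta>)
qed

end

section \<open>Regular sequences in rings of polynomial functions on the arrangement\<close>

text \<open>One setting for all polynomial functions and for the symmetric ones. Computations take
  place with global representatives in \<open>C\<close>, where ordinary ring arithmetic is
  available. The condition \<open>retract\<close> moves polynomial coefficients over symmetric
  elements into \<open>C\<close>: trivially in the first case, by averaging in the second.\<close>

locale fun_subring = triple +
  fixes C :: "((nat \<Rightarrow> complex) \<Rightarrow> complex) set"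
  assumes subring: "subring_set C"
    and C_poly: "p \<in> C \<Longrightarrow> poly_fun n p"
    and C_sym: "poly_fun n p \<Longrightarrow> sym_fun n p \<Longrightarrow> p \<in> C"
    and retract: "a \<in> C \<Longrightarrow> (\<And>j. poly_fun n (c j)) \<Longrightarrow> (\<And>j. sym_fun n (th j)) \<Longrightarrow>
      (\<And>x. x \<in> XX \<Longrightarrow> a x = (\<Sum>j\<in>(J :: nat set). th j x * c j x)) \<Longrightarrow>
      \<exists>c'. (\<forall>j. c' j \<in> C) \<and> (\<forall>x\<in>XX. a x = (\<Sum>j\<in>J. th j x * c' j x))"
begin

section \<open>Transfer between the ring of restrictions and its representatives\<close>

abbreviation res :: "((nat \<Rightarrow> complex) \<Rightarrow> complex) \<Rightarrow> (nat \<Rightarrow> complex) \<Rightarrow> complex" where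
  "res p \<equiv> restrict p XX"

abbreviation R :: "((nat \<Rightarrow> complex) \<Rightarrow> complex) ring" where
  "R \<equiv> fun_ring XX {restrict p XX | p. p \<in> C}"

sublocale C: subring_set C by (rule subring)

lemma const_C: "(\<lambda>_. c) \<in> C"
  by (rule C_sym) (auto simp: sym_fun_def intro: poly_fun_const)

lemma res_eq_iff: "res p = res q \<longleftrightarrow> (\<forall>x\<in>XX. p x = q x)"
  by (auto simp: restrict_def fun_eq_iff)

lemma carrier_R: "carrier R = res ` C" by (auto simp: fun_ring_def)

lemma res_carrier: "p \<in> C \<Longrightarrow> res p \<in> carrier R" by (auto simp: carrier_R)

lemma R_mult: "res p \<otimes>\<^bsub>R\<^esub> res q = res (p * q)"
  by (auto simp: fun_ring_def intro!: restrict_ext)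

lemma R_add: "res p \<oplus>\<^bsub>R\<^esub> res q = res (p + q)"
  by (auto simp: fun_ring_def intro!: restrict_ext)

lemma R_zero: "\<zero>\<^bsub>R\<^esub> = res 0"
  by (auto simp: fun_ring_def zero_fun_def)

lemma R_one: "\<one>\<^bsub>R\<^esub> = res 1"
  by (auto simp: fun_ring_def one_fun_def)

lemma ideal_res:
  assumes cr: "cring R" and A: "C.ideal_of A"
  shows "ideal (res ` A) R"
proof -
  interpret cring R by (rule cr)
  have AC: "A \<subseteq> C" using C.ideal_ofD(4)[OF A] by blast
  show ?thesis
  proof (rule idealI)
    show "ring R" by (rule ring_axioms)
    show "subgroup (res ` A) (add_monoid R)"
    proof (rule add.subgroupI)
      show "res ` A \<subseteq> carrier R" using AC by (auto simp: carrier_R)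
      show "res ` A \<noteq> {}" using C.ideal_ofD(1)[OF A] by blast
      fix f assume "f \<in> res ` A"
      then obtain p where p: "p \<in> A" "f = res p" by blast
      have "res (- p) \<oplus>\<^bsub>R\<^esub> res p = \<zero>\<^bsub>R\<^esub>" by (simp add: R_add R_zero)
      then have "\<ominus>\<^bsub>R\<^esub> res p = res (- p)"
        using p AC C.uminus_closed by (intro minus_equality) (auto intro!: res_carrier)
      then show "\<ominus>\<^bsub>R\<^esub> f \<in> res ` A" using p C.ideal_of_uminus[OF A] by auto
    next
      fix f g assume "f \<in> res ` A" "g \<in> res ` A"
      then show "f \<oplus>\<^bsub>R\<^esub> g \<in> res ` A" using C.ideal_ofD(2)[OF A] by (auto simp: R_add)
    qed
    fix a x assume "a \<in> res ` A" "x \<in> carrier R"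
    then obtain p c where pc: "a = res p" "p \<in> A" "x = res c" "c \<in> C" by (auto simp: carrier_R)
    have "c * p \<in> A" "p * c \<in> A" using C.ideal_ofD(3)[OF A pc(4,2)] by (simp_all add: mult.commute)
    then show "x \<otimes>\<^bsub>R\<^esub> a \<in> res ` A" "a \<otimes>\<^bsub>R\<^esub> x \<in> res ` A"
      unfolding pc(1,3) R_mult by blast+
  qed
qed

lemma ideal_of_preimage:
  assumes "ideal I R"
  shows "C.ideal_of {p \<in> C. res p \<in> I}"
proof -
  interpret ideal I R by (rule assms)
  show ?thesis unfolding C.ideal_of_def
  proof (intro conjI ballI)
    show "0 \<in> {p \<in> C. res p \<in> I}" using additive_subgroup.zero_closed[OF is_additive_subgroup] C.zero_closed
      by (simp add: R_zero)
    fix p q assume "p \<in> {p \<in> C. res p \<in> I}" "q \<in> {p \<in> C. res p \<in> I}"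
    then show "p + q \<in> {p \<in> C. res p \<in> I}"
      using additive_subgroup.a_closed[OF is_additive_subgroup, of "res p" "res q"] C.add_closed
      by (simp add: R_add)
  next
    fix p q assume "p \<in> C" "q \<in> {p \<in> C. res p \<in> I}"
    then show "p * q \<in> {p \<in> C. res p \<in> I}"
      using I_l_closed[of "res q" "res p"] C.mult_closed by (simp add: R_mult res_carrier)
  qed auto
qed

section \<open>Vanishing ideals and a chain of primes below the origin\<close>

definition van :: "(nat \<Rightarrow> complex) set \<Rightarrow> ((nat \<Rightarrow> complex) \<Rightarrow> complex) set" where
  "van V = {p \<in> C. \<forall>x\<in>V. p x = 0}"

lemma ideal_of_van: "C.ideal_of (van V)"
  unfolding C.ideal_of_def van_def by (auto intro: C.zero_closed C.add_closed C.mult_closed)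

lemma res_van_iff: "V \<subseteq> XX \<Longrightarrow> p \<in> C \<Longrightarrow> res p \<in> res ` van V \<longleftrightarrow> p \<in> van V"
  by (auto simp: van_def res_eq_iff subset_iff image_iff)

lemma prime_van:
  assumes cr: "cring R" and V: "V \<subseteq> XX" "V \<noteq> {}"
    and lines: "\<And>x y t. x \<in> V \<Longrightarrow> y \<in> V \<Longrightarrow> (\<lambda>k. x k + t * (y k - x k)) \<in> V"
  shows "primeideal (res ` van V) R"
proof (rule primeidealI[OF ideal_res[OF cr ideal_of_van] cr])
  have "1 \<notin> van V" using V by (auto simp: van_def)
  then have "res 1 \<notin> res ` van V" using res_van_iff[OF V(1), of 1] C.one_closed by blast
  then show "carrier R \<noteq> res ` van V" using C.one_closed res_carrier by metis
  fix f g assume "f \<in> carrier R" "g \<in> carrier R" and fg: "f \<otimes>\<^bsub>R\<^esub> g \<in> res ` van V"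
  then obtain p q where pq: "p \<in> C" "q \<in> C" "f = res p" "g = res q" by (auto simp: carrier_R)
  have "p * q \<in> van V" using fg pq res_van_iff[OF V(1), of "p * q"] C.mult_closed by (simp add: R_mult)
  then have "p x * q x = 0" if "x \<in> V" for x using that by (auto simp: van_def)
  then have "(\<forall>x\<in>V. p x = 0) \<or> (\<forall>x\<in>V. q x = 0)"
    using poly_fun_mult_eq_0[OF C_poly[OF pq(1)] C_poly[OF pq(2)] lines] by blast
  then show "f \<in> res ` van V \<or> g \<in> res ` van V"
    using pq by (auto simp: van_def)
qed

text \<open>A linear space with \<open>s\<close> free parameters, the last of them repeated in all
  further blocks. Its points have at most \<open>s\<close> distinct values, so
  \<open>theta n (Suc s)\<close> separates it from the next space; for \<open>s = 0\<close> it is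
  the origin.\<close>

definition flag :: "nat \<Rightarrow> (nat \<Rightarrow> complex) set" where
  "flag s = pt ` {z. \<forall>i\<ge>s. z i = (if s = 0 then 0 else z (s - 1))}"

lemma flag_sub: "flag s \<subseteq> XX" by (auto simp: flag_def pt_XX)

lemma flag_mono: "flag s \<subseteq> flag (Suc s)"
proof -
  have "z i = z s" if "\<forall>i\<ge>s. z i = (if s = 0 then 0 else z (s - 1))" "i \<ge> Suc s" for z :: "nat \<Rightarrow> complex" and i
  proof -
    have "z i = (if s = 0 then 0 else z (s - 1))" using that by auto
    moreover have "z s = (if s = 0 then 0 else z (s - 1))" using that(1) by blast
    ultimately show ?thesis by simp
  qed
  then show ?thesis unfolding flag_def by (intro image_mono) auto
qed

lemma flag_lines:
  assumes "x \<in> flag s" "y \<in> flag s"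
  shows "(\<lambda>k. x k + t * (y k - x k)) \<in> flag s"
proof -
  obtain z z' where z: "x = pt z" "\<forall>i\<ge>s. z i = (if s = 0 then 0 else z (s - 1))"
    "y = pt z'" "\<forall>i\<ge>s. z' i = (if s = 0 then 0 else z' (s - 1))" using assms by (auto simp: flag_def)
  have "(\<lambda>k. x k + t * (y k - x k)) = pt (\<lambda>i. z i + t * (z' i - z i))"
    using z(1,3) by (auto simp: pt_def)
  moreover have "\<forall>i\<ge>s. z i + t * (z' i - z i) = (if s = 0 then 0 else z (s - 1) + t * (z' (s - 1) - z (s - 1)))"
    using z(2,4) by (cases "s = 0") auto
  ultimately show ?thesis unfolding flag_def by blast
qed

lemma card_pt_image: "card (pt z ` {..<n}) = card (z ` {..<r})"
proof -
  have "pt z ` {..<n} = z ` \<beta> ` {..<n}" by (auto simp: pt_def image_iff)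
  then show ?thesis by (simp add: image_\<beta>)
qed

lemma flag_theta:
  assumes "s < r"
  shows "\<forall>x\<in>flag s. theta n (Suc s) x = 0" "\<exists>x\<in>flag (Suc s). theta n (Suc s) x \<noteq> 0"
proof -
  have n: "n > 0" using fibre_ex[of 0] r_ge_3 by force
  define z :: "nat \<Rightarrow> complex" where "z i = of_nat (Suc (min i s))" for i
  have ptz: "pt z \<in> flag (Suc s)" unfolding flag_def by (intro imageI) (auto simp: z_def)
  show "\<forall>x\<in>flag s. theta n (Suc s) x = 0"
  proof (cases "s = 0")
    case True
    have "x k = 0" if "x \<in> flag s" for x k using that True by (auto simp: flag_def pt_def)
    then have "(\<Sum>k<n. x k) = 0" if "x \<in> flag s" for x using that by (intro sum.neutral) blast
    then show ?thesis using True by (simp add: theta_def theta_deg_def power_0_left)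
  next
    case False
    show ?thesis
    proof
      fix x assume "x \<in> flag s"
      then obtain y where y: "x = pt y" "\<forall>i\<ge>s. y i = y (s - 1)" using False by (auto simp: flag_def)
      have "y ` {..<r} \<subseteq> y ` {..<s}"
      proof
        fix c assume "c \<in> y ` {..<r}"
        then obtain i where i: "c = y i" by blast
        show "c \<in> y ` {..<s}"
        proof (cases "i < s")
          case False
          then have "c = y (s - 1)" using y(2) i by auto
          then show ?thesis using \<open>s \<noteq> 0\<close> by simp
        qed (use i in simp)
      qed
      then have "card (y ` {..<r}) \<le> card (y ` {..<s})" by (rule card_mono[rotated]) simp
      also have "\<dots> \<le> s" using card_image_le[of "{..<s}" y] by simp
      finally have "card (x ` {..<n}) < Suc s" by (simp add: y card_pt_image)
      then show "theta n (Suc s) x = 0" using False by (intro theta_eq_0) auto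
    qed
  qed
  have "theta n (Suc s) (pt z) \<noteq> 0"
  proof (cases "s = 0")
    case True
    have "(\<Sum>k<n. pt z k) = of_nat n" using True by (simp add: pt_def z_def)
    then show ?thesis using True n by (simp add: theta_def)
  next
    case False
    have "z ` {..<r} = (\<lambda>i. of_nat (Suc i)) ` {..<Suc s}"
    proof
      show "z ` {..<r} \<subseteq> (\<lambda>i. of_nat (Suc i)) ` {..<Suc s}"
        by (auto simp: z_def intro!: image_eqI[of _ _ "min _ s"])
      show "(\<lambda>i. of_nat (Suc i)) ` {..<Suc s} \<subseteq> z ` {..<r}"
      proof
        fix c :: complex assume "c \<in> (\<lambda>i. of_nat (Suc i)) ` {..<Suc s}"
        then obtain i where i: "i < Suc s" "c = of_nat (Suc i)" by blast
        then have "c = z i" by (simp add: z_def min_def)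
        then show "c \<in> z ` {..<r}" using i assms by auto
      qed
    qed
    then have "card (z ` {..<r}) = Suc s" by (simp add: card_image inj_on_def del: of_nat_Suc)
    then show ?thesis using False by (intro theta_neq_0) (auto simp: card_pt_image)
  qed
  then show "\<exists>x\<in>flag (Suc s). theta n (Suc s) x \<noteq> 0" using ptz by blast
qed

lemma flag_0: "flag 0 = {\<lambda>_. 0}"
proof -
  have "{z. \<forall>i\<ge>0::nat. z i = (if (0::nat) = 0 then 0 else z (0 - 1))} = {\<lambda>_. 0 :: complex}" by auto
  then show ?thesis unfolding flag_def by (simp add: pt_def)
qed

definition M0 :: "((nat \<Rightarrow> complex) \<Rightarrow> complex) set" where
  "M0 = res ` van (flag 0)"

text \<open>The vanishing ideals of the flag are prime because its members are closed under lines,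
  and strictly nested because of the parameters. A lower bound on the height is enough: equality
  with the grade turns it into a long regular sequence.\<close>

lemma ht_M0:
  assumes cr: "cring R"
  shows "enat r \<le> ht R M0"
proof -
  define P where "P i = res ` van (flag (r - i))" for i
  have ne: "flag s \<noteq> {}" for s
  proof -
    have "pt (\<lambda>_. 0) \<in> flag s" unfolding flag_def by (intro imageI) auto
    then show ?thesis by blast
  qed
  have prime: "primeideal (P i) R" for i
    unfolding P_def by (rule prime_van[OF cr flag_sub ne flag_lines])
  have "P i \<subset> P (Suc i)" if i: "i < r" for i
  proof -
    define s where "s = r - Suc i"
    have s: "s < r" "r - i = Suc s" using i by (auto simp: s_def)
    have "van (flag (Suc s)) \<subseteq> van (flag s)" using flag_mono[of s] by (auto simp: van_def)
    moreover have "theta n (Suc s) \<in> C" by (rule C_sym[OF poly_fun_theta sym_fun_theta])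
    then have "res (theta n (Suc s)) \<in> res ` van (flag s)" "res (theta n (Suc s)) \<notin> res ` van (flag (Suc s))"
      using flag_theta[OF s(1)] res_van_iff[OF flag_sub] by (auto simp: van_def)
    ultimately show ?thesis unfolding P_def s(2) s_def[symmetric] by blast
  qed
  then have "enat r \<in> {enat k | k. \<exists>P. (\<forall>i\<le>k. primeideal (P i) R) \<and> (\<forall>i<k. P i \<subset> P (Suc i)) \<and> P k = M0}"
    using prime by (intro CollectI exI[of _ r] exI[of _ P] conjI refl allI impI) (simp_all add: P_def M0_def)
  then show ?thesis unfolding ht_def by (rule Sup_upper)
qed

lemma maximal_M0:
  assumes cr: "cring R"
  shows "maximalideal M0 R"
proof (rule maximalidealI)
  show "ideal M0 R" unfolding M0_def by (rule ideal_res[OF cr ideal_of_van])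
  have "1 \<notin> van (flag 0)" by (auto simp: van_def flag_0)
  then have "res 1 \<notin> M0" unfolding M0_def using res_van_iff[OF flag_sub, of 1] C.one_closed by blast
  then show "carrier R \<noteq> M0" using C.one_closed res_carrier by metis
  fix J assume J: "ideal J R" "M0 \<subseteq> J" "J \<subseteq> carrier R"
  interpret ideal J R by (rule J)
  show "J = M0 \<or> J = carrier R"
  proof (cases "J = M0")
    case False
    then obtain p where p: "p \<in> C" "res p \<in> J" "res p \<notin> M0" using J by (auto simp: carrier_R)
    define c where "c = p (\<lambda>_. 0)"
    have c: "c \<noteq> 0" using p res_van_iff[OF flag_sub, of p 0] by (auto simp: M0_def van_def flag_0 c_def)
    have d: "(\<lambda>_. 1 / c) * p \<in> C" by (intro C.mult_closed const_C p)
    have "1 - (\<lambda>_. 1 / c) * p \<in> van (flag 0)"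
      using c d by (auto simp: van_def flag_0 c_def intro!: C.diff_closed C.one_closed)
    then have "res (1 - (\<lambda>_. 1 / c) * p) \<in> J" using J(2) unfolding M0_def by blast
    moreover have "res ((\<lambda>_. 1 / c) * p) \<in> J"
      using I_l_closed[OF p(2) res_carrier[OF const_C[of "1 / c"]]] by (simp add: R_mult)
    ultimately have "res (1 - (\<lambda>_. 1 / c) * p) \<oplus>\<^bsub>R\<^esub> res ((\<lambda>_. 1 / c) * p) \<in> J"
      by (rule additive_subgroup.a_closed[OF is_additive_subgroup])
    then have "\<one>\<^bsub>R\<^esub> \<in> J" by (simp add: R_add R_one)
    then show ?thesis using one_imp_carrier by blast
  qed simp
qed

text \<open>The grade is a supremum, so this yields a sequence of length at least \<open>r\<close>;
  its first \<open>r\<close> elements are the ones used later.\<close>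

lemma cm_regular_seq:
  assumes cm: "cohen_macaulay R"
  obtains a k where "r \<le> k" "\<And>i. i < k \<Longrightarrow> a i \<in> M0" "regular_seq R a k"
proof -
  have cr: "cring R" using cm by (simp add: cohen_macaulay_def)
  have "enat r \<le> grade R M0"
    using cm maximal_M0[OF cr] ht_M0[OF cr] by (simp add: cohen_macaulay_def)
  have "\<exists>k a. r \<le> k \<and> (\<forall>i<k. a i \<in> M0) \<and> regular_seq R a k"
  proof (rule ccontr)
    assume no: "\<not> ?thesis"
    have "grade R M0 \<le> enat (r - 1)"
      unfolding grade_def
    proof (rule Sup_least)
      fix x assume "x \<in> {enat k | k. \<exists>a. (\<forall>i<k. a i \<in> M0) \<and> regular_seq R a k}"
      then obtain k a where k: "x = enat k" "\<forall>i<k. a i \<in> M0" "regular_seq R a k" by blast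
      then have "\<not> r \<le> k" using no by blast
      then have "k \<le> r - 1" by linarith
      then show "x \<le> enat (r - 1)" using k(1) by simp
    qed
    with \<open>enat r \<le> grade R M0\<close> have "enat r \<le> enat (r - 1)" by (rule order_trans)
    then show False using r_ge_3 by simp
  qed
  then show ?thesis using that by blast
qed

lemma sum_reverse: "(\<Sum>i<m. f (m - i)) = (\<Sum>j\<in>{1..m::nat}. f j)"
  by (rule sum.reindex_bij_witness[of _ "\<lambda>j. m - j" "\<lambda>i. m - i"]) auto

text \<open>The regular sequence \<open>a\<close> and the parameters \<open>ts\<close> are linked
  only through \<open>rad\<close>: by \<open>theta_radical\<close> some power of each
  \<open>a j\<close> lies in the ideal of \<open>ts\<close>. Their common length \<open>r\<close>
  lets the induction of \<open>koszul_exact\<close> descend to \<open>J 0\<close>, the functions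
  vanishing on the arrangement.\<close>

lemma not_cm: "\<not> cohen_macaulay R"
proof
  assume cm: "cohen_macaulay R"
  then have cr: "cring R" by (simp add: cohen_macaulay_def)
  interpret R: cring R by (rule cr)
  obtain a0 m where m: "r \<le> m" and a0: "\<And>i. i < m \<Longrightarrow> a0 i \<in> M0" "regular_seq R a0 m"
    using cm_regular_seq[OF cm] by blast
  have "\<exists>p. p \<in> van (flag 0) \<and> a0 i = res p" if "i < r" for i
    using a0(1)[of i] that m unfolding M0_def by auto
  then obtain a where a: "\<And>i. i < r \<Longrightarrow> a i \<in> van (flag 0)" "\<And>i. i < r \<Longrightarrow> a0 i = res (a i)"
    by metis
  have aC: "a i \<in> C" "a i (\<lambda>_. 0) = 0" if "i < r" for i
    using a(1)[OF that] by (auto simp: van_def flag_0)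
  have a0c: "a0 ` {..<j} \<subseteq> carrier R" if "j \<le> r" for j
    using a(2) aC(1) that by (auto intro!: res_carrier)
  \<comment> \<open>The two top parameters carry the relation and keep exponent \<open>1\<close>.
    The other exponents exceed the degree \<open>card offT * 3 + 5\<close> of \<open>wit\<close> by
    two, as \<open>no_equation\<close> requires.\<close>
  define e where "e s = (if s \<ge> r - 1 then 1 else card offT * 3 + 7)" for s
  define tt where "tt s x = theta n s x ^ e s" for s x
  have tt_sym: "sym_fun n (tt s)" for s using sym_fun_theta[of n s] by (simp add: tt_def sym_fun_def)
  have tt_poly: "poly_fun n (tt s)" for s
    unfolding tt_def[abs_def] by (rule poly_fun_power[OF poly_fun_theta])
  have ttC: "tt s \<in> C" for s by (rule C_sym[OF tt_poly tt_sym])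
  define us where "us = map (\<lambda>i. tt (r - 2 - i)) [0..<r - 2]"
  define ts where "ts = tt r # tt (r - 1) # us"
  have len: "length ts = r" using r_ge_3 by (simp add: ts_def us_def)
  have ts_nth: "ts ! i = tt (r - i)" if "i < r" for i
  proof -
    consider "i = 0" | "i = 1" | k where "i = Suc (Suc k)" by (metis One_nat_def not0_implies_Suc)
    then show ?thesis
    proof cases
      case 3
      have "k < r - 2" using that 3 by linarith
      then show ?thesis using 3 by (simp add: ts_def us_def)
    qed (simp_all add: ts_def)
  qed
  define I where "I j = genideal R (a0 ` {..<j})" for j
  define J where "J j = {p \<in> C. res p \<in> I j}" for j
  have idI: "ideal (I j) R" if "j \<le> r" for j
    unfolding I_def by (rule R.genideal_ideal[OF a0c[OF that]])
  have idJ: "C.ideal_of (J j)" if "j \<le> r" for j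
    unfolding J_def by (rule ideal_of_preimage[OF idI[OF that]])
  have J0: "p x = 0" if "p \<in> J 0" "x \<in> XX" for p x
  proof -
    have "I 0 \<subseteq> {\<zero>\<^bsub>R\<^esub>}"
      unfolding I_def by (rule R.genideal_minimal[OF R.zeroideal]) simp
    then have "res p = res 0" using that by (auto simp: J_def R_zero)
    then show ?thesis using that(2) unfolding res_eq_iff by simp
  qed
  have J0I: "p \<in> J 0" if "p \<in> C" "\<And>x. x \<in> XX \<Longrightarrow> p x = 0" for p
  proof -
    have "res p = \<zero>\<^bsub>R\<^esub>" unfolding R_zero res_eq_iff using that(2) by simp
    then have "res p \<in> I 0"
      using additive_subgroup.zero_closed[OF ideal.axioms(1)[OF idI[of 0]]] by simp
    then show ?thesis using that(1) by (simp add: J_def)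
  qed
  have mono: "J j \<subseteq> J (Suc j)" if "j < r" for j
  proof -
    have "I j \<subseteq> I (Suc j)" unfolding I_def
      by (rule R.genideal_minimal[OF R.genideal_ideal[OF a0c]], use that in simp)
         (use R.genideal_self[OF a0c[of "Suc j"]] that in auto)
    then show ?thesis by (auto simp: J_def)
  qed
  have aJ: "a j \<in> J (Suc j)" if "j < r" for j
  proof -
    have "a0 j \<in> I (Suc j)" unfolding I_def using R.genideal_self[OF a0c[of "Suc j"]] that by auto
    then show ?thesis using aC[OF that] a(2)[OF that] by (simp add: J_def)
  qed
  have reg: "x \<in> J j" if "j < r" "x \<in> C" "a j * x \<in> J j" for j x
  proof -
    have "a0 j \<otimes>\<^bsub>R\<^esub> res x \<in> I j"
      using that a(2)[OF that(1)] by (simp add: J_def R_mult)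
    moreover have "j < m" using that m by simp
    ultimately have "res x \<in> I j"
      using a0(2) res_carrier[OF that(2)] unfolding regular_seq_def I_def by blast
    then show ?thesis using that by (simp add: J_def)
  qed
  have dec: "\<exists>y\<in>C. x - a j * y \<in> J j" if j: "j < r" and x: "x \<in> J (Suc j)" for j x
  proof -
    \<comment> \<open>The elements that are multiples of \<open>a j\<close> modulo
      \<open>J j\<close> form an ideal containing the generators of
      \<open>I (Suc j)\<close>.\<close>
    define A where "A = {p \<in> C. \<exists>y\<in>C. p - a j * y \<in> J j}"
    have jr: "j \<le> r" using j by simp
    have "C.ideal_of A"
      unfolding C.ideal_of_def
    proof (intro conjI ballI)
      show "A \<subseteq> C" by (auto simp: A_def)
      show "0 \<in> A" unfolding A_def using C.zero_closed C.ideal_ofD(1)[OF idJ[OF jr]]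
        by (auto intro!: bexI[of _ 0])
      fix p q assume "p \<in> A" "q \<in> A"
      then obtain y z where pq: "p \<in> C" "q \<in> C" "y \<in> C" "z \<in> C"
        and J: "p - a j * y \<in> J j" "q - a j * z \<in> J j" by (auto simp: A_def)
      have "p + q - a j * (y + z) = (p - a j * y) + (q - a j * z)" by (simp add: algebra_simps)
      with C.ideal_ofD(2)[OF idJ[OF jr] J] have "p + q - a j * (y + z) \<in> J j" by (simp only:)
      then show "p + q \<in> A" unfolding A_def using C.add_closed pq by blast
    next
      fix c p assume "c \<in> C" "p \<in> A"
      then obtain y where y: "p \<in> C" "y \<in> C" and J: "p - a j * y \<in> J j" by (auto simp: A_def)
      have "c * p - a j * (c * y) = c * (p - a j * y)" by (simp add: algebra_simps)
      with C.ideal_ofD(3)[OF idJ[OF jr] \<open>c \<in> C\<close> J] have "c * p - a j * (c * y) \<in> J j" by (simp only:)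
      then show "c * p \<in> A" unfolding A_def using C.mult_closed[OF \<open>c \<in> C\<close>] y by blast
    qed
    then have idA: "ideal (res ` A) R" by (rule ideal_res[OF cr])
    have "a0 i \<in> res ` A" if i: "i < Suc j" for i
    proof (cases "i = j")
      case True
      have "a j - a j * 1 \<in> J j" using C.ideal_ofD(1)[OF idJ[OF jr]] by simp
      then have "a j \<in> A" unfolding A_def using aC[OF j] C.one_closed by blast
      then show ?thesis using a(2)[OF j] True by blast
    next
      case False
      then have ij: "i < j" using i by simp
      have "a0 i \<in> I j" unfolding I_def using R.genideal_self[OF a0c[OF jr]] ij by auto
      then have "a i \<in> J j" using aC(1)[of i] a(2)[of i] ij j by (simp add: J_def)
      then have "a i \<in> A" unfolding A_def using aC(1)[of i] ij j C.zero_closed by (auto intro!: bexI[of _ 0])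
      then show ?thesis using a(2)[of i] ij j by auto
    qed
    then have "I (Suc j) \<subseteq> res ` A" unfolding I_def by (intro R.genideal_minimal[OF idA]) auto
    then obtain p where p: "p \<in> A" "res x = res p" using x by (auto simp: J_def)
    then obtain y where y: "y \<in> C" "p - a j * y \<in> J j" "p \<in> C" by (auto simp: A_def)
    have xC: "x \<in> C" using x by (simp add: J_def)
    have "res (x - a j * y) = res (p - a j * y)" using p(2) by (simp add: res_eq_iff)
    moreover have "x - a j * y \<in> C" by (intro C.diff_closed C.mult_closed xC aC(1)[OF j] y)
    ultimately have "x - a j * y \<in> J j" using y(2) by (simp add: J_def)
    then show ?thesis using y(1) by blast
  qed
  have rad: "\<exists>N u. (\<forall>i. u i \<in> C) \<and> a j ^ N - (\<Sum>i<length ts. u i * ts ! i) \<in> J 0" if j: "j < length ts" for j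
  proof -
    have jr: "j < r" using j len by simp
    have n: "n > 0" using fibre_ex[of 0] r_ge_3 by force
    obtain N c where c: "\<And>s. poly_fun n (c s)" "\<And>x. card (x ` {..<n}) \<le> r \<Longrightarrow>
        a j x ^ N = (\<Sum>s\<in>{1..r}. theta n s x ^ e s * c s x)"
    proof -
      have "e s > 0" for s by (simp add: e_def)
      moreover have "r \<ge> 1" using r_ge_3 by simp
      ultimately show ?thesis
        using theta_radical[OF _ n _ C_poly[OF aC(1)[OF jr]] aC(2)[OF jr], of e r] that by blast
    qed
    have aN: "a j ^ N \<in> C" using C.power_closed aC(1)[OF jr] by blast
    have "(a j ^ N) x = (\<Sum>s\<in>{1..r}. tt s x * c s x)" if "x \<in> XX" for x
      using c(2)[OF card_XX[OF that]] by (simp add: power_fun_apply tt_def)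
    \<comment> \<open>The coefficients obtained so far are merely polynomial; since the parameters
      are symmetric, \<open>retract\<close> replaces them by coefficients in
      \<open>C\<close>.\<close>
    from retract[OF aN c(1) tt_sym this] obtain c' where c': "\<And>s. c' s \<in> C"
      "\<And>x. x \<in> XX \<Longrightarrow> (a j ^ N) x = (\<Sum>s\<in>{1..r}. tt s x * c' s x)" by blast
    have sum: "(\<Sum>i<length ts. c' (r - i) * ts ! i) = (\<Sum>s\<in>{1..r}. c' s * tt s)"
    proof -
      have "(\<Sum>i<length ts. c' (r - i) * ts ! i) = (\<Sum>i<r. c' (r - i) * tt (r - i))"
        unfolding len by (intro sum.cong) (auto simp: ts_nth)
      then show ?thesis using sum_reverse[of "\<lambda>s. c' s * tt s" r] by simp
    qed
    have "a j ^ N - (\<Sum>i<length ts. c' (r - i) * ts ! i) \<in> J 0"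
      unfolding sum
    proof (rule J0I)
      show "a j ^ N - (\<Sum>s = 1..r. c' s * tt s) \<in> C"
        by (intro C.diff_closed C.sum_closed C.mult_closed aN c' ttC)
      show "(a j ^ N - (\<Sum>s = 1..r. c' s * tt s)) x = 0" if "x \<in> XX" for x
        using c'(2)[OF that] by (simp add: sum_fun_apply mult.commute)
    qed
    then show ?thesis using c'(1) by (intro exI[of _ N] exI[of _ "\<lambda>i. c' (r - i)"] conjI allI)
  qed
  obtain g where g: "poly_fun n g" "sym_fun n g" "\<And>z. g (pt z) = theta n r (pt z) * wit z"
    using lifts_theta_top unfolding lifts_def by blast
  obtain h where h: "poly_fun n h" "sym_fun n h" "\<And>z. h (pt z) = theta n (r - 1) (pt z) * wit z"
    using lifts_theta_second unfolding lifts_def by blast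
  have gC: "g \<in> C" "h \<in> C" using C_sym g h by auto
  have e1: "e r = 1" "e (r - 1) = 1" by (auto simp: e_def)
  have gh: "tt r * h - tt (r - 1) * g \<in> J 0"
  proof (rule J0I)
    show "tt r * h - tt (r - 1) * g \<in> C" by (intro C.diff_closed C.mult_closed ttC gC)
    show "(tt r * h - tt (r - 1) * g) x = 0" if "x \<in> XX" for x
    proof (rule sym_eq_XX[OF _ _ _ that])
      show "sym_fun n (tt r * h - tt (r - 1) * g)"
        using tt_sym[of r] tt_sym[of "r - 1"] g(2) h(2) by (simp add: sym_fun_def)
      show "(tt r * h - tt (r - 1) * g) (pt z) = (\<lambda>_. 0) (pt z)" for z
        unfolding tt_def minus_apply times_fun_apply e1 g(3) h(3) by simp
    qed (simp add: sym_fun_def)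
  qed
  have lenr: "j \<le> length ts \<longleftrightarrow> j \<le> r" "j < length ts \<longleftrightarrow> j < r" for j by (simp_all add: len)
  have tsC: "set ts \<subseteq> C" using ttC by (auto simp: ts_def us_def)
  have "\<exists>b v. b \<in> C \<and> (\<forall>i. v i \<in> C) \<and> g - (tt r * b + (\<Sum>i<length us. us ! i * v i)) \<in> J 0"
    by (rule C.syzygy_mod_rest[of "tt r" "tt (r - 1)" us J a g h])
       (use idJ mono aC aJ reg dec tsC rad gC gh in \<open>simp_all only: ts_def[symmetric] lenr\<close>)
  then obtain b v where b: "b \<in> C" and v: "\<And>i. v i \<in> C"
    and eq: "g - (tt r * b + (\<Sum>i<length us. us ! i * v i)) \<in> J 0" by blast
  have us_nth: "us ! i = tt (r - 2 - i)" if "i < r - 2" for i using that by (simp add: us_def)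
  have pt_eq: "g x = tt r x * b x + (\<Sum>i<r - 2. tt (r - 2 - i) x * v i x)" if x: "x \<in> XX" for x
  proof -
    have "(g - (tt r * b + (\<Sum>i<length us. us ! i * v i))) x = 0" by (rule J0[OF eq x])
    moreover have "(\<Sum>i<length us. us ! i * v i) = (\<Sum>i<r - 2. tt (r - 2 - i) * v i)"
      by (intro sum.cong) (auto simp: us_def)
    ultimately show ?thesis by (simp add: sum_fun_apply)
  qed
  \<comment> \<open>Only a symmetric \<open>b\<close> can be expanded in power sums, so the equation
    is averaged; the parameters are symmetric and pass through. The reversal in \<open>v'\<close>
    attaches \<open>v' j\<close> to the parameter with index \<open>j\<close>.\<close>
  define b' where "b' = sym_avg n b"
  define v' where "v' j = sym_avg n (v (r - 2 - j))" for j
  have avg: "g x = tt r x * b' x + (\<Sum>i<r - 2. tt (r - 2 - i) x * v' (r - 2 - i) x)" if x: "x \<in> XX" for x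
  proof -
    have "sym_avg n (\<lambda>x. g x - (tt r x * b x + (\<Sum>i<r - 2. tt (r - 2 - i) x * v i x))) x = 0"
      by (rule sym_avg_eq) (use pt_eq[OF X_permute[OF x]] in simp)
    then have "g x = tt r x * b' x + (\<Sum>i<r - 2. tt (r - 2 - i) x * sym_avg n (v i) x)"
      unfolding sym_avg_diff sym_avg_add sym_avg_sum sym_avg_mult_left[OF tt_sym] sym_avg_sym[OF g(2)] b'_def
      by simp
    moreover have "v' (r - 2 - i) = sym_avg n (v i)" if "i < r - 2" for i
    proof -
      have "r - 2 - (r - 2 - i) = i" using that by linarith
      then show ?thesis by (simp only: v'_def)
    qed
    ultimately show ?thesis by simp
  qed
  show False
  proof (rule no_equation[OF g(3), of b' v' "{1..r - 2}" e])
    show "poly_fun n b'" unfolding b'_def by (rule poly_fun_sym_avg[OF C_poly[OF b]])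
    show "sym_fun n b'" unfolding b'_def by (rule sym_fun_sym_avg)
    show "poly_fun n (v' j)" for j unfolding v'_def by (rule poly_fun_sym_avg[OF C_poly[OF v]])
    show "card offT * 3 + 7 \<le> e j" if "j \<in> {1..r - 2}" for j
    proof -
      have "\<not> r - 1 \<le> j" using that r_ge_3 by auto
      then show ?thesis by (simp add: e_def)
    qed
    show "g (pt z) = theta n r (pt z) * b' (pt z) + (\<Sum>j\<in>{1..r - 2}. theta n j (pt z) ^ e j * v' j (pt z))" for z
      using avg[OF pt_XX] sum_reverse[of "\<lambda>j. tt j (pt z) * v' j (pt z)" "r - 2"]
      by (simp add: tt_def e1)
  qed simp
qed

end

section \<open>Partitions\<close>

lemma sum_list_take_mono: "j \<le> j' \<Longrightarrow> sum_list (take j lam) \<le> sum_list (take j' (lam :: nat list))"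
  by (metis le_add1 le_iff_add sum_list_append take_add)

lemma blk_eq_iff:
  assumes k: "k < sum_list lam" and j: "j < length lam"
  shows "blk lam k = j \<longleftrightarrow> sum_list (take j lam) \<le> k \<and> k < sum_list (take (Suc j) lam)"
proof
  assume b: "blk lam k = j"
  have "k < sum_list (take (Suc (length lam)) lam)" using k by simp
  then have "k < sum_list (take (Suc (blk lam k)) lam)" unfolding blk_def by (rule LeastI)
  moreover have "sum_list (take j lam) \<le> k"
  proof (cases j)
    case (Suc i)
    then have "i < blk lam k" using b by simp
    then have "\<not> k < sum_list (take (Suc i) lam)" unfolding blk_def by (rule not_less_Least)
    then show ?thesis using Suc by simp
  qed simp
  ultimately show "sum_list (take j lam) \<le> k \<and> k < sum_list (take (Suc j) lam)" using b by simp
next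
  assume a: "sum_list (take j lam) \<le> k \<and> k < sum_list (take (Suc j) lam)"
  show "blk lam k = j" unfolding blk_def
  proof (rule Least_equality)
    show "k < sum_list (take (Suc j) lam)" using a by simp
    fix i assume i: "k < sum_list (take (Suc i) lam)"
    show "j \<le> i"
    proof (rule ccontr)
      assume "\<not> j \<le> i"
      then have "sum_list (take (Suc i) lam) \<le> sum_list (take j lam)"
        by (intro sum_list_take_mono) simp
      then show False using a i by simp
    qed
  qed
qed

lemma blk_less:
  assumes "k < sum_list lam"
  shows "blk lam k < length lam"
proof -
  have "lam \<noteq> []" using assms by auto
  then have "k < sum_list (take (Suc (length lam - 1)) lam)" using assms by simp
  then have "blk lam k \<le> length lam - 1" unfolding blk_def by (rule Least_le)
  then show ?thesis using \<open>lam \<noteq> []\<close> by (cases lam) auto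
qed

lemma card_blk:
  assumes j: "j < length lam"
  shows "card {k. k < sum_list lam \<and> blk lam k = j} = lam ! j"
proof -
  have le: "sum_list (take (Suc j) lam) \<le> sum_list lam"
    using sum_list_take_mono[of "Suc j" "length lam" lam] j by simp
  have "{k. k < sum_list lam \<and> blk lam k = j} = {sum_list (take j lam)..<sum_list (take (Suc j) lam)}"
  proof (rule Set.set_eqI)
    fix k
    show "k \<in> {k. k < sum_list lam \<and> blk lam k = j} \<longleftrightarrow>
        k \<in> {sum_list (take j lam)..<sum_list (take (Suc j) lam)}"
    proof (cases "k < sum_list lam")
      case True
      show ?thesis using blk_eq_iff[OF True j] True by simp
    qed (use le in auto)
  qed
  then show ?thesis using j by (simp add: take_Suc_conv_app_nth)
qed

text \<open>Let \<open>a > b > c > d\<close> be the four largest parts. A sum involving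
  \<open>a\<close> exceeds every part, and \<open>b + c\<close> exceeds \<open>b\<close>, so it can
  only be a part if it equals \<open>a\<close>. In that case \<open>d\<close> replaces
  \<open>c\<close>, since \<open>b + d\<close> lies strictly between \<open>b\<close> and
  \<open>a\<close>.\<close>

lemma exists_triple:
  fixes lam :: "nat list"
  assumes pos: "0 \<notin> set lam"
    and parts: "card (set lam) \<ge> 4 \<or>
         (\<exists>a b c. set lam = {a, b, c} \<and> a > b \<and> b > c \<and> a \<noteq> b + c)"
  obtains a b c where "{a, b, c} \<subseteq> set lam" "a \<noteq> b" "a \<noteq> c" "b \<noteq> c"
    "a + b \<notin> set lam" "a + c \<notin> set lam" "b + c \<notin> set lam"
proof (cases "card (set lam) \<ge> 4")
  case True
  define S where "S = set lam"
  have S: "finite S" "card S \<ge> 4" "0 \<notin> S" using True pos by (auto simp: S_def)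
  have ex: "\<exists>x\<in>S - A. \<forall>y\<in>S - A. y \<le> x" if "card A < 4" "finite A" for A
  proof -
    have ne: "S - A \<noteq> {}"
    proof
      assume "S - A = {}"
      then have "card S \<le> card A" using card_mono[OF that(2), of S] by blast
      then show False using S that by simp
    qed
    have "finite (S - A)" using S(1) by simp
    then show ?thesis using Max_in[OF _ ne] by (intro bexI[of _ "Max (S - A)"]) auto
  qed
  obtain a where a: "a \<in> S" "\<And>y. y \<in> S \<Longrightarrow> y \<le> a" using ex[of "{}"] by auto
  obtain b where b: "b \<in> S" "b \<noteq> a" "\<And>y. y \<in> S \<Longrightarrow> y \<noteq> a \<Longrightarrow> y \<le> b" using ex[of "{a}"] by auto
  obtain c where c: "c \<in> S" "c \<noteq> a" "c \<noteq> b"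
    "\<And>y. y \<in> S \<Longrightarrow> y \<noteq> a \<Longrightarrow> y \<noteq> b \<Longrightarrow> y \<le> c" using ex[of "{a, b}"] b by auto
  obtain d where d: "d \<in> S" "d \<noteq> a" "d \<noteq> b" "d \<noteq> c"
    using ex[of "{a, b, c}"] b c by auto
  have pos': "b > 0" "c > 0" "d > 0" using b c d S(3) by (auto intro: gr0I)
  have lt: "b < a" "c < b" "d < c"
    using a(2)[OF b(1)] b(2,3) c d by (auto simp: order_less_le)
  have big: "y \<notin> S" if "y > a" for y using a(2)[of y] that by auto
  have mid: "y \<notin> S" if "y > b" "y \<noteq> a" for y using b(3)[of y] that by auto
  show ?thesis
  proof (cases "b + c = a")
    case False
    show ?thesis
      by (rule that[of a b c]) (use a b c pos' lt big[of "a + b"] big[of "a + c"] mid[of "b + c"] False in \<open>auto simp: S_def\<close>)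
  next
    case True
    show ?thesis
      by (rule that[of a b d]) (use a b d pos' lt big[of "a + b"] big[of "a + d"] mid[of "b + d"] True in \<open>auto simp: S_def\<close>)
  qed
next
  case False
  then obtain a b c where abc: "set lam = {a, b, c}" "a > b" "b > c" "a \<noteq> b + c" using parts by blast
  then have "c > 0" using pos by auto
  then show ?thesis using abc by (intro that[of a b c]) auto
qed

lemma (in triple) fun_subring_poly: "fun_subring n r \<beta> L i1 i2 i3 {p. poly_fun n p}"
proof (rule fun_subring.intro[OF triple_axioms], rule fun_subring_axioms.intro)
  show "subring_set {p. poly_fun n p}" by (rule subring_poly_fun)
qed auto

lemma (in triple) fun_subring_sym_poly:
  "fun_subring n r \<beta> L i1 i2 i3 {p. poly_fun n p \<and> sym_fun n p}"
proof (rule fun_subring.intro[OF triple_axioms], rule fun_subring_axioms.intro)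
  show "subring_set {p. poly_fun n p \<and> sym_fun n p}" by (rule subring_sym_poly_fun)
next
  fix a c and th :: "nat \<Rightarrow> (nat \<Rightarrow> complex) \<Rightarrow> complex" and J
  assume a: "a \<in> {p. poly_fun n p \<and> sym_fun n p}" and c: "\<And>j. poly_fun n (c j)"
    and th: "\<And>j. sym_fun n (th j)" and eq: "\<And>x. x \<in> XX \<Longrightarrow> a x = (\<Sum>j\<in>J. th j x * c j x)"
  have "a x = (\<Sum>j\<in>J. th j x * sym_avg n (c j) x)" if x: "x \<in> XX" for x
  proof -
    have "sym_avg n (\<lambda>x. a x - (\<Sum>j\<in>J. th j x * c j x)) x = 0"
      by (rule sym_avg_eq) (use eq[OF X_permute[OF x]] in simp)
    then show ?thesis
      using a by (simp add: sym_avg_diff sym_avg_sum sym_avg_mult_left[OF th] sym_avg_sym)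
  qed
  then show "\<exists>c'. (\<forall>j. c' j \<in> {p. poly_fun n p \<and> sym_fun n p}) \<and> (\<forall>x\<in>XX. a x = (\<Sum>j\<in>J. th j x * c' j x))"
    using poly_fun_sym_avg[OF c] sym_fun_sym_avg by (intro exI[of _ "\<lambda>j. sym_avg n (c j)"]) auto
qed auto

lemma E_lam_eq:
  assumes "blocks (sum_list lam) (length lam) (blk lam) ((!) lam)"
  shows "E_lam lam = range (blocks.pt (sum_list lam) (blk lam))"
proof -
  interpret blocks "sum_list lam" "length lam" "blk lam" "(!) lam" by (rule assms)
  show ?thesis
  proof
    show "range pt \<subseteq> E_lam lam" by (auto simp: E_lam_def cspace_def pt_def)
    show "E_lam lam \<subseteq> range pt"
    proof
      fix x assume x: "x \<in> E_lam lam"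
      define z where "z i = x (SOME k. k < sum_list lam \<and> blk lam k = i)" for i
      have "x k = pt z k" for k
      proof (cases "k < sum_list lam")
        case True
        have "(SOME l. l < sum_list lam \<and> blk lam l = blk lam k) < sum_list lam \<and>
            blk lam (SOME l. l < sum_list lam \<and> blk lam l = blk lam k) = blk lam k"
          by (rule someI[of _ k]) (use True in simp)
        then have "x (SOME l. l < sum_list lam \<and> blk lam l = blk lam k) = x k"
          using x True unfolding E_lam_def by blast
        then show ?thesis using True by (simp add: pt_def z_def)
      next
        case False
        then show ?thesis using x by (simp add: E_lam_def cspace_def pt_def)
      qed
      then have "x = pt z" by blast
      then show "x \<in> range pt" by blast
    qed
  qed
qed

theorem theorem7p1:
  fixes lam :: "nat list" and n :: nat
  assumes "is_partition lam n"
    and "card (set lam) \<ge> 4 \<or>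
         (\<exists>a b c. set lam = {a, b, c} \<and> a > b \<and> b > c \<and> a \<noteq> b + c)"
  shows "\<not> cohen_macaulay (inv_coord_ring lam) \<and> \<not> cohen_macaulay (coord_ring lam)"
proof -
  have pos: "0 \<notin> set lam" using assms(1) by (simp add: is_partition_def)
  obtain a b c where abc: "{a, b, c} \<subseteq> set lam" "a \<noteq> b" "a \<noteq> c" "b \<noteq> c"
    "a + b \<notin> set lam" "a + c \<notin> set lam" "b + c \<notin> set lam"
    using exists_triple[OF pos assms(2)] by blast
  obtain i1 i2 i3 where i: "i1 < length lam" "lam ! i1 = a" "i2 < length lam" "lam ! i2 = b"
    "i3 < length lam" "lam ! i3 = c"
    using abc(1) by (auto simp: in_set_conv_nth)
  have B: "blocks (sum_list lam) (length lam) (blk lam) ((!) lam)"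
  proof
    show "lam ! i > 0" if "i < length lam" for i using nth_mem[OF that] pos by (metis gr0I)
  qed (auto intro: blk_less card_blk)
  interpret triple "sum_list lam" "length lam" "blk lam" "(!) lam" i1 i2 i3
  proof (rule triple.intro[OF B], rule triple_axioms.intro)
    fix k assume "k < length lam"
    then have "lam ! k \<in> set lam" by simp
    then show "lam ! k \<noteq> lam ! i1 + lam ! i2" "lam ! k \<noteq> lam ! i1 + lam ! i3" "lam ! k \<noteq> lam ! i2 + lam ! i3"
      using abc(5-7) i by metis+
  qed (use i abc in auto)
  have X: "X_lam lam = XX"
    unfolding X_lam_def XX_def E_lam_eq[OF B] by blast
  have "\<not> cohen_macaulay (fun_ring XX {restrict p XX | p. p \<in> {p. poly_fun (sum_list lam) p}})"
    by (rule fun_subring.not_cm[OF fun_subring_poly])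
  then have 1: "\<not> cohen_macaulay (coord_ring lam)" by (simp add: coord_ring_def X)
  have "{f \<in> carrier (coord_ring lam). \<forall>\<sigma>. \<sigma> permutes {..<sum_list lam} \<longrightarrow>
        (\<forall>x\<in>X_lam lam. f (x \<circ> \<sigma>) = f x)}
      = {restrict p XX | p. p \<in> {p. poly_fun (sum_list lam) p \<and> sym_fun (sum_list lam) p}}" (is "?A = ?B")
  proof
    show "?B \<subseteq> ?A"
      by (auto simp: coord_ring_def fun_ring_def X X_permute sym_fun_def)
    show "?A \<subseteq> ?B"
    proof
      fix f assume f: "f \<in> ?A"
      then obtain p where p: "poly_fun (sum_list lam) p" "f = restrict p XX"
        by (auto simp: coord_ring_def fun_ring_def X)
      \<comment> \<open>An invariant function on the arrangement may be represented by a polynomial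
        that is not symmetric elsewhere; its average is symmetric and has the same
        restriction.\<close>
      have "sym_avg (sum_list lam) p x = p x" if x: "x \<in> XX" for x
      proof (rule sym_avg_eq)
        fix \<sigma> assume s: "\<sigma> permutes {..<sum_list lam}"
        then have "f (x \<circ> \<sigma>) = f x" using f x by (simp add: X)
        then show "p (x \<circ> \<sigma>) = p x" using x X_permute[OF x s] by (simp add: p(2))
      qed
      then have "f = restrict (sym_avg (sum_list lam) p) XX" unfolding p(2) by (intro restrict_ext) simp
      then show "f \<in> ?B" using poly_fun_sym_avg[OF p(1)] sym_fun_sym_avg by blast
    qed
  qed
  moreover have "\<not> cohen_macaulay (fun_ring XX {restrict p XX | p. p \<in> {p. poly_fun (sum_list lam) p \<and> sym_fun (sum_list lam) p}})"
    by (rule fun_subring.not_cm[OF fun_subring_sym_poly])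
  ultimately have 2: "\<not> cohen_macaulay (inv_coord_ring lam)" unfolding inv_coord_ring_def X by simp
  show ?thesis using 1 2 by blast
qed

end
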